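(* Let $k,m,n,N$ be positive integers. Let $L$ be an even positive definite lattice of rank $n$ containing a sublattice isometric to $\bigoplus_{j=1}^nA_1(d_j)$, where $d_1,\dots,d_n$ are positive integers with $d_i\le d_j$ for $1\le i<j\le n$. Let $\Gamma\le\mathrm{SL}_2(\mathbb Z)$ be a congruence subgroup and $\chi:\Gamma\to\mathbb C^\times$ a character of finite order. Put $C_n=3^{-2^{-n}}\cdot2^{1-3\cdot2^{-n}}$. If $k<3\cdot2^{3-2^n}\cdot d_1m$ and $$N>C_n\cdot[\mathrm{SL}_2(\mathbb Z):\Gamma]\cdot\prod_{j=1}^nd_j^{2^{j-1-n}}\cdot k^{2^{-n}}m^{1-2^{-n}},$$ then $J_{k,L,m}(\Gamma,\chi)[q^N]=0$.
   Context: $L$ has bilinear form $\langle\cdot,\cdot\rangle$ (even: $\langle v,v\rangle\in2\mathbb Z$) and dual $L'$; $A_1(d)$ is $\mathbb Z$ with form $2dx^2$. For $A=\begin{pmatrix}a&b\\c&d\end{pmatrix}\in\mathrm{SL}_2(\mathbb Z)$: $(\varphi|_{k,m}A)(\tau,\mathfrak z)=(c\tau+d)^{-k}e^{-\pi im\frac{c\langle\mathfrak z,\mathfrak z\rangle}{c\tau+d}}\varphi\big(\frac{a\tau+b}{c\tau+d},\frac{\mathfrak z}{c\tau+d}\big)$. $J_{k,L,m}(\Gamma,\chi)$ is the space of holomorphic $\varphi:\mathbb H\times(L\otimes\mathbb C)\to\mathbb C$ with $\varphi|_{k,m}A=\chi(A)\varphi$ for $A\in\Gamma$, $e^{\pi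 im(\langle x,x\rangle\tau+2\langle x,\mathfrak z\rangle)}\varphi(\tau,\mathfrak z+x\tau+y)=\varphi(\tau,\mathfrak z)$ for $x,y\in L$, and such that for every $\gamma\in\mathrm{SL}_2(\mathbb Z)$, $\varphi|_{k,m}\gamma=\sum f_\gamma(n,\ell)e^{2\pi i(n\tau+\langle\ell,\mathfrak z\rangle)}$ ($\ell\in L'$, $n\ge0$ rational with bounded denominators) with $f_\gamma(n,\ell)=0$ unless $2nm\ge\langle\ell,\ell\rangle$. Writing $\varphi=\sum_nc_n(\mathfrak z)e^{2\pi in\tau}$, $\mathrm{ord}_\infty(\varphi)$ is the least $n$ with $c_n\not\equiv0$ ($\infty$ if $\varphi=0$), and $J_{k,L,m}(\Gamma,\chi)[q^N]=\{\varphi:\mathrm{ord}_\infty(\varphi)\ge N\}$. *)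

theory Defs
  imports "HOL-Analysis.Analysis" "HOL-Algebra.Coset" "HOL-Number_Theory.Cong"
begin

text \<open>
  Lattices. A positive definite lattice of rank \<open>n = CARD('n)\<close> is realised as the integer span of
  a basis of the Euclidean space \<open>real ^ 'n\<close>, with the inner product as its bilinear form (every
  such lattice is isometric to one of these). Then \<open>L \<otimes> \<complex>\<close> is \<open>complex ^ 'n\<close>,
  with the complex-bilinear (not sesquilinear) extension of the inner product.
\<close>

definition is_lattice :: "(real ^ 'n) set \<Rightarrow> bool" where
  "is_lattice L \<longleftrightarrow>
     (\<exists>B. independent B \<and> span B = UNIV \<and>
          L = range (\<lambda>a :: real ^ 'n \<Rightarrow> int. \<Sum>b\<in>B. of_int (a b) *\<^sub>R b))"

definition even_lattice :: "(real ^ 'n) set \<Rightarrow> bool" where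
  "even_lattice L \<longleftrightarrow> is_lattice L \<and> (\<forall>v\<in>L. \<exists>j::int. v \<bullet> v = 2 * of_int j)"

definition dual_lattice :: "(real ^ 'n) set \<Rightarrow> (real ^ 'n) set" where
  "dual_lattice L = {w. \<forall>v\<in>L. w \<bullet> v \<in> \<int>}"

definition cvec :: "real ^ 'n \<Rightarrow> complex ^ 'n" where
  "cvec x = (\<chi> i. complex_of_real (x $ i))"

definition cform :: "complex ^ 'n \<Rightarrow> complex ^ 'n \<Rightarrow> complex" where
  "cform z w = (\<Sum>i\<in>UNIV. z $ i * w $ i)"

text \<open>
  The orthogonal sum of \<open>A\<^sub>1(d j)\<close> for \<open>j = 1, \<dots>, n\<close>: integer vectors indexed by
  \<open>{1..n}\<close> (extended by zero), with the bilinear form whose quadratic values are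
  \<open>\<Sum>j. 2 * d j * (x j)\<^sup>2\<close>.
\<close>

definition A1_sum :: "nat \<Rightarrow> (nat \<Rightarrow> int) set" where
  "A1_sum n = {x. \<forall>j. j \<notin> {1..n} \<longrightarrow> x j = 0}"

definition A1_sum_form :: "nat \<Rightarrow> (nat \<Rightarrow> nat) \<Rightarrow> (nat \<Rightarrow> int) \<Rightarrow> (nat \<Rightarrow> int) \<Rightarrow> int" where
  "A1_sum_form n d x y = (\<Sum>j=1..n. 2 * int (d j) * x j * y j)"

text \<open>\<open>M\<close> is the sublattice; it is a subgroup because \<open>f\<close> is additive.\<close>

definition contains_A1_sum :: "(real ^ 'n) set \<Rightarrow> nat \<Rightarrow> (nat \<Rightarrow> nat) \<Rightarrow> bool" where
  "contains_A1_sum L n d \<longleftrightarrow>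
     (\<exists>M f. M \<subseteq> L \<and> bij_betw f (A1_sum n) M \<and>
        (\<forall>x\<in>A1_sum n. \<forall>y\<in>A1_sum n.
            f (\<lambda>j. x j + y j) = f x + f y \<and>
            f x \<bullet> f y = of_int (A1_sum_form n d x y)))"

definition SL2Z :: "(int ^ 2 ^ 2) monoid" where
  "SL2Z = \<lparr>carrier = {A. det A = 1}, mult = (**), one = mat 1\<rparr>"

definition principal_congruence_subgroup :: "nat \<Rightarrow> (int ^ 2 ^ 2) set" where
  "principal_congruence_subgroup M =
     {A \<in> carrier SL2Z. \<forall>i j. [A $ i $ j = mat 1 $ i $ j] (mod int M)}"

definition congruence_subgroup :: "(int ^ 2 ^ 2) set \<Rightarrow> bool" where
  "congruence_subgroup \<Gamma> \<longleftrightarrow>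
     subgroup \<Gamma> SL2Z \<and> (\<exists>M>0. principal_congruence_subgroup M \<subseteq> \<Gamma>)"

definition SL2Z_index :: "(int ^ 2 ^ 2) set \<Rightarrow> nat" where
  "SL2Z_index \<Gamma> = card (rcosets\<^bsub>SL2Z\<^esub> \<Gamma>)"

definition complex_units :: "complex monoid" where
  "complex_units = \<lparr>carrier = - {0}, mult = (*), one = 1\<rparr>"

definition finite_order_character :: "(int ^ 2 ^ 2) set \<Rightarrow> (int ^ 2 ^ 2 \<Rightarrow> complex) \<Rightarrow> bool" where
  "finite_order_character \<Gamma> ch \<longleftrightarrow>
     ch \<in> hom (SL2Z\<lparr>carrier := \<Gamma>\<rparr>) complex_units \<and> (\<exists>r>0. \<forall>A\<in>\<Gamma>. ch A ^ r = 1)"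

text \<open>
  Functions \<open>\<phi>\<close> on \<open>\<H> \<times> (L \<otimes> \<complex>)\<close> are curried functions on
  \<open>complex\<close> and \<open>complex ^ 'n\<close>; only the values with \<open>Im \<tau> > 0\<close> are meaningful.
  Holomorphy is complex Frechet differentiability at every point.
\<close>

definition holomorphic_HxC :: "(complex \<Rightarrow> complex ^ 'n \<Rightarrow> complex) \<Rightarrow> bool" where
  "holomorphic_HxC \<phi> \<longleftrightarrow>
     (\<forall>\<tau> z. Im \<tau> > 0 \<longrightarrow>
        (\<exists>D. ((\<lambda>(t, w). \<phi> t w) has_derivative D) (at (\<tau>, z)) \<and>
             (\<forall>c t w. D (c * t, c *s w) = c * D (t, w))))"

definition slash ::
  "int \<Rightarrow> nat \<Rightarrow> (complex \<Rightarrow> complex ^ 'n \<Rightarrow> complex) \<Rightarrow> int ^ 2 ^ 2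
     \<Rightarrow> complex \<Rightarrow> complex ^ 'n \<Rightarrow> complex" where
  "slash k m \<phi> A \<tau> z =
     (let a = of_int (A $ 1 $ 1); b = of_int (A $ 1 $ 2);
          c = of_int (A $ 2 $ 1); d = of_int (A $ 2 $ 2)
      in (c * \<tau> + d) powi (- k) *
         exp (- (of_real pi * \<i> * of_nat m * (c * cform z z / (c * \<tau> + d)))) *
         \<phi> ((a * \<tau> + b) / (c * \<tau> + d)) (inverse (c * \<tau> + d) *s z))"

text \<open>The exponents of \<open>q\<close>: nonnegative rationals with denominator dividing \<open>D\<close>.\<close>

definition q_exponents :: "nat \<Rightarrow> rat set" where
  "q_exponents D = {r. r \<ge> 0 \<and> of_nat D * r \<in> \<int>}"

definition jacobi_expansion ::
  "(real ^ 'n) set \<Rightarrow> nat \<Rightarrow> (complex \<Rightarrow> complex ^ 'n \<Rightarrow> complex) \<Rightarrow> bool" where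
  "jacobi_expansion L m \<psi> \<longleftrightarrow>
     (\<exists>f :: rat \<Rightarrow> real ^ 'n \<Rightarrow> complex. \<exists>D>0.
        (\<forall>\<tau> z. Im \<tau> > 0 \<longrightarrow>
           ((\<lambda>(r, l). f r l * exp (2 * of_real pi * \<i> * (of_rat r * \<tau> + cform (cvec l) z)))
              has_sum \<psi> \<tau> z) (q_exponents D \<times> dual_lattice L)) \<and>
        (\<forall>r\<in>q_exponents D. \<forall>l\<in>dual_lattice L.
           \<not> 2 * of_rat r * real m \<ge> l \<bullet> l \<longrightarrow> f r l = 0))"

text \<open>Elements are normalised to vanish outside the upper half-plane, so that the zero
  function on \<open>\<H> \<times> (L \<otimes> \<complex>)\<close> has exactly one representative.\<close>

definition jacobi_forms ::
  "int \<Rightarrow> (real ^ 'n) set \<Rightarrow> nat \<Rightarrow> (int ^ 2 ^ 2) set \<Rightarrow> (int ^ 2 ^ 2 \<Rightarrow> complex)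
     \<Rightarrow> (complex \<Rightarrow> complex ^ 'n \<Rightarrow> complex) set" where
  "jacobi_forms k L m \<Gamma> ch =
     {\<phi>. holomorphic_HxC \<phi> \<and>
         (\<forall>\<tau> z. Im \<tau> \<le> 0 \<longrightarrow> \<phi> \<tau> z = 0) \<and>
         (\<forall>A\<in>\<Gamma>. \<forall>\<tau> z. Im \<tau> > 0 \<longrightarrow> slash k m \<phi> A \<tau> z = ch A * \<phi> \<tau> z) \<and>
         (\<forall>x\<in>L. \<forall>y\<in>L. \<forall>\<tau> z. Im \<tau> > 0 \<longrightarrow>
            exp (of_real pi * \<i> * of_nat m * (of_real (x \<bullet> x) * \<tau> + 2 * cform (cvec x) z)) *
              \<phi> \<tau> (z + \<tau> *s cvec x + cvec y) = \<phi> \<tau> z) \<and>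
         (\<forall>\<gamma>\<in>carrier SL2Z. jacobi_expansion L m (slash k m \<phi> \<gamma>))}"

definition is_q_expansion ::
  "(complex \<Rightarrow> complex ^ 'n \<Rightarrow> complex) \<Rightarrow> (rat \<Rightarrow> complex ^ 'n \<Rightarrow> complex) \<Rightarrow> bool" where
  "is_q_expansion \<phi> c \<longleftrightarrow>
     (\<exists>D>0. (\<forall>r z. r \<notin> q_exponents D \<longrightarrow> c r z = 0) \<and>
            (\<forall>\<tau> z. Im \<tau> > 0 \<longrightarrow>
               ((\<lambda>r. c r z * exp (2 * of_real pi * \<i> * of_rat r * \<tau>)) has_sum \<phi> \<tau> z)
                 (q_exponents D)))"

text \<open>
  The coefficients \<open>c\<close> are uniquely determined by \<open>\<phi>\<close> when they exist, as they do for Jacobi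
  forms, and the infimum is attained if the set is nonempty, since the exponents have bounded
  denominators. For \<open>\<phi> = 0\<close> the set is empty and the value is \<open>\<infinity>\<close>.
\<close>

definition ord_infinity :: "(complex \<Rightarrow> complex ^ 'n \<Rightarrow> complex) \<Rightarrow> ereal" where
  "ord_infinity \<phi> =
     Inf {ereal (of_rat r) | r. \<exists>c. is_q_expansion \<phi> c \<and> (\<exists>z. c r z \<noteq> 0)}"

definition jacobi_forms_vanishing ::
  "int \<Rightarrow> (real ^ 'n) set \<Rightarrow> nat \<Rightarrow> (int ^ 2 ^ 2) set \<Rightarrow> (int ^ 2 ^ 2 \<Rightarrow> complex) \<Rightarrow> nat
     \<Rightarrow> (complex \<Rightarrow> complex ^ 'n \<Rightarrow> complex) set" where
  "jacobi_forms_vanishing k L m \<Gamma> ch N =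
     {\<phi> \<in> jacobi_forms k L m \<Gamma> ch. ord_infinity \<phi> \<ge> ereal (real N)}"

definition C_const :: "nat \<Rightarrow> real" where
  "C_const n = 3 powr (- (2 powr (- real n))) * 2 powr (1 - 3 * 2 powr (- real n))"

end

theory Submission
  imports Defs "HOL-Complex_Analysis.Conformal_Mappings" "HOL-Real_Asymp.Real_Asymp"
begin

text \<open>
  Suppose \<open>\<phi> \<noteq> 0\<close>. For \<open>\<xi>, \<eta>\<close> in \<open>(1/h) \<Oplus>\<^sub>j A\<^sub>1(d\<^sub>j)\<close> the function
  \<open>exp (\<pi> i m \<langle>\<xi>, \<xi>\<rangle> \<tau>) \<phi>(\<tau>, \<xi> \<tau> + \<eta>)\<close> depends, in absolute value, only on the classes of \<open>\<xi>\<close> and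
  \<open>\<eta>\<close> modulo the sublattice, and the modular group permutes these functions, for all \<open>\<phi>|\<gamma>\<close> with \<open>\<gamma>\<close>
  in \<open>\<Gamma> \ SL\<^sub>2(\<int>)\<close>, up to the automorphy factor of weight \<open>k\<close>. The product of those that do not
  vanish identically therefore transforms, in absolute value, like a modular form of weight at most
  \<open>k [SL\<^sub>2(\<int>) : \<Gamma>] h\<^bsup>2n\<^esup>\<close>, and its vanishing order at infinity is at most \<open>5/54\<close> times the weight.

  On the other hand, if only exponents \<open>r \<ge> N\<close> occur in \<open>\<phi>\<close>, then \<open>2 r m \<ge> \<langle>l, l\<rangle>\<close> forces the factor at
  \<open>\<xi>\<close> to vanish to order at least \<open>(sqrt N - |\<xi>|)\<^sup>2\<close> (for \<open>|\<xi>|\<^sup>2 = m \<langle>\<xi>, \<xi>\<rangle> / 2 \<le> N\<close>), and for all but a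
  proportion \<open>O(1/h)\<close> of the \<open>\<xi>\<close> no factor vanishes identically. Letting \<open>h\<close> tend to infinity, the
  average of \<open>(sqrt N - |\<xi>|)\<^sup>2\<close> over a box is bounded by \<open>5/54 k [SL\<^sub>2(\<int>) : \<Gamma>]\<close>, and a suitable box
  contradicts the assumption on \<open>N\<close>. For the last step the constant \<open>C\<^sub>n\<close> is read as the iterate of
  \<open>b \<mapsto> sqrt (2 d\<^sub>j m b)\<close> starting from \<open>k / 12\<close>.
\<close>

section \<open>The maximum principle for invariant functions\<close>

text \<open>Passing to absolute values removes the values of \<open>ch\<close> and the phases
  produced by lattice translations, so the modular group acts on the factors by a plain permutation
  and no multiplier system has to be computed.

  The main obstacle is that a factor may vanish identically and must then be left out together with
  its order. Among the factors for \<open>\<Gamma>\<close> itself, those at risk have \<xi> on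
  finitely many hyperplanes that do not depend on h; this is why h has to tend to infinity. The
  factors for all other cosets are credited with order 0 only.

  Using 5/54 in place of the sharp 1/12 costs a factor 10/9. It is affordable because the hypothesis
  on k makes the j-th ratio b j / (2 * D j) of the iteration smaller than (1/2)^(2^(n-j)), whereas a
  box with sides proportional to 1/(n+1) loses only about (n+1)^(n+1). The margin is narrow for n =
  1 and n = 2. The modulus h is taken odd, h = 2R + 1, to have representatives symmetric about
  0.\<close>

definition upper_half :: "complex set" where "upper_half = {\<tau>. Im \<tau> > 0}"

lemma open_upper_half: "open upper_half"
  unfolding upper_half_def by (rule open_halfspace_Im_gt)

lemma connected_upper_half: "connected upper_half"
  unfolding upper_half_def by (intro convex_connected convex_halfspace_Im_gt)

lemma int_periodic:
  fixes G :: "complex \<Rightarrow> real"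
  assumes "\<And>\<tau>. Im \<tau> > 0 \<Longrightarrow> G (\<tau> + 1) = G \<tau>" and "Im \<tau> > 0"
  shows "G (\<tau> + of_int n) = G \<tau>"
proof -
  have nat: "G (\<sigma> + of_nat j) = G \<sigma>" if "Im \<sigma> > 0" for \<sigma> j
  proof (induction j)
    case (Suc j)
    have "G (\<sigma> + of_nat (Suc j)) = G ((\<sigma> + of_nat j) + 1)" by (simp add: add_ac)
    also have "\<dots> = G (\<sigma> + of_nat j)" using that by (intro assms(1)) simp
    finally show ?case using Suc by simp
  qed simp
  show ?thesis
  proof (cases "n \<ge> 0")
    case True
    then show ?thesis using nat[of \<tau> "nat n"] assms(2) by simp
  next
    case False
    have "G (\<tau> + of_int n + of_nat (nat (- n))) = G (\<tau> + of_int n)"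
      using assms(2) by (intro nat) simp
    then show ?thesis using False by (simp add: of_nat_nat)
  qed
qed

lemma translate_to_strip:
  fixes G :: "complex \<Rightarrow> real"
  assumes "\<And>\<tau>. Im \<tau> > 0 \<Longrightarrow> G (\<tau> + 1) = G \<tau>" and "Im \<tau> > 0"
  obtains \<sigma> where "\<bar>Re \<sigma>\<bar> \<le> 1/2" "Im \<sigma> = Im \<tau>" "G \<sigma> = G \<tau>"
proof
  let ?n = "- round (Re \<tau>)"
  show "\<bar>Re (\<tau> + of_int ?n)\<bar> \<le> 1/2"
    using of_int_round_abs_le[of "Re \<tau>"] by (simp add: abs_minus_commute)
  show "G (\<tau> + of_int ?n) = G \<tau>" by (rule int_periodic[of G, OF assms])
qed simp

text \<open>The height 0.86 lies strictly below \<open>sqrt 3 / 2\<close>, so each inversion of a point of the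
  strip below it raises the imaginary part by a fixed factor.\<close>

lemma reduce_to_fundamental_domain:
  fixes G :: "complex \<Rightarrow> real"
  assumes T: "\<And>\<tau>. Im \<tau> > 0 \<Longrightarrow> G (\<tau> + 1) = G \<tau>"
    and S: "\<And>\<tau>. Im \<tau> > 0 \<Longrightarrow> G (- 1 / \<tau>) = G \<tau>"
    and "Im \<tau> > 0"
  obtains \<sigma> where "\<bar>Re \<sigma>\<bar> \<le> 1/2" "Im \<sigma> \<ge> 86/100" "G \<sigma> = G \<tau>"
proof -
  \<comment> \<open>\<open>j\<close> bounds the number of inversions: each gains a factor of at
    least 100/99 in height until 0.86 is reached.\<close>
  have *: "\<exists>\<sigma>. \<bar>Re \<sigma>\<bar> \<le> 1/2 \<and> Im \<sigma> \<ge> 86/100 \<and> G \<sigma> = G \<tau>"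
    if "Im \<tau> \<ge> 86/100 * (99/100) ^ j" for \<tau> and j :: nat
    using that
  proof (induction j arbitrary: \<tau>)
    case 0
    then have "Im \<tau> > 0" by simp
    from translate_to_strip[of G, OF T this] obtain \<sigma> where
      "\<bar>Re \<sigma>\<bar> \<le> 1/2" "Im \<sigma> = Im \<tau>" "G \<sigma> = G \<tau>" by blast
    then show ?case using 0 by (intro exI[of _ \<sigma>]) auto
  next
    case (Suc j)
    have pos: "Im \<tau> > 0" by (rule less_le_trans[OF _ Suc.prems]) simp
    from translate_to_strip[of G, OF T pos] obtain \<sigma> where
      \<sigma>: "\<bar>Re \<sigma>\<bar> \<le> 1/2" "Im \<sigma> = Im \<tau>" "G \<sigma> = G \<tau>" by blast
    show ?case
    proof (cases "Im \<tau> \<ge> 86/100")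
      case True
      then show ?thesis using \<sigma> by auto
    next
      case False
      have "(Re \<sigma>)\<^sup>2 \<le> (1/2)\<^sup>2" using \<sigma>(1) abs_le_square_iff[of "Re \<sigma>" "1/2"] by simp
      moreover have "(Im \<sigma>)\<^sup>2 \<le> (86/100)\<^sup>2" using False \<sigma>(2) pos by (intro power_mono) auto
      \<comment> \<open>1/4 + 0.86^2 = 0.9896, just below 0.99.\<close>
      ultimately have n: "(Re \<sigma>)\<^sup>2 + (Im \<sigma>)\<^sup>2 \<le> 99/100" by (simp add: power2_eq_square)
      have p: "(Re \<sigma>)\<^sup>2 + (Im \<sigma>)\<^sup>2 > 0" using pos \<sigma>(2) by (simp add: sum_power2_gt_zero_iff)
      have im: "Im (- 1 / \<sigma>) = Im \<tau> / ((Re \<sigma>)\<^sup>2 + (Im \<sigma>)\<^sup>2)"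
        using \<sigma>(2) by (simp add: Im_divide)
      have "86/100 * (99/100) ^ j \<le> Im \<tau> / (99/100)" using Suc.prems by simp
      also have "\<dots> \<le> Im (- 1 / \<sigma>)"
        unfolding im using n p pos by (intro divide_left_mono) auto
      finally obtain \<rho> where "\<bar>Re \<rho>\<bar> \<le> 1/2 \<and> Im \<rho> \<ge> 86/100 \<and> G \<rho> = G (- 1 / \<sigma>)"
        using Suc.IH by blast
      moreover have "G (- 1 / \<sigma>) = G \<sigma>" using S \<sigma>(2) pos by simp
      ultimately show ?thesis using \<sigma>(3) by metis
    qed
  qed
  obtain j :: nat where "(99/100::real) ^ j < Im \<tau> / (86/100)"
    using real_arch_pow_inv[of "Im \<tau> / (86/100)" "99/100"] assms(3) by auto
  then have "Im \<tau> \<ge> 86/100 * (99/100) ^ j" by simp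
  from *[OF this] show ?thesis using that by blast
qed

lemma compact_strip_box: "compact {\<tau>. \<bar>Re \<tau>\<bar> \<le> 1/2 \<and> a \<le> Im \<tau> \<and> Im \<tau> \<le> b}"
proof -
  have "{\<tau>. \<bar>Re \<tau>\<bar> \<le> 1/2 \<and> a \<le> Im \<tau> \<and> Im \<tau> \<le> b} = cbox (Complex (-1/2) a) (Complex (1/2) b)"
    by (auto simp: in_cbox_complex_iff)
  then show ?thesis by (metis compact_cbox)
qed

text \<open>The logarithmic derivative a - w / (2 * x) is positive at x and beyond; the bound ln s
  \<le> s - 1 at s = y / x makes this quantitative.\<close>

lemma strict_increase_exp_powr:
  fixes w a x y :: real
  assumes "w \<ge> 0" "0 < x" "x < y" "w < 2 * a * x"
  shows "x powr (- w / 2) * exp (a * x) < y powr (- w / 2) * exp (a * y)"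
proof -
  have "ln (y / x) \<le> y / x - 1" using assms by (intro ln_le_minus_one) auto
  then have "w / 2 * (ln y - ln x) \<le> w / 2 * (y / x - 1)"
    using assms by (intro mult_left_mono) (auto simp: ln_div)
  also have "\<dots> = (w / (2 * x)) * (y - x)" using assms by (simp add: field_simps)
  also have "\<dots> < a * (y - x)" using assms by (intro mult_strict_right_mono) (auto simp: field_simps)
  finally have "- w / 2 * ln x + a * x < - w / 2 * ln y + a * y" by (simp add: field_simps)
  then show ?thesis using assms by (simp add: powr_def exp_add[symmetric])
qed

text \<open>An elementary substitute for the valence formula (with \<open>5/54\<close> in place of \<open>1/12\<close>): the
  invariant function \<open>norm (F \<tau>) * Im \<tau> powr (w/2)\<close> attains its maximum at some \<open>\<tau>\<^sub>0\<close> of height at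
  least 0.86, and if \<open>F\<close> decayed too fast, the maximum principle for \<open>F \<tau> * exp (-2 \<pi> i \<nu> \<tau>)\<close> would
  fail at \<open>\<tau>\<^sub>0\<close>.\<close>

proposition vanishing_order_bound:
  fixes F :: "complex \<Rightarrow> complex" and w \<nu> C :: real
  defines "G \<equiv> \<lambda>\<tau>. norm (F \<tau>) * Im \<tau> powr (w / 2)"
  assumes w: "w \<ge> 0" and hol: "F holomorphic_on upper_half"
    and T: "\<And>\<tau>. Im \<tau> > 0 \<Longrightarrow> G (\<tau> + 1) = G \<tau>"
    and S: "\<And>\<tau>. Im \<tau> > 0 \<Longrightarrow> G (- 1 / \<tau>) = G \<tau>"
    and decay: "\<And>\<tau>. Im \<tau> \<ge> 1/2 \<Longrightarrow> norm (F \<tau>) \<le> C * exp (- 2 * pi * \<nu> * Im \<tau>)"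
    and nz: "\<exists>\<tau>. Im \<tau> > 0 \<and> F \<tau> \<noteq> 0"
  shows "\<nu> \<le> w * 5 / 54"
proof (rule ccontr)
  assume "\<not> \<nu> \<le> w * 5 / 54"
  then have "w * 5 / 54 < \<nu>" by simp
  \<comment> \<open>Stopping short of \<nu> keeps the normalised function \<open>H\<close> tending
    to 0 at the cusp, while the inequality to be refuted still holds for \<nu>'.\<close>
  then obtain \<nu>' where \<nu>': "w * 5 / 54 < \<nu>'" "\<nu>' < \<nu>" using dense by blast
  have \<nu>0: "\<nu>' > 0" "\<nu> > 0" using \<nu>' w by (auto intro: le_less_trans[of 0 "w * 5 / 54"])
  have cont: "continuous_on upper_half F" using hol by (rule holomorphic_on_imp_continuous_on)
  have contG: "continuous_on upper_half G"
    unfolding G_def using cont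
    by (intro continuous_intros) (auto simp: upper_half_def)
  have C0: "C \<ge> 0"
  proof -
    have "0 \<le> C * exp (- 2 * pi * \<nu> * Im \<i>)"
      by (rule order.trans[OF norm_ge_zero decay]) simp
    then show ?thesis by (simp add: zero_le_mult_iff)
  qed
  have expneg: "eventually (\<lambda>y. C * exp (- 2 * pi * \<nu> * y) * y powr (w / 2) < e) at_top" if "e > 0" for e :: real
  proof -
    have "((\<lambda>y. C * exp (- (2 * pi * \<nu>) * y) * y powr (w / 2)) \<longlongrightarrow> 0) at_top"
      using \<nu>0 w by real_asymp
    from order_tendstoD(2)[OF this that] show ?thesis by simp
  qed
  have expneg': "eventually (\<lambda>y. C * exp (- 2 * pi * (\<nu> - \<nu>') * y) < e) at_top" if "e > 0" for e :: real
  proof -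
    have "\<nu> - \<nu>' > 0" using \<nu>' by simp
    then have "((\<lambda>y. C * exp (- (2 * pi * (\<nu> - \<nu>')) * y)) \<longlongrightarrow> 0) at_top"
      by real_asymp
    from order_tendstoD(2)[OF this that] show ?thesis by simp
  qed
  obtain \<tau>a where \<tau>a: "Im \<tau>a > 0" "F \<tau>a \<noteq> 0" using nz by blast
  obtain \<tau>b where \<tau>b: "\<bar>Re \<tau>b\<bar> \<le> 1/2" "Im \<tau>b \<ge> 86/100" "G \<tau>b = G \<tau>a"
    using reduce_to_fundamental_domain[of G, OF T S \<tau>a(1)] by blast
  have Gb: "G \<tau>b > 0" using \<tau>a \<tau>b by (simp add: G_def)
  obtain Y where Y: "\<And>y. y \<ge> Y \<Longrightarrow> C * exp (- 2 * pi * \<nu> * y) * y powr (w / 2) < G \<tau>b"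
    using expneg[OF Gb] by (auto simp: eventually_at_top_linorder)
  \<comment> \<open>Above height Y the decay forces \<open>G\<close> below \<open>G \<tau>b\<close>,
    so the maximum over this compact box is the maximum over the whole half-plane.\<close>
  define K where "K = {\<tau>. \<bar>Re \<tau>\<bar> \<le> 1/2 \<and> 86/100 \<le> Im \<tau> \<and> Im \<tau> \<le> max Y (Im \<tau>b)}"
  have "compact K" unfolding K_def by (rule compact_strip_box)
  moreover have "\<tau>b \<in> K" using \<tau>b by (auto simp: K_def)
  moreover have "continuous_on K G"
    by (rule continuous_on_subset[OF contG]) (auto simp: K_def upper_half_def)
  ultimately obtain \<tau>0 where \<tau>0: "\<tau>0 \<in> K" "\<And>\<tau>. \<tau> \<in> K \<Longrightarrow> G \<tau> \<le> G \<tau>0"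
    using continuous_attains_sup[of K G] by blast
  have G0: "G \<tau>0 > 0" using \<tau>0(2)[OF \<open>\<tau>b \<in> K\<close>] Gb by simp
  have im0: "Im \<tau>0 \<ge> 86/100" using \<tau>0(1) by (simp add: K_def)
  have max: "G \<tau> \<le> G \<tau>0" if "Im \<tau> > 0" for \<tau>
  proof -
    obtain \<sigma> where \<sigma>: "\<bar>Re \<sigma>\<bar> \<le> 1/2" "Im \<sigma> \<ge> 86/100" "G \<sigma> = G \<tau>"
      using reduce_to_fundamental_domain[of G, OF T S \<open>Im \<tau> > 0\<close>] by blast
    show ?thesis
    proof (cases "Im \<sigma> \<le> max Y (Im \<tau>b)")
      case True
      then show ?thesis using \<tau>0(2)[of \<sigma>] \<sigma> by (auto simp: K_def)
    next
      case False
      have "G \<sigma> \<le> C * exp (- 2 * pi * \<nu> * Im \<sigma>) * Im \<sigma> powr (w / 2)"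
        unfolding G_def using \<sigma> by (intro mult_right_mono decay) auto
      also have "\<dots> < G \<tau>b" using False by (intro Y) auto
      also have "\<dots> \<le> G \<tau>0" using \<tau>0 \<open>\<tau>b \<in> K\<close> by blast
      finally show ?thesis using \<sigma> by simp
    qed
  qed
  define a where "a = 2 * pi * \<nu>'"
  define H where "H \<tau> = F \<tau> * exp (- (2 * of_real pi * \<i> * of_real \<nu>') * \<tau>)" for \<tau>
  define V where "V \<tau> = norm (F \<tau>) * exp (a * Im \<tau>)" for \<tau>
  have HV: "norm (H \<tau>) = V \<tau>" for \<tau>
    by (simp add: H_def V_def norm_mult a_def)
  have holH: "H holomorphic_on upper_half"
    unfolding H_def using hol by (intro holomorphic_intros)
  have VG: "V \<tau> = G \<tau> * (Im \<tau> powr (- w / 2) * exp (a * Im \<tau>))" if "Im \<tau> > 0" for \<tau>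
    using that by (simp add: V_def G_def powr_minus field_simps)
  have VT: "V (\<tau> + 1) = V \<tau>" if "Im \<tau> > 0" for \<tau>
    using that T[OF that] by (simp add: VG)
  \<comment> \<open>4 * pi * 0.86 = 10.807... barely exceeds 54/5 = 10.8; this is the origin of the
    constant 5/54.\<close>
  have "w < 2 * a * (86/100)"
  proof -
    have "w < \<nu>' * (54/5)" using \<nu>' by simp
    also have "\<dots> \<le> \<nu>' * (4 * pi * (86/100))"
      using \<nu>0 pi_approx by (intro mult_left_mono) auto
    finally show ?thesis by (simp add: a_def algebra_simps)
  qed
  moreover have a0: "a > 0" using \<nu>0 by (simp add: a_def)
  ultimately have wa: "w / (2 * a) < 86/100" by (simp add: field_simps)
  \<comment> \<open>The height y1 must lie strictly below \<tau>0, yet above w / (2 * a) for the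
    growth lemma and above 1/2 for the decay hypothesis.\<close>
  have "max (w / (2 * a)) (1/2) < 86/100"
    unfolding max_less_iff_conj using wa by (rule conjI) simp
  then obtain y1 where "max (w / (2 * a)) (1/2) < y1" "y1 < 86/100" using dense by blast
  then have y1: "1/2 \<le> y1" "y1 < 86/100" "w / (2 * a) < y1"
    unfolding max_less_iff_conj by (blast intro: less_imp_le)+
  from y1(3) have wy1: "w < 2 * a * y1" using a0 by (simp add: field_simps)
  have V0: "V \<tau>0 > 0" using VG[of \<tau>0] G0 im0 by simp
  have decayV: "V \<tau> \<le> C * exp (- 2 * pi * (\<nu> - \<nu>') * Im \<tau>)" if "Im \<tau> \<ge> 1/2" for \<tau>
  proof -
    have "V \<tau> \<le> C * exp (- 2 * pi * \<nu> * Im \<tau>) * exp (a * Im \<tau>)"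
      unfolding V_def using that by (intro mult_right_mono decay) auto
    then show ?thesis by (simp add: a_def mult.assoc exp_add[symmetric] algebra_simps)
  qed
  obtain Z where Z: "\<And>y. y \<ge> Z \<Longrightarrow> C * exp (- 2 * pi * (\<nu> - \<nu>') * y) < V \<tau>0"
    using expneg'[OF V0] by (auto simp: eventually_at_top_linorder)
  define K2 where "K2 = {\<tau>. \<bar>Re \<tau>\<bar> \<le> 1/2 \<and> y1 \<le> Im \<tau> \<and> Im \<tau> \<le> max Z (Im \<tau>0)}"
  have contV: "continuous_on K2 V"
  proof -
    have "continuous_on K2 H"
      by (rule continuous_on_subset[OF holomorphic_on_imp_continuous_on[OF holH]])
        (use y1 in \<open>auto simp: K2_def upper_half_def\<close>)
    then have "continuous_on K2 (\<lambda>\<tau>. norm (H \<tau>))" by (intro continuous_intros)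
    then show ?thesis by (simp add: HV)
  qed
  have "\<tau>0 \<in> K2" using \<tau>0(1) y1 im0 by (auto simp: K2_def K_def)
  moreover have "compact K2" unfolding K2_def by (rule compact_strip_box)
  ultimately obtain \<tau>2 where \<tau>2: "\<tau>2 \<in> K2" "\<And>\<tau>. \<tau> \<in> K2 \<Longrightarrow> V \<tau> \<le> V \<tau>2"
    using continuous_attains_sup[OF _ _ contV] by blast
  have V2: "V \<tau>0 \<le> V \<tau>2" using \<tau>2 \<open>\<tau>0 \<in> K2\<close> by blast
  have max2: "V \<tau> \<le> V \<tau>2" if "Im \<tau> \<ge> y1" for \<tau>
  proof -
    have "Im \<tau> > 0" using that y1 by simp
    from translate_to_strip[of V, OF VT this] obtain \<sigma> where
      \<sigma>: "\<bar>Re \<sigma>\<bar> \<le> 1/2" "Im \<sigma> = Im \<tau>" "V \<sigma> = V \<tau>" by blast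
    show ?thesis
    proof (cases "Im \<sigma> \<le> max Z (Im \<tau>0)")
      case True
      then show ?thesis using \<tau>2(2)[of \<sigma>] \<sigma> that by (auto simp: K2_def)
    next
      case False
      have "V \<sigma> \<le> C * exp (- 2 * pi * (\<nu> - \<nu>') * Im \<sigma>)"
        using \<sigma> that y1 by (intro decayV) auto
      also have "\<dots> < V \<tau>0" using False by (intro Z) auto
      finally show ?thesis using V2 \<sigma> by simp
    qed
  qed
  \<comment> \<open>On the edge Im \<tau> = y1 the invariant part is at most
    \<open>G \<tau>0\<close>, and the remaining factor is strictly smaller than at the greater
    height Im \<tau>0. So \<open>V\<close> stays below \<open>V \<tau>0\<close> there and its
    maximum is attained at an interior point.\<close>
  have "Im \<tau>2 > y1"
  proof (rule ccontr)
    assume "\<not> ?thesis"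
    then have eq: "Im \<tau>2 = y1" using \<tau>2(1) by (simp add: K2_def)
    have "V \<tau>2 = G \<tau>2 * (y1 powr (- w / 2) * exp (a * y1))" using VG[of \<tau>2] eq y1 by simp
    also have "\<dots> \<le> G \<tau>0 * (y1 powr (- w / 2) * exp (a * y1))"
      using eq y1 by (intro mult_right_mono max) auto
    also have "\<dots> < G \<tau>0 * (Im \<tau>0 powr (- w / 2) * exp (a * Im \<tau>0))"
      using G0 w y1 im0 wy1 by (intro mult_strict_left_mono strict_increase_exp_powr) auto
    also have "\<dots> = V \<tau>0" using VG[of \<tau>0] im0 by simp
    finally show False using V2 by simp
  qed
  then have "H constant_on upper_half"
    using y1 max2
    by (intro maximum_modulus_principle[OF holH open_upper_half connected_upper_half
          open_halfspace_Im_gt[of y1], of \<tau>2]) (auto simp: upper_half_def HV)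
  then obtain c where c: "\<And>\<tau>. Im \<tau> > 0 \<Longrightarrow> H \<tau> = c"
    by (auto simp: constant_on_def upper_half_def)
  \<comment> \<open>A constant \<open>H\<close> contradicts its decay; any point above Z shows
    it.\<close>
  define \<sigma> where "\<sigma> = Complex 0 (max Z 1)"
  have "V \<sigma> < V \<tau>0"
    by (rule le_less_trans[OF decayV Z]) (auto simp: \<sigma>_def)
  moreover have "V \<sigma> = V \<tau>0"
    using c[of \<sigma>] c[of \<tau>0] im0 by (simp add: HV[symmetric] \<sigma>_def)
  ultimately show False by simp
qed

section \<open>The numerical inequality\<close>

text \<open>Read backwards, b j = b (j+1) * (b (j+1) / (2 * D (j+1))). The start \<beta> = k / 12 is
  the sharp bound for the order of a modular form of weight k, the case of rank 0; one square root
  is taken per coordinate.\<close>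

primrec slice_bound :: "real \<Rightarrow> (nat \<Rightarrow> real) \<Rightarrow> nat \<Rightarrow> real" where
  "slice_bound \<beta> D 0 = \<beta>"
| "slice_bound \<beta> D (Suc j) = sqrt (2 * D (Suc j) * slice_bound \<beta> D j)"

lemma powr_half_eq_sqrt: "x \<ge> 0 \<Longrightarrow> x powr (a / 2) = sqrt (x powr a)" for x a :: real
  by (metis powr_half_sqrt powr_powr powr_ge_zero times_divide_eq_right mult_1_right)

lemma prod_sqrt: "(\<Prod>j\<in>A. sqrt (f j)) = sqrt (\<Prod>j\<in>A. f j)"
  by (induction A rule: infinite_finite_induct) (simp_all add: real_sqrt_mult)

text \<open>Each square root halves all exponents present and contributes a fresh 1/2 to the
  exponents of 2, of m and of the newest d, which produces the exponents in \<open>C_const\<close>.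
  For n = 0 the constant is 3^(-1) * 2^(-2) = 1/12.\<close>

lemma slice_bound_closed_form:
  fixes d :: "nat \<Rightarrow> nat" and k m :: nat
  assumes "k > 0" "m > 0"
  shows "slice_bound (real k / 12) (\<lambda>j. real (d j) * real m) n =
      C_const n * (\<Prod>j=1..n. real (d j) powr (2 powr (real j - 1 - real n))) *
           real k powr (2 powr (- real n)) * real m powr (1 - 2 powr (- real n))"
proof (induction n)
  case 0
  have "(2::real) powr (1 - 3) = 1 / 4" using powr_realpow[of "2::real" 2] powr_minus_divide[of "2::real" 2] by simp
  then show ?case using assms by (simp add: C_const_def powr_minus_divide)
next
  case (Suc n)
  define e where "e = 2 powr (- real n)"
  have e: "2 powr (- real (Suc n)) = e / 2"
    unfolding e_def by (simp add: powr_diff powr_minus_divide powr_add field_simps)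
  have dexp: "2 powr (real j - 1 - real (Suc n)) = 2 powr (real j - 1 - real n) / 2" for j
    using powr_diff[of 2 "real j - 1 - real n" 1] by (simp add: algebra_simps)
  define A where "A = (\<Prod>j=1..n. real (d j) powr (2 powr (real j - 1 - real n)))"
  have prods: "(\<Prod>j=1..n. real (d j) powr (2 powr (real j - 1 - real n) / 2)) = sqrt A"
    unfolding A_def prod_sqrt[symmetric] by (simp add: powr_half_eq_sqrt)
  have last: "2 powr (real (Suc n) - 1 - real n) = (1 :: real)" by simp
  have m: "real m powr (1 - e / 2) = sqrt (real m) * sqrt (real m powr (1 - e))"
    using powr_add[of "real m" "1 / 2" "(1 - e) / 2"] powr_half_eq_sqrt[of "real m" "1 - e"]
      powr_half_sqrt[of "real m"] by (simp add: field_simps)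
  have c2: "2 powr (1 - 3 * (e / 2)) = sqrt 2 * sqrt (2 powr (1 - 3 * e))"
    using powr_add[of 2 "1 / 2" "(1 - 3 * e) / 2"] powr_half_eq_sqrt[of 2 "1 - 3 * e"]
      powr_half_sqrt[of 2] by (simp add: field_simps)
  have c3: "3 powr (- (e / 2)) = sqrt (3 powr (- e))"
    using powr_half_eq_sqrt[of 3 "- e"] by simp
  have k: "real k powr (e / 2) = sqrt (real k powr e)" by (rule powr_half_eq_sqrt) simp
  have "slice_bound (real k / 12) (\<lambda>j. real (d j) * real m) (Suc n) =
     sqrt (2 * (real (d (Suc n)) * real m) *
       (3 powr (- e) * 2 powr (1 - 3 * e) * A * real k powr e * real m powr (1 - e)))"
    by (simp only: slice_bound.simps Suc.IH C_const_def e_def A_def)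
  also have "\<dots> = sqrt (3 powr (- e)) * (sqrt 2 * sqrt (2 powr (1 - 3 * e))) *
      (sqrt A * sqrt (real (d (Suc n)))) * sqrt (real k powr e) *
      (sqrt (real m) * sqrt (real m powr (1 - e)))"
    by (simp only: real_sqrt_mult mult_ac)
  also have "sqrt (real (d (Suc n))) = real (d (Suc n)) powr (1 / 2)" by (simp add: powr_half_sqrt)
  also have "sqrt A * \<dots> =
      (\<Prod>j=1..Suc n. real (d j) powr (2 powr (real j - 1 - real (Suc n))))"
    unfolding prods[symmetric]
    by (simp add: dexp last del: of_nat_Suc)
  finally show ?case
    by (simp only: C_const_def e m c2 c3 k)
qed


lemma two_power_sum: "(\<Sum>j=1..n. 2 ^ (n - j)) + 1 = (2::nat) ^ n"
proof (induction n)
  case (Suc n)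
  have "(\<Sum>j=1..Suc n. 2 ^ (Suc n - j)) = (\<Sum>j=1..n. 2 * 2 ^ (n - j)) + (1::nat)"
    by (simp add: Suc_diff_le)
  then show ?case using Suc by (simp add: sum_distrib_left[symmetric])
qed simp

text \<open>10/9 is the quotient of 5/54 and 1/12. For n = 2 the inequality reads 30 < 32, and for n
  = 1 it would be false. From n = 3 on, n + 1 \<le> 2^(n-1) reduces it to a comparison of exponents
  of 2.\<close>

lemma self_power_less:
  assumes "n \<ge> 2"
  shows "10 / 9 * real (n + 1) ^ (n + 1) < 2 ^ n * 2 ^ (2 ^ n) / 2"
proof (cases "n = 2")
  case False
  then have n: "n \<ge> 3" using assms by simp
  have *: "i + 1 \<le> 2 ^ (i - 1)" if i: "i \<ge> 3" for i :: nat
  proof -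
    have "p + 4 \<le> 2 ^ (p + 2)" for p :: nat by (induction p) auto
    moreover obtain p where "i = p + 3" using i le_Suc_ex add.commute by metis
    ultimately show ?thesis by (simp add: add.commute)
  qed
  have a: "n + 1 \<le> 2 ^ (n - 1)" by (rule *) fact
  have b: "(n - 1) * (n + 1) + 2 \<le> 2 ^ n + n"
    using n
  proof (induction n rule: nat_induct_at_least)
    case (Suc n)
    have c: "n + 1 \<le> 2 ^ (n - 1)" by (rule *) fact
    have d: "(2::nat) ^ n = 2 * 2 ^ (n - 1)" using Suc.hyps by (cases n) auto
    obtain p where p: "n = p + 1" using Suc.hyps by (cases n) auto
    show ?case using Suc.IH c d p by (auto simp: algebra_simps)
  qed auto
  have "real (n + 1) ^ (n + 1) \<le> real (2 ^ (n - 1)) ^ (n + 1)"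
    using a by (intro power_mono of_nat_mono) auto
  also have "\<dots> = 2 ^ ((n - 1) * (n + 1))"
    by (simp only: of_nat_power of_nat_numeral power_mult)
  finally have "4 * real (n + 1) ^ (n + 1) \<le> 2 ^ ((n - 1) * (n + 1) + 2)"
    by (simp add: power_add)
  also have "\<dots> \<le> 2 ^ (2 ^ n + n)" using b by (intro power_increasing) auto
  finally have "2 * real (n + 1) ^ (n + 1) \<le> 2 ^ n * 2 ^ (2 ^ n) / 2"
    by (simp add: power_add mult.commute)
  moreover have "real (n + 1) ^ (n + 1) > 0" by (intro zero_less_power) simp
  ultimately show ?thesis by linarith
qed (simp add: power_numeral_reduce)

section \<open>Growth of the iterated square roots from a small initial value\<close>

context
  fixes D :: "nat \<Rightarrow> real" and \<beta> :: real and n :: nat and b :: "nat \<Rightarrow> real"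
  assumes n: "n > 0" and \<beta>: "\<beta> > 0"
    and D: "\<And>j. 1 \<le> j \<Longrightarrow> j \<le> n \<Longrightarrow> D j > 0"
    and Dmono: "\<And>i j. 1 \<le> i \<Longrightarrow> i < j \<Longrightarrow> j \<le> n \<Longrightarrow> D i \<le> D j"
    and \<beta>D: "\<beta> < 2 * D 1 * (1/2) ^ (2 ^ n)"
  defines "b \<equiv> slice_bound \<beta> D"
begin

lemma slice_bound_pos: "j \<le> n \<Longrightarrow> b j > 0"
  unfolding b_def by (induction j) (use \<beta> D in auto)

lemma slice_bound_step:
  assumes "Suc j \<le> n"
  shows "b j = b (Suc j) * (b (Suc j) / (2 * D (Suc j)))"
proof -
  have "b (Suc j) * b (Suc j) = 2 * D (Suc j) * b j"
    using slice_bound_pos[of j] D[of "Suc j"] assms by (simp add: b_def)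
  then show ?thesis using D[of "Suc j"] assms by (simp add: field_simps)
qed

text \<open>After squaring, the claim for j + 1 follows from the one for j: the exponent 2^(n-j) is
  halved by the root, and D j \<le> D (j+1) allows both factors D to be taken equal. The case j = 1
  is the hypothesis on \<beta>.\<close>

lemma slice_bound_less:
  assumes "1 \<le> j" "j \<le> n"
  shows "b j / (2 * D j) < (1/2) ^ (2 ^ (n - j))"
proof -
  have *: "b j < 2 * D j * (1/2) ^ (2 ^ (n - j))"
    using assms
  proof (induction j rule: nat_induct_at_least)
    case base
    have "(b 1)\<^sup>2 = 2 * D 1 * \<beta>" using D[of 1] n \<beta> by (simp add: b_def)
    also have "\<dots> < 2 * D 1 * (2 * D 1 * (1/2) ^ (2 ^ n))"
      using D[of 1] n \<beta>D by (intro mult_strict_left_mono) auto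
    also have "(1/2 :: real) ^ (2 ^ n) = ((1/2) ^ (2 ^ (n - 1)))\<^sup>2"
      using n by (cases n) (auto simp: power_mult[symmetric] mult.commute)
    also have "2 * D 1 * (2 * D 1 * \<dots>) = (2 * D 1 * (1/2) ^ (2 ^ (n - 1)))\<^sup>2"
      by (simp add: power2_eq_square)
    finally show ?case
      by (rule power_less_imp_less_base) (use D[of 1] n in auto)
  next
    case (Suc j)
    have "(b (Suc j))\<^sup>2 = 2 * D (Suc j) * b j"
      using slice_bound_pos[of j] D[of "Suc j"] Suc by (simp add: b_def)
    also have "\<dots> < 2 * D (Suc j) * (2 * D j * (1/2) ^ (2 ^ (n - j)))"
      using D[of "Suc j"] Suc by (intro mult_strict_left_mono) auto
    also have "\<dots> \<le> 2 * D (Suc j) * (2 * D (Suc j) * (1/2) ^ (2 ^ (n - j)))"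
      using Dmono[of j "Suc j"] D[of "Suc j"] Suc by (intro mult_left_mono mult_right_mono) auto
    also have "n - j = Suc (n - Suc j)" using Suc by simp
    also have "(1/2 :: real) ^ (2 ^ Suc (n - Suc j)) = ((1/2) ^ (2 ^ (n - Suc j)))\<^sup>2"
      by (auto simp: power_mult[symmetric] mult.commute)
    also have "2 * D (Suc j) * (2 * D (Suc j) * \<dots>) = (2 * D (Suc j) * (1/2) ^ (2 ^ (n - Suc j)))\<^sup>2"
      by (simp add: power2_eq_square)
    finally show ?case
      by (rule power_less_imp_less_base) (use D[of "Suc j"] Suc in auto)
  qed
  then show ?thesis using D[of j] assms by (simp add: field_simps)
qed

text \<open>Descending from j + 1 to j multiplies by a ratio below p = (1/2)^(2^(n-j-1)). The bound
  already contains the same p, and p * p is the required power. The factor 2 normalises j = n, where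
  the power is 1/2.\<close>

lemma slice_bound_le_last: "j \<le> n \<Longrightarrow> b j \<le> b n * 2 * (1/2) ^ (2 ^ (n - j))"
proof (induction "n - j" arbitrary: j)
  case (Suc i)
  then have j: "Suc j \<le> n" "n - j = Suc (n - Suc j)" by auto
  have double: "(1/2 :: real) ^ (2 ^ Suc i) = (1/2) ^ (2 ^ i) * (1/2) ^ (2 ^ i)" for i
    by (simp add: mult_2 power_add)
  have "b j = b (Suc j) * (b (Suc j) / (2 * D (Suc j)))" by (rule slice_bound_step) fact
  also have "\<dots> \<le> (b n * 2 * (1/2) ^ (2 ^ (n - Suc j))) * (1/2) ^ (2 ^ (n - Suc j))"
  proof (rule mult_mono)
    show "b (Suc j) \<le> b n * 2 * (1/2) ^ (2 ^ (n - Suc j))"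
      using Suc.hyps(2) j(1) by (intro Suc.hyps(1)) auto
    show "b (Suc j) / (2 * D (Suc j)) \<le> (1/2) ^ (2 ^ (n - Suc j))"
      using j(1) by (intro less_imp_le[OF slice_bound_less]) auto
    show "0 \<le> b n * 2 * (1/2) ^ (2 ^ (n - Suc j))"
      using slice_bound_pos[of n] by simp
    show "0 \<le> b (Suc j) / (2 * D (Suc j))"
      using slice_bound_pos[of "Suc j"] D[of "Suc j"] j(1) by simp
  qed
  also have "\<dots> = b n * 2 * (1/2) ^ (2 ^ (n - j))"
    by (subst j(2)) (simp only: double mult_ac)
  finally show ?case .
qed auto

text \<open>The ratio is below the power of 1/2, and so is its square below that power times the
  ratio with b j replaced by its bound through b n. The minimum of the two estimates matches the
  truncation of the box sides in \<open>exists_averaging_box\<close>.\<close>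

lemma slice_bound_ratio_le:
  assumes "1 \<le> j" "j \<le> n"
  shows "b j / (2 * D j) \<le> (1/2) ^ (2 ^ (n - j)) * min 1 (sqrt (b n / D j))"
proof -
  define p :: real where "p = (1/2) ^ (2 ^ (n - j))"
  have p: "p > 0" by (simp add: p_def)
  have Dj: "D j > 0" using D assms by simp
  have "(b j / (2 * D j))\<^sup>2 \<le> p * ((b n * 2 * p) / (2 * D j))"
    unfolding power2_eq_square using assms Dj slice_bound_le_last[of j] slice_bound_less[of j]
      slice_bound_pos[of j] p
    by (intro mult_mono divide_right_mono) (auto simp: p_def)
  also have "\<dots> = p\<^sup>2 * (b n / D j)" using Dj by (simp add: power2_eq_square field_simps)
  finally have "b j / (2 * D j) \<le> sqrt (p\<^sup>2 * (b n / D j))" by (rule real_le_rsqrt)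
  also have "\<dots> = p * sqrt (b n / D j)" using p by (simp only: real_sqrt_mult real_sqrt_abs abs_of_pos)
  finally have "b j / (2 * D j) \<le> p * sqrt (b n / D j)" .
  moreover have "b j / (2 * D j) \<le> p" using slice_bound_less[OF assms] by (simp add: p_def)
  ultimately show ?thesis unfolding p_def[symmetric] by (simp add: min_def)
qed

text \<open>Telescoping writes \<beta> as b n times the product of all ratios, in which the powers
  of 1/2 have total exponent 2^n - 1. The factor 2^(2^n) / 2 so gained pays for the 10/9 and for the
  small sides of the box.\<close>

lemma slice_bound_start:
  "2 ^ (2 ^ n) / 2 * \<beta> \<le> b n * (\<Prod>j=1..n. min 1 (sqrt (b n / D j)))"
proof -
  have "b 0 = b j * (\<Prod>i=1..j. b i / (2 * D i))" if "j \<le> n" for j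
    using that
  proof (induction j)
    case (Suc j)
    then show ?case using slice_bound_step[of j] by simp
  qed simp
  then have "\<beta> = b n * (\<Prod>j=1..n. b j / (2 * D j))" by (simp add: b_def)
  also have "\<dots> \<le> b n * (\<Prod>j=1..n. (1/2) ^ (2 ^ (n - j)) * min 1 (sqrt (b n / D j)))"
    using slice_bound_ratio_le slice_bound_pos D
    by (intro mult_left_mono prod_mono) (auto intro!: divide_nonneg_pos less_imp_le)
  also have "(\<Prod>j=1..n. (1/2) ^ (2 ^ (n - j)) * min 1 (sqrt (b n / D j))) =
      (1/2) ^ (\<Sum>j=1..n. 2 ^ (n - j)) * (\<Prod>j=1..n. min 1 (sqrt (b n / D j)))"
    by (simp add: prod.distrib power_sum)
  also have "(1/2 :: real) ^ (\<Sum>j=1..n. 2 ^ (n - j)) = 2 / 2 ^ (2 ^ n)"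
    unfolding two_power_sum[of n, symmetric] by (simp add: power_one_over field_simps)
  finally show ?thesis by (simp add: field_simps)
qed

text \<open>In the application t is the index, x = sqrt N and 10/9 * \<beta> = 5/54 * k. The right
  side of the last claim is the integral of x^2 - 2 x (sum of sqrt (D j) |y_j|) + (sum of D j y_j^2)
  over the box of half-sides \<rho> j, since |y| and y^2 have the means \<rho>/2 and \<rho>^2/3 on
  [-\<rho>, \<rho>].\<close>

lemma exists_averaging_box:
  assumes t: "t \<ge> 1" and x: "x > 0" and tx: "t * b n \<le> x\<^sup>2"
  obtains \<rho> where "\<And>j. j \<in> {1..n} \<Longrightarrow> 0 < \<rho> j \<and> \<rho> j \<le> 1/2"
    and "(\<Sum>j=1..n. D j * (\<rho> j)\<^sup>2) \<le> x\<^sup>2"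
    and "t * (10 / 9 * \<beta>) < (\<Prod>j=1..n. 2 * \<rho> j) *
          (x\<^sup>2 - x * (\<Sum>j=1..n. sqrt (D j) * \<rho> j) + (\<Sum>j=1..n. D j * (\<rho> j)\<^sup>2) / 3)"
proof
  \<comment> \<open>The bound 1/2 keeps the box inside one period. The other entry makes each
    \<open>sqrt (D j) * \<rho> j\<close> at most sqrt (b n) / (n + 1), so the linear term uses up at
    most n / (n + 1) of x^2.\<close>
  define \<rho> where "\<rho> j = min (1/2) (sqrt (b n / D j) / real (n + 1))" for j
  define S where "S = (\<Sum>j=1..n. sqrt (D j) * \<rho> j)"
  define Q where "Q = (\<Sum>j=1..n. D j * (\<rho> j)\<^sup>2)"
  define P where "P = (\<Prod>j=1..n. min 1 (sqrt (b n / D j)))"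
  have bn: "b n > 0" by (rule slice_bound_pos) simp
  have "b n \<le> t * b n" using t bn by simp
  then have bx: "b n \<le> x\<^sup>2" using tx by simp
  then have sbx: "sqrt (b n) \<le> x" using x by (intro real_le_lsqrt) auto
  show \<rho>: "0 < \<rho> j \<and> \<rho> j \<le> 1/2" if "j \<in> {1..n}" for j
    using that D[of j] bn unfolding \<rho>_def by (intro conjI min.cobounded1) simp
  have le: "sqrt (D j) * \<rho> j \<le> sqrt (b n) / real (n + 1)" if "j \<in> {1..n}" for j
  proof -
    have "sqrt (D j) * \<rho> j \<le> sqrt (D j) * (sqrt (b n / D j) / real (n + 1))"
      using D[of j] that unfolding \<rho>_def by (intro mult_left_mono) auto
    also have "\<dots> = sqrt (b n) / real (n + 1)"
      using D[of j] that by (simp add: real_sqrt_divide)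
    finally show ?thesis .
  qed
  have "S \<le> (\<Sum>j=1..n. sqrt (b n) / real (n + 1))" unfolding S_def by (intro sum_mono le)
  also have "\<dots> = real n / real (n + 1) * sqrt (b n)" by simp
  also have "\<dots> \<le> real n / real (n + 1) * x" using sbx by (intro mult_left_mono) auto
  finally have S: "S \<le> real n / real (n + 1) * x" .
  have "Q \<le> (\<Sum>j=1..n. b n / real n)"
    unfolding Q_def
  proof (intro sum_mono)
    fix j assume j: "j \<in> {1..n}"
    have "D j * (\<rho> j)\<^sup>2 = (sqrt (D j) * \<rho> j)\<^sup>2"
      using D[of j] j by (simp add: power_mult_distrib)
    also have "\<dots> \<le> (sqrt (b n) / real (n + 1))\<^sup>2"
      using le[OF j] \<rho>[OF j] D[of j] j by (intro power_mono) auto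
    also have "\<dots> = b n / (real (n + 1))\<^sup>2" using bn by (simp add: power_divide)
    also have "\<dots> \<le> b n / real n"
      using bn n by (intro divide_left_mono mult_pos_pos zero_less_power) (auto simp: power2_eq_square algebra_simps)
    finally show "D j * (\<rho> j)\<^sup>2 \<le> b n / real n" .
  qed
  also have "\<dots> = b n" using n by simp
  finally show Qx: "(\<Sum>j=1..n. D j * (\<rho> j)\<^sup>2) \<le> x\<^sup>2" using bx by (simp add: Q_def)
  have Q0: "Q \<ge> 0" unfolding Q_def 
    using D by (intro sum_nonneg mult_nonneg_nonneg zero_le_power2) (auto intro: less_imp_le)
  have P0: "P > 0" unfolding P_def using D bn by (intro prod_pos) auto
  \<comment> \<open>As n \<ge> 1, the factor 2 / (n + 1) is at most 1 and can be pulled out of the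
    minimum that defines \<open>2 * \<rho> j\<close>.\<close>
  have P2: "(2 / real (n + 1)) ^ n * P \<le> (\<Prod>j=1..n. 2 * \<rho> j)"
  proof -
    have "(2 / real (n + 1)) ^ n * P = (\<Prod>j=1..n. 2 / real (n + 1) * min 1 (sqrt (b n / D j)))"
      unfolding P_def prod.distrib by simp
    also have "\<dots> \<le> (\<Prod>j=1..n. 2 * \<rho> j)"
    proof (intro prod_mono conjI)
      fix j assume "j \<in> {1..n}"
      have "2 / real (n + 1) * min 1 (sqrt (b n / D j)) =
          min (2 / real (n + 1)) (2 * (sqrt (b n / D j) / real (n + 1)))"
        by (simp add: min_mult_distrib_left)
      also have "\<dots> \<le> min 1 (2 * (sqrt (b n / D j) / real (n + 1)))"
        using n by (intro min.mono) auto
      also have "\<dots> = 2 * \<rho> j" by (auto simp: \<rho>_def min_def)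
      finally show "2 / real (n + 1) * min 1 (sqrt (b n / D j)) \<le> 2 * \<rho> j" .
    qed (use D bn in \<open>auto intro!: divide_nonneg_pos less_imp_le\<close>)
    finally show ?thesis .
  qed
  show "t * (10 / 9 * \<beta>) < (\<Prod>j=1..n. 2 * \<rho> j) *
          (x\<^sup>2 - x * (\<Sum>j=1..n. sqrt (D j) * \<rho> j) + (\<Sum>j=1..n. D j * (\<rho> j)\<^sup>2) / 3)"
  \<comment> \<open>For \<open>n \<ge> 2\<close> the quadratic term may be dropped; for \<open>n = 1\<close> the estimate needs it.\<close>
  proof (cases "n = 1")
    case False
    then have n2: "n \<ge> 2" using n by simp
    have "t * (10 / 9 * \<beta>) * real (n + 1) ^ (n + 1) = t * \<beta> * (10 / 9 * real (n + 1) ^ (n + 1))" by simp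
    also have "\<dots> < t * \<beta> * (2 ^ n * 2 ^ (2 ^ n) / 2)"
      using t \<beta> by (intro mult_strict_left_mono self_power_less n2) auto
    also have "\<dots> = t * 2 ^ n * (2 ^ (2 ^ n) / 2 * \<beta>)" by simp
    also have "\<dots> \<le> t * 2 ^ n * (b n * P)"
      using slice_bound_start t unfolding P_def by (intro mult_left_mono) auto
    finally have "t * (10 / 9 * \<beta>) < t * 2 ^ n * (b n * P) / real (n + 1) ^ (n + 1)"
      by (simp add: pos_less_divide_eq)
    also have "\<dots> = (2 / real (n + 1)) ^ n * P * (t * b n / real (n + 1))"
      by (simp add: field_simps)
    also have "\<dots> \<le> (\<Prod>j=1..n. 2 * \<rho> j) * (x\<^sup>2 / real (n + 1))"
      using tx t bn \<rho> P0 by (intro mult_mono P2 divide_right_mono prod_nonneg) (auto intro: less_imp_le)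
    also have "\<dots> \<le> (\<Prod>j=1..n. 2 * \<rho> j) * (x\<^sup>2 - x * S + Q / 3)"
    proof (intro mult_left_mono prod_nonneg)
      have "x * S \<le> x * (real n / real (n + 1) * x)" using S x by (intro mult_left_mono) auto
      also have "\<dots> = x\<^sup>2 - x\<^sup>2 / real (n + 1)" by (simp add: field_simps power2_eq_square)
      finally show "x\<^sup>2 / real (n + 1) \<le> x\<^sup>2 - x * S + Q / 3" using Q0 by simp
    qed (use \<rho> in \<open>auto intro: less_imp_le\<close>)
    finally show ?thesis by (simp add: S_def Q_def)
  next
    case n1: True
    define s where "s = sqrt (b 1)"
    have D1: "D 1 > 0" using D n1 by simp
    have b1: "b 1 < D 1" using slice_bound_less[of 1] n1 D1 by (simp add: field_simps)
    define u where "u = s / sqrt (D 1)"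
    have u: "0 < u" "u < 1" using b1 bn n1 D1 by (auto simp: u_def s_def)
    have \<rho>1: "\<rho> 1 = u / 2" using n1 u by (simp add: \<rho>_def u_def s_def real_sqrt_divide)
    have su: "sqrt (D 1) * u = s" using D1 by (simp add: u_def)
    have s2: "s\<^sup>2 = b 1" using bn n1 by (simp add: s_def)
    have Du: "D 1 * u\<^sup>2 = s\<^sup>2" using D1 by (simp add: u_def power_divide)
    have \<beta>u: "\<beta> = u\<^sup>2 * b 1 / 2"
    proof -
      have "b 0 = \<beta>" by (simp add: b_def)
      moreover have "b 0 = b 1 * (b 1 / (2 * D 1))" using slice_bound_step[of 0] n1 by simp
      moreover have "u\<^sup>2 = b 1 / D 1" using D1 Du s2 by (simp add: field_simps)
      ultimately show ?thesis by simp
    qed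
    \<comment> \<open>Twelve times the difference of the two sides below is this product; 7/12 = 1 -
      1/2 + 1/12 is the value for x = s = 1.\<close>
    have "0 \<le> (5 * x - s) * (x - s)"
      using sbx n1 x bn by (intro mult_nonneg_nonneg) (auto simp: s_def)
    then have "7 / 12 * x\<^sup>2 \<le> x\<^sup>2 - x * (s / 2) + s\<^sup>2 / 12"
      by (simp add: algebra_simps power2_eq_square)
    then have le7: "7 / 12 * (t * b 1) \<le> x\<^sup>2 - x * (s / 2) + s\<^sup>2 / 12"
      using tx n1 by simp
    \<comment> \<open>Since \<beta> = u^2 * b 1 / 2, what remains is 5/9 * u^2 < 7/12 * u, which
      holds because u < 1 and 5/9 < 7/12.\<close>
    have "u * u < u * 1" using u by (intro mult_strict_left_mono) auto
    then have "5 / 9 * u\<^sup>2 < 7 / 12 * u" using u by (simp add: power2_eq_square)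
    then have "t * b 1 * (5 / 9 * u\<^sup>2) < t * b 1 * (7 / 12 * u)"
      using t bn n1 by (intro mult_strict_left_mono) auto
    then have "t * (10 / 9 * \<beta>) < u * (7 / 12 * (t * b 1))" by (simp add: \<beta>u algebra_simps)
    also have "\<dots> \<le> u * (x\<^sup>2 - x * (s / 2) + s\<^sup>2 / 12)"
      using le7 u by (intro mult_left_mono) auto
    also have "s / 2 = sqrt (D 1) * \<rho> 1" using \<rho>1 by (simp flip: su)
    also have "s\<^sup>2 / 12 = D 1 * (\<rho> 1)\<^sup>2 / 3" unfolding \<rho>1 Du[symmetric] by (simp add: power_divide)
    also have "u = 2 * \<rho> 1" using \<rho>1 by simp
    finally show ?thesis using n1 by simp
  qed
qed

end

section \<open>Exponential series and norms\<close>

definition qexp :: "real \<Rightarrow> complex \<Rightarrow> complex" where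
  "qexp x \<tau> = exp (2 * of_real pi * \<i> * of_real x * \<tau>)"

lemma norm_qexp: "norm (qexp x \<tau>) = exp (- 2 * pi * x * Im \<tau>)"
  by (simp add: qexp_def)

text \<open>Summability in the complex numbers is absolute, so the series at \<open>\<i> / 2\<close>
  serves as a majorant: moving up to height Im \<tau> shrinks every nonzero term by at least exp (-
  2 * pi * \<nu> * (Im \<tau> - 1/2)).\<close>

lemma qexp_series_bound:
  fixes f :: "'a \<Rightarrow> complex" and E :: "'a \<Rightarrow> real"
  assumes hs: "\<And>\<tau>. Im \<tau> > 0 \<Longrightarrow> ((\<lambda>i. f i * qexp (E i) \<tau>) has_sum \<psi> \<tau>) A"
    and E: "\<And>i. i \<in> A \<Longrightarrow> f i \<noteq> 0 \<Longrightarrow> E i \<ge> \<nu>"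
  obtains C where "C \<ge> 0" "\<And>\<tau>. Im \<tau> \<ge> 1/2 \<Longrightarrow> norm (\<psi> \<tau>) \<le> C * exp (- 2 * pi * \<nu> * Im \<tau>)"
proof -
  define g where "g i = norm (f i * qexp (E i) (\<i> / 2))" for i
  have "(\<lambda>i. f i * qexp (E i) (\<i> / 2)) summable_on A"
    using hs[of "\<i> / 2"] by (auto intro: has_sum_imp_summable)
  then have g: "g summable_on A"
    unfolding g_def by (simp add: summable_on_iff_abs_summable_on_complex)
  show ?thesis
  proof
    show "infsum g A * exp (pi * \<nu>) \<ge> 0"
      by (intro mult_nonneg_nonneg infsum_nonneg) (auto simp: g_def)
    fix \<tau> assume \<tau>: "Im \<tau> \<ge> 1/2"
    define c where "c = exp (- 2 * pi * \<nu> * (Im \<tau> - 1/2))"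
    have le: "norm (f i * qexp (E i) \<tau>) \<le> g i * c" if "i \<in> A" for i
    proof (cases "f i = 0")
      case False
      have "E i * (Im \<tau> - 1/2) \<ge> \<nu> * (Im \<tau> - 1/2)"
        using E[OF that False] \<tau> by (intro mult_right_mono) auto
      then have "2 * pi * (\<nu> * (Im \<tau> - 1/2)) \<le> 2 * pi * (E i * (Im \<tau> - 1/2))"
        by (intro mult_left_mono) auto
      then have "exp (- 2 * pi * E i * Im \<tau>) \<le> exp (- pi * E i - 2 * pi * \<nu> * (Im \<tau> - 1/2))"
        by (simp add: algebra_simps)
      also have "\<dots> = exp (- pi * E i) * c"
        unfolding c_def exp_add[symmetric] by (simp add: algebra_simps)
      finally have "norm (f i) * exp (- 2 * pi * E i * Im \<tau>) \<le> norm (f i) * (exp (- pi * E i) * c)"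
        by (intro mult_left_mono) auto
      then show ?thesis by (simp add: g_def norm_mult norm_qexp mult.assoc)
    qed (simp add: g_def)
    have "norm (\<psi> \<tau>) \<le> infsum g A * c"
    proof (rule norm_infsum_le)
      show "((\<lambda>i. f i * qexp (E i) \<tau>) has_sum \<psi> \<tau>) A" by (rule hs) (use \<tau> in linarith)
      show "((\<lambda>i. g i * c) has_sum infsum g A * c) A"
        using g by (intro has_sum_cmult_left has_sum_infsum)
    qed (rule le)
    also have "\<dots> = infsum g A * exp (pi * \<nu>) * exp (- 2 * pi * \<nu> * Im \<tau>)"
      unfolding c_def mult.assoc exp_add[symmetric] by (simp add: algebra_simps)
    finally show "norm (\<psi> \<tau>) \<le> infsum g A * exp (pi * \<nu>) * exp (- 2 * pi * \<nu> * Im \<tau>)" .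
  qed
qed

text \<open>If the sum vanished, its lowest term would be minus the rest, which decays faster by exp
  (- 2 * pi * \<delta> * Im \<tau>). The exponents are arbitrary reals, so periodicity cannot
  isolate a term; the gap \<delta> does.\<close>

lemma qexp_series_nonzero:
  fixes f :: "'a \<Rightarrow> complex" and E :: "'a \<Rightarrow> real"
  assumes hs: "\<And>\<tau>. Im \<tau> > 0 \<Longrightarrow> ((\<lambda>i. f i * qexp (E i) \<tau>) has_sum \<psi> \<tau>) A"
    and i0: "i0 \<in> A" "f i0 \<noteq> 0" and \<delta>: "\<delta> > 0"
    and gap: "\<And>i. i \<in> A \<Longrightarrow> f i \<noteq> 0 \<Longrightarrow> i \<noteq> i0 \<Longrightarrow> E i \<ge> E i0 + \<delta>"
  shows "\<exists>\<tau>. Im \<tau> > 0 \<and> \<psi> \<tau> \<noteq> 0"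
proof (rule ccontr)
  assume "\<not> ?thesis"
  then have zero: "\<psi> \<tau> = 0" if "Im \<tau> > 0" for \<tau> using that by blast
  have hs': "((\<lambda>i. f i * qexp (E i) \<tau>) has_sum (- (f i0 * qexp (E i0) \<tau>))) (A - {i0})"
    if "Im \<tau> > 0" for \<tau>
  proof -
    have "((\<lambda>i. f i * qexp (E i) \<tau>) has_sum (\<psi> \<tau> - f i0 * qexp (E i0) \<tau>)) (A - {i0})"
      using i0 by (intro has_sum_Diff hs that has_sum_finiteI) auto
    then show ?thesis using zero[OF that] by simp
  qed
  obtain C where C: "C \<ge> 0"
    "\<And>\<tau>. Im \<tau> \<ge> 1/2 \<Longrightarrow>
       norm (- (f i0 * qexp (E i0) \<tau>)) \<le> C * exp (- 2 * pi * (E i0 + \<delta>) * Im \<tau>)"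
  proof (rule qexp_series_bound[where f = f and E = E and A = "A - {i0}" and \<nu> = "E i0 + \<delta>"
        and \<psi> = "\<lambda>\<tau>. - (f i0 * qexp (E i0) \<tau>)"])
    show "((\<lambda>i. f i * qexp (E i) \<tau>) has_sum - (f i0 * qexp (E i0) \<tau>)) (A - {i0})"
      if "Im \<tau> > 0" for \<tau> by (rule hs'[OF that])
  qed (use gap in blast)+
  have le: "norm (f i0) \<le> C * exp (- (2 * pi * \<delta>) * y)" if "y \<ge> 1/2" for y
  proof -
    have "norm (f i0) * exp (- 2 * pi * E i0 * y) \<le> C * exp (- 2 * pi * (E i0 + \<delta>) * y)"
      using C(2)[of "Complex 0 y"] that by (simp add: norm_mult norm_qexp)
    also have "\<dots> = C * exp (- (2 * pi * \<delta>) * y) * exp (- 2 * pi * E i0 * y)"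
      unfolding mult.assoc exp_add[symmetric] by (simp add: algebra_simps)
    finally show ?thesis by simp
  qed
  have "((\<lambda>y. C * exp (- (2 * pi * \<delta>) * y)) \<longlongrightarrow> 0) at_top"
    using \<delta> by real_asymp
  moreover have "eventually (\<lambda>y. norm (f i0) \<le> C * exp (- (2 * pi * \<delta>) * y)) at_top"
    using eventually_ge_at_top[of "1/2::real"] by (rule eventually_mono) (rule le)
  ultimately have "norm (f i0) \<le> 0" by (rule tendsto_lowerbound) simp
  then show False using i0 by simp
qed

text \<open>Members that vanish identically are left out, so that the product does not vanish.\<close>

lemma prod_permuted:
  fixes u :: "'a \<Rightarrow> complex \<Rightarrow> real"
  assumes X: "finite X" and \<sigma>: "inj_on \<sigma> X" "\<sigma> ` X \<subseteq> X"
    and t: "\<And>\<tau>. Im \<tau> > 0 \<Longrightarrow> Im (t \<tau>) > 0"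
    and surj: "\<And>\<tau>. Im \<tau> > 0 \<Longrightarrow> \<exists>\<tau>'. Im \<tau>' > 0 \<and> t \<tau>' = \<tau>"
    and u: "\<And>x \<tau>. x \<in> X \<Longrightarrow> Im \<tau> > 0 \<Longrightarrow> u x (t \<tau>) = u (\<sigma> x) \<tau>"
    and "Im \<tau> > 0"
  defines "X' \<equiv> {x \<in> X. \<exists>\<tau>. Im \<tau> > 0 \<and> u x \<tau> \<noteq> 0}"
  shows "(\<Prod>x\<in>X'. u x (t \<tau>)) = (\<Prod>x\<in>X'. u x \<tau>)"
proof -
  have fin: "finite X'" using X by (simp add: X'_def)
  \<comment> \<open>Surjectivity of \<open>t\<close> pulls a point where \<open>u x\<close> is
    nonzero back to one where \<open>u (\<sigma> x)\<close> is nonzero, so \<sigma> maps the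
    retained indices to retained ones. Finiteness and injectivity make it a permutation of
    them.\<close>
  have sub: "\<sigma> ` X' \<subseteq> X'"
  proof clarify
    fix x assume "x \<in> X'"
    then obtain \<tau>1 where x: "x \<in> X" "Im \<tau>1 > 0" "u x \<tau>1 \<noteq> 0" by (auto simp: X'_def)
    then obtain \<tau>' where "Im \<tau>' > 0" "t \<tau>' = \<tau>1" using surj by blast
    then have "u (\<sigma> x) \<tau>' \<noteq> 0" using u[of x \<tau>'] x by simp
    then show "\<sigma> x \<in> X'" using x \<sigma>(2) \<open>Im \<tau>' > 0\<close> by (auto simp: X'_def)
  qed
  have inj: "inj_on \<sigma> X'" by (rule inj_on_subset[OF \<sigma>(1)]) (auto simp: X'_def)
  then have bij: "bij_betw \<sigma> X' X'"
    using endo_inj_surj[OF fin sub] by (simp add: bij_betw_def)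
  have "(\<Prod>x\<in>X'. u x (t \<tau>)) = (\<Prod>x\<in>X'. u (\<sigma> x) \<tau>)"
    using u \<open>Im \<tau> > 0\<close> by (intro prod.cong) (auto simp: X'_def)
  also have "\<dots> = (\<Prod>x\<in>X'. u x \<tau>)" by (rule prod.reindex_bij_betw[OF bij])
  finally show ?thesis .
qed

text \<open>The product of the earlier factors is nonzero on a nonempty open set; a further factor
  vanishing there would vanish identically by analytic continuation.\<close>

lemma holomorphic_prod_nonzero:
  assumes "finite X" and "\<And>x. x \<in> X \<Longrightarrow> f x holomorphic_on upper_half"
    and "\<And>x. x \<in> X \<Longrightarrow> \<exists>\<tau>. Im \<tau> > 0 \<and> f x \<tau> \<noteq> 0"
  shows "\<exists>\<tau>. Im \<tau> > 0 \<and> (\<Prod>x\<in>X. f x \<tau>) \<noteq> (0::complex)"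
  using assms
proof (induction X rule: finite_induct)
  case empty
  then show ?case by (intro exI[of _ \<i>]) auto
next
  case (insert x X)
  define g where "g \<tau> = (\<Prod>x\<in>X. f x \<tau>)" for \<tau>
  have holf: "f x holomorphic_on upper_half" using insert.prems by simp
  have holg: "g holomorphic_on upper_half"
    unfolding g_def using insert.prems by (intro holomorphic_on_prod) auto
  obtain \<tau>1 where \<tau>1: "Im \<tau>1 > 0" "g \<tau>1 \<noteq> 0" using insert by (auto simp: g_def)
  define U where "U = {\<tau> \<in> upper_half. g \<tau> \<noteq> 0}"
  have U: "open U"
    unfolding U_def using continuous_open_preimage[OF holomorphic_on_imp_continuous_on[OF holg]
      open_upper_half, of "- {0}"] by (simp add: vimage_def Int_def open_Compl)
  show ?case
  proof (rule ccontr)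
    assume "\<not> ?thesis"
    then have "f x \<tau> = 0" if "\<tau> \<in> U" for \<tau>
      using that insert.hyps by (auto simp: U_def g_def upper_half_def)
    then have "f x \<tau> = 0" if "Im \<tau> > 0" for \<tau>
      using analytic_continuation_open[OF U open_upper_half _ connected_upper_half _ holf, of "\<lambda>_. 0" \<tau>]
        \<tau>1 that by (auto simp: U_def upper_half_def)
    then show False using insert.prems by blast
  qed
qed

text \<open>In the product of the retained members weights and orders add up, and the permutations
  \<sigma> and \<rho> become invariance under translation and inversion. The right side counts all
  of X, at least as many as are retained.\<close>

proposition sum_vanishing_orders_bound:
  fixes \<psi> :: "'a \<Rightarrow> complex \<Rightarrow> complex" and k :: nat
  defines "u \<equiv> \<lambda>x \<tau>. norm (\<psi> x \<tau>) * Im \<tau> powr (real k / 2)"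
  assumes X: "finite X" and hol: "\<And>x. x \<in> X \<Longrightarrow> \<psi> x holomorphic_on upper_half"
    and T: "inj_on \<sigma> X" "\<sigma> ` X \<subseteq> X"
      "\<And>x \<tau>. x \<in> X \<Longrightarrow> Im \<tau> > 0 \<Longrightarrow> u x (\<tau> + 1) = u (\<sigma> x) \<tau>"
    and S: "inj_on \<rho> X" "\<rho> ` X \<subseteq> X"
      "\<And>x \<tau>. x \<in> X \<Longrightarrow> Im \<tau> > 0 \<Longrightarrow> u x (- 1 / \<tau>) = u (\<rho> x) \<tau>"
    and decay: "\<And>x. x \<in> X \<Longrightarrow>
      \<exists>C\<ge>0. \<forall>\<tau>. Im \<tau> \<ge> 1/2 \<longrightarrow> norm (\<psi> x \<tau>) \<le> C * exp (- 2 * pi * \<nu> x * Im \<tau>)"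
  shows "(\<Sum>x | x \<in> X \<and> (\<exists>\<tau>. Im \<tau> > 0 \<and> \<psi> x \<tau> \<noteq> 0). \<nu> x) \<le> real k * real (card X) * 5 / 54"
proof -
  define X' where "X' = {x \<in> X. \<exists>\<tau>. Im \<tau> > 0 \<and> u x \<tau> \<noteq> 0}"
  have X'eq: "{x. x \<in> X \<and> (\<exists>\<tau>. Im \<tau> > 0 \<and> \<psi> x \<tau> \<noteq> 0)} = X'"
    unfolding X'_def u_def by force
  have fin: "finite X'" using X by (simp add: X'_def)
  define F where "F \<tau> = (\<Prod>x\<in>X'. \<psi> x \<tau>)" for \<tau>
  define w where "w = real k * real (card X')"
  have G: "norm (F \<tau>) * Im \<tau> powr (w / 2) = (\<Prod>x\<in>X'. u x \<tau>)" if "Im \<tau> > 0" for \<tau>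
  proof -
    have "(\<Prod>x\<in>X'. u x \<tau>) = norm (F \<tau>) * (Im \<tau> powr (real k / 2)) ^ card X'"
      by (simp add: u_def F_def prod.distrib prod_norm)
    also have "(Im \<tau> powr (real k / 2)) ^ card X' = Im \<tau> powr (w / 2)"
      using that by (simp add: powr_power w_def mult.commute)
    finally show ?thesis by simp
  qed
  obtain C where C: "\<And>x. x \<in> X \<Longrightarrow> C x \<ge> 0"
    "\<And>x \<tau>. x \<in> X \<Longrightarrow> Im \<tau> \<ge> 1/2 \<Longrightarrow> norm (\<psi> x \<tau>) \<le> C x * exp (- 2 * pi * \<nu> x * Im \<tau>)"
    using decay by metis
  have "(\<Sum>x\<in>X'. \<nu> x) \<le> w * 5 / 54"
  proof (rule vanishing_order_bound)
    show "0 \<le> w" by (simp add: w_def)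
    show "F holomorphic_on upper_half"
      unfolding F_def using hol by (intro holomorphic_on_prod) (auto simp: X'_def)
    fix \<tau> :: complex
    show "norm (F (\<tau> + 1)) * Im (\<tau> + 1) powr (w / 2) = norm (F \<tau>) * Im \<tau> powr (w / 2)"
      if "Im \<tau> > 0"
    proof -
      have "(\<Prod>x\<in>X'. u x (\<tau> + 1)) = (\<Prod>x\<in>X'. u x \<tau>)" unfolding X'_def
      proof (rule prod_permuted[OF X T(1,2)])
        show "\<exists>\<tau>'. Im \<tau>' > 0 \<and> \<tau>' + 1 = \<rho>" if "Im \<rho> > 0" for \<rho>
          using that by (intro exI[of _ "\<rho> - 1"]) auto
      qed (use that T(3) in auto)
      then show ?thesis using that G[of \<tau>] G[of "\<tau> + 1"] by simp
    qed
    show "norm (F (- 1 / \<tau>)) * Im (- 1 / \<tau>) powr (w / 2) = norm (F \<tau>) * Im \<tau> powr (w / 2)"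
      if "Im \<tau> > 0"
    proof -
      have im: "Im (- 1 / \<rho>) > 0" if "Im \<rho> > 0" for \<rho>
        using that by (auto simp: Im_divide sum_power2_gt_zero_iff)
      have "(\<Prod>x\<in>X'. u x (- 1 / \<tau>)) = (\<Prod>x\<in>X'. u x \<tau>)" unfolding X'_def
      proof (rule prod_permuted[OF X S(1,2)])
        show "\<exists>\<tau>'. Im \<tau>' > 0 \<and> - 1 / \<tau>' = \<rho>" if "Im \<rho> > 0" for \<rho>
          using that im[OF that] by (intro exI[of _ "- 1 / \<rho>"]) auto
      qed (use that S(3) im in blast)+
      then show ?thesis using that G[of \<tau>] G[of "- 1 / \<tau>"] im[OF that] by simp
    qed
    show "norm (F \<tau>) \<le> (\<Prod>x\<in>X'. C x) * exp (- 2 * pi * (\<Sum>x\<in>X'. \<nu> x) * Im \<tau>)"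
      if "Im \<tau> \<ge> 1/2"
    proof -
      have "norm (F \<tau>) = (\<Prod>x\<in>X'. norm (\<psi> x \<tau>))" by (simp add: F_def prod_norm)
      also have "\<dots> \<le> (\<Prod>x\<in>X'. C x * exp (- 2 * pi * \<nu> x * Im \<tau>))"
        using C that by (intro prod_mono) (auto simp: X'_def)
      also have "\<dots> = (\<Prod>x\<in>X'. C x) * exp (\<Sum>x\<in>X'. - 2 * pi * \<nu> x * Im \<tau>)"
        by (simp add: prod.distrib exp_sum fin)
      also have "(\<Sum>x\<in>X'. - 2 * pi * \<nu> x * Im \<tau>) = - 2 * pi * (\<Sum>x\<in>X'. \<nu> x) * Im \<tau>"
        by (simp add: sum_distrib_left sum_distrib_right sum_negf)
      finally show ?thesis .
    qed
  next
    show "\<exists>\<tau>. Im \<tau> > 0 \<and> F \<tau> \<noteq> 0"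
      unfolding F_def using hol fin
      by (intro holomorphic_prod_nonzero) (auto simp: X'_def u_def)
  qed
  also have "w * 5 / 54 \<le> real k * real (card X) * 5 / 54"
    using X by (auto simp: w_def X'_def intro!: divide_right_mono mult_right_mono mult_left_mono card_mono)
  finally show ?thesis by (simp only: X'eq)
qed

section \<open>Values of Jacobi forms at torsion points\<close>

lemma cform_cvec: "cform (cvec x) (cvec y) = of_real (x \<bullet> y)"
  by (simp add: cform_def cvec_def inner_vec_def)

lemma cform_add_left: "cform (x + y) z = cform x z + cform y z"
  by (simp add: cform_def algebra_simps sum.distrib)

lemma cform_add_right: "cform x (y + z) = cform x y + cform x z"
  by (simp add: cform_def algebra_simps sum.distrib)

lemma cform_scale_left: "cform (c *s x) y = c * cform x y"
  by (simp add: cform_def sum_distrib_left mult_ac)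

lemma cform_scale_right: "cform x (c *s y) = c * cform x y"
  by (simp add: cform_def sum_distrib_left mult_ac)

lemmas cform_simps = cform_cvec cform_add_left cform_add_right cform_scale_left cform_scale_right

lemma cvec_add: "cvec (x + y) = cvec x + cvec y"
  by (simp add: cvec_def vec_eq_iff)

section \<open>Moebius transformations and their factors of automorphy\<close>

definition mob :: "int ^ 2 ^ 2 \<Rightarrow> complex \<Rightarrow> complex" where
  "mob A \<tau> = (of_int (A $ 1 $ 1) * \<tau> + of_int (A $ 1 $ 2)) / (of_int (A $ 2 $ 1) * \<tau> + of_int (A $ 2 $ 2))"

definition jfac :: "int ^ 2 ^ 2 \<Rightarrow> complex \<Rightarrow> complex" where
  "jfac A \<tau> = of_int (A $ 2 $ 1) * \<tau> + of_int (A $ 2 $ 2)"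

lemma matrix_mult_2:
  fixes A B :: "int ^ 2 ^ 2"
  shows "(A ** B) $ i $ j = A $ i $ 1 * B $ 1 $ j + A $ i $ 2 * B $ 2 $ j"
  by (simp add: matrix_matrix_mult_def sum_2)

lemma jfac_nonzero:
  assumes "det A = 1" "Im \<tau> > 0"
  shows "jfac A \<tau> \<noteq> 0"
proof
  assume *: "jfac A \<tau> = 0"
  then have "Im (jfac A \<tau>) = 0" "Re (jfac A \<tau>) = 0" by auto
  then have "A $ 2 $ 1 = 0" "A $ 2 $ 2 = 0" using assms(2) by (auto simp: jfac_def)
  then show False using assms(1) by (simp add: det_2)
qed

lemma Im_mob:
  assumes "det A = 1" "Im \<tau> > 0"
  shows "Im (mob A \<tau>) = Im \<tau> / (norm (jfac A \<tau>))\<^sup>2"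
proof -
  have "real_of_int (det A) = 1" using assms(1) by simp
  then have d: "real_of_int (A $ 1 $ 1) * real_of_int (A $ 2 $ 2) - real_of_int (A $ 1 $ 2) * real_of_int (A $ 2 $ 1) = 1"
    by (simp add: det_2)
  have "Im (mob A \<tau>) = ((real_of_int (A $ 1 $ 1) * real_of_int (A $ 2 $ 2) - real_of_int (A $ 1 $ 2) * real_of_int (A $ 2 $ 1)) * Im \<tau>) / (norm (jfac A \<tau>))\<^sup>2"
    unfolding mob_def jfac_def[symmetric] by (simp add: Im_divide cmod_power2 jfac_def algebra_simps)
  then show ?thesis unfolding d by simp
qed

lemma Im_mob_pos: "det A = 1 \<Longrightarrow> Im \<tau> > 0 \<Longrightarrow> Im (mob A \<tau>) > 0"
  using Im_mob jfac_nonzero by (simp add: zero_less_power)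

lemma mob_mult:
  assumes "det A = 1" "det B = 1" "Im \<tau> > 0"
  shows "mob (A ** B) \<tau> = mob A (mob B \<tau>)"
proof -
  have j: "jfac B \<tau> \<noteq> 0" using jfac_nonzero assms by blast
  have num: "of_int (A $ i $ 1) * mob B \<tau> + of_int (A $ i $ 2) =
     (of_int ((A ** B) $ i $ 1) * \<tau> + of_int ((A ** B) $ i $ 2)) / jfac B \<tau>" for i
    using j unfolding mob_def jfac_def[symmetric] by (simp add: field_simps matrix_mult_2) (simp add: jfac_def algebra_simps)
  show ?thesis unfolding mob_def[of A] num mob_def[of "A ** B"] using j by simp
qed

text \<open>Up to a constant of modulus one this is the value at z = 0 of \<phi> acted on by the
  element (\<xi>, \<eta>) of the real Heisenberg group.\<close>

definition torval :: "nat \<Rightarrow> (complex \<Rightarrow> complex ^ 'n \<Rightarrow> complex) \<Rightarrow> complex \<Rightarrow> real ^ 'n \<Rightarrow> real ^ 'n \<Rightarrow> complex" where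
  "torval m \<phi> \<tau> \<xi> \<eta> =
     exp (of_real pi * \<i> * of_nat m * (of_real (\<xi> \<bullet> \<xi>) * \<tau>)) * \<phi> \<tau> (\<tau> *s cvec \<xi> + cvec \<eta>)"

text \<open>Expanding the square of \<xi> + x yields the exponential of the translation law at z =
  \<tau> \<xi> + \<eta>, except for the cross term of x with \<eta>. That term is real, so it only
  contributes a phase.\<close>

lemma norm_torval_translate:
  assumes "exp (of_real pi * \<i> * of_nat m * (of_real (x \<bullet> x) * \<tau> + 2 * cform (cvec x) z)) *
              \<phi> \<tau> (z + \<tau> *s cvec x + cvec y) = \<phi> \<tau> z"
    and z: "z = \<tau> *s cvec \<xi> + cvec \<eta>"
  shows "norm (torval m \<phi> \<tau> (\<xi> + x) (\<eta> + y)) = norm (torval m \<phi> \<tau> \<xi> \<eta>)"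
proof -
  have arg: "\<tau> *s cvec (\<xi> + x) + cvec (\<eta> + y) = z + \<tau> *s cvec x + cvec y"
    by (simp add: z cvec_add algebra_simps vector_add_ldistrib)
  define e where "e w = exp (of_real pi * \<i> * of_nat m * w)" for w :: complex
  have "(\<xi> + x) \<bullet> (\<xi> + x) = \<xi> \<bullet> \<xi> + 2 * (x \<bullet> \<xi>) + x \<bullet> x"
    by (simp add: inner_add_left inner_add_right inner_commute)
  then have "of_real ((\<xi> + x) \<bullet> (\<xi> + x)) * \<tau> =
      of_real (\<xi> \<bullet> \<xi>) * \<tau> + (of_real (x \<bullet> x) * \<tau> + 2 * cform (cvec x) z) + of_real (- 2 * (x \<bullet> \<eta>))"
    by (simp add: z cform_simps algebra_simps)
  then have "e (of_real ((\<xi> + x) \<bullet> (\<xi> + x)) * \<tau>) =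
      e (of_real (\<xi> \<bullet> \<xi>) * \<tau>) * e (of_real (x \<bullet> x) * \<tau> + 2 * cform (cvec x) z) * e (of_real (- 2 * (x \<bullet> \<eta>)))"
    by (simp only: e_def exp_add[symmetric] distrib_left)
  then have "torval m \<phi> \<tau> (\<xi> + x) (\<eta> + y) = e (of_real (- 2 * (x \<bullet> \<eta>))) * torval m \<phi> \<tau> \<xi> \<eta>"
    unfolding torval_def arg z[symmetric] e_def[symmetric] assms(1)[symmetric, unfolded e_def[symmetric]]
    by (simp only: mult_ac)
  moreover have "norm (e (of_real (- 2 * (x \<bullet> \<eta>)))) = 1" by (simp add: e_def)
  ultimately show ?thesis by (simp add: norm_mult)
qed

text \<open>Dividing z = \<tau> \<xi> + \<eta> by the automorphy factor gives \<xi>' times the image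
  of \<tau> plus \<eta>', where the row vector (\<xi>', \<eta>') is (\<xi>, \<eta>) times the
  inverse of A. The Gaussian factor of the slash operator is what adjusts the quadratic
  exponent.\<close>

lemma norm_torval_slash:
  assumes det: "det A = 1" and \<tau>: "Im \<tau> > 0"
  defines "a \<equiv> real_of_int (A $ 1 $ 1)" and "b \<equiv> real_of_int (A $ 1 $ 2)"
    and "c \<equiv> real_of_int (A $ 2 $ 1)" and "d \<equiv> real_of_int (A $ 2 $ 2)"
  shows "norm (torval m (slash k m \<phi> A) \<tau> \<xi> \<eta>) =
     norm (jfac A \<tau>) powi (- k) *
     norm (torval m \<phi> (mob A \<tau>) (d *\<^sub>R \<xi> - c *\<^sub>R \<eta>) (a *\<^sub>R \<eta> - b *\<^sub>R \<xi>))"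
proof -
  define j where "j = of_real c * \<tau> + of_real d"
  have jf: "jfac A \<tau> = j" by (simp add: j_def jfac_def c_def d_def)
  have j0: "j \<noteq> 0" using jfac_nonzero[OF det \<tau>] jf by simp
  have mob: "mob A \<tau> = (of_real a * \<tau> + of_real b) / j"
    by (simp add: mob_def j_def a_def b_def c_def d_def)
  have "real_of_int (det A) = 1" using det by simp
  then have ad: "a * d - b * c = 1" by (simp add: det_2 a_def b_def c_def d_def)
  then have adc: "of_real a * of_real d - of_real b * of_real c = (1::complex)"
    by (metis of_real_1 of_real_diff of_real_mult)
  define l' m' where "l' = d *\<^sub>R \<xi> - c *\<^sub>R \<eta>" and "m' = a *\<^sub>R \<eta> - b *\<^sub>R \<xi>"
  define z where "z = \<tau> *s cvec \<xi> + cvec \<eta>"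
  have z': "inverse j *s z = mob A \<tau> *s cvec l' + cvec m'"
  proof (subst vec_eq_iff, intro allI)
    fix i
    define p q where "p = complex_of_real (\<xi> $ i)" and "q = complex_of_real (\<eta> $ i)"
    have "(of_real a * \<tau> + of_real b) * (of_real d * p - of_real c * q) + (of_real a * q - of_real b * p) * j =
       (of_real a * of_real d - of_real b * of_real c) * (\<tau> * p + q)"
      by (simp add: j_def algebra_simps)
    then have "mob A \<tau> * (of_real d * p - of_real c * q) + (of_real a * q - of_real b * p) = inverse j * (\<tau> * p + q)"
      using j0 unfolding adc mob by (simp add: field_simps)
    then show "(inverse j *s z) $ i = (mob A \<tau> *s cvec l' + cvec m') $ i"
      by (simp add: z_def l'_def m'_def p_def q_def cvec_def distrib_left mult.assoc)
  qed
  define Z where "Z = cform z z"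
  define P Q R where "P = complex_of_real (\<xi> \<bullet> \<xi>)" and "Q = complex_of_real (\<xi> \<bullet> \<eta>)"
    and "R = complex_of_real (\<eta> \<bullet> \<eta>)"
  have Z: "Z = P * \<tau>\<^sup>2 + 2 * Q * \<tau> + R"
    by (simp add: Z_def z_def cform_simps P_def Q_def R_def inner_commute algebra_simps power2_eq_square)
  \<comment> \<open>The real remainder in \<open>key\<close>: multiplied by pi * \<i> * m and
    exponentiated it has modulus one, so the quadratic exponents agree up to a phase.\<close>
  define r where "r = d * b * (\<xi> \<bullet> \<xi>) - 2 * b * c * (\<xi> \<bullet> \<eta>) + a * c * (\<eta> \<bullet> \<eta>)"
  have l'2: "complex_of_real (l' \<bullet> l') = of_real d ^ 2 * P - 2 * of_real c * of_real d * Q + of_real c ^ 2 * R"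
    by (simp add: l'_def P_def Q_def R_def inner_diff_left inner_diff_right inner_commute
        algebra_simps power2_eq_square)
  have r: "complex_of_real r = of_real d * of_real b * P - 2 * of_real b * of_real c * Q + of_real a * of_real c * R"
    by (simp add: r_def P_def Q_def R_def)
  have key: "of_real (l' \<bullet> l') * mob A \<tau> = P * \<tau> - of_real c * Z / j + of_real r"
  proof -
    have "of_real (l' \<bullet> l') * (of_real a * \<tau> + of_real b) - (P * \<tau> * j - of_real c * Z + of_real r * j) =
        (of_real a * of_real d - of_real b * of_real c - 1) * (of_real d * P * \<tau> - 2 * of_real c * Q * \<tau> - of_real c * R)"
      unfolding l'2 r Z j_def by algebra
    then have "of_real (l' \<bullet> l') * (of_real a * \<tau> + of_real b) = P * \<tau> * j - of_real c * Z + of_real r * j"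
      unfolding adc by simp
    then show ?thesis using j0 unfolding mob by (simp add: field_simps)
  qed
  define e where "e w = exp (of_real pi * \<i> * of_nat m * w)" for w :: complex
  have e_add: "e (x + y) = e x * e y" for x y by (simp add: e_def distrib_left exp_add)
  have e_real: "norm (e (of_real x)) = 1" for x by (simp add: e_def)
  have "torval m (slash k m \<phi> A) \<tau> \<xi> \<eta> =
     j powi (- k) * (e (P * \<tau>) * e (- (of_real c * Z / j))) * \<phi> (mob A \<tau>) (inverse j *s z)"
    by (simp add: torval_def slash_def Let_def e_def P_def Z_def[symmetric] z_def[symmetric]
        mob a_def b_def c_def d_def j_def mult_ac)
  also have "e (P * \<tau>) * e (- (of_real c * Z / j)) = e (P * \<tau> - of_real c * Z / j)"
    by (simp flip: e_add)
  also have "norm (j powi (- k) * \<dots> * \<phi> (mob A \<tau>) (inverse j *s z)) =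
     norm j powi (- k) * norm (e (of_real (l' \<bullet> l') * mob A \<tau>) * \<phi> (mob A \<tau>) (inverse j *s z))"
    unfolding key e_add by (simp add: norm_mult norm_power_int e_real)
  also have "e (of_real (l' \<bullet> l') * mob A \<tau>) * \<phi> (mob A \<tau>) (inverse j *s z) = torval m \<phi> (mob A \<tau>) l' m'"
    by (simp add: torval_def e_def z')
  finally show ?thesis by (simp only: jf l'_def m'_def)
qed

lemma torval_holomorphic:
  assumes "holomorphic_HxC \<phi>"
  shows "(\<lambda>\<tau>. torval m \<phi> \<tau> \<xi> \<eta>) holomorphic_on upper_half"
proof -
  have "(\<lambda>\<tau>. \<phi> \<tau> (\<tau> *s cvec \<xi> + cvec \<eta>)) field_differentiable at \<tau>" if "Im \<tau> > 0" for \<tau>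
  proof -
    have "\<exists>D. ((\<lambda>(t, w). \<phi> t w) has_derivative D) (at (\<tau>, \<tau> *s cvec \<xi> + cvec \<eta>)) \<and>
             (\<forall>c t w. D (c * t, c *s w) = c * D (t, w))"
      using assms that by (simp add: holomorphic_HxC_def)
    then obtain D where D: "((\<lambda>(t, w). \<phi> t w) has_derivative D) (at (\<tau>, \<tau> *s cvec \<xi> + cvec \<eta>))"
      "\<And>c t w. D (c * t, c *s w) = c * D (t, w)"
      by auto
    have lin: "bounded_linear (\<lambda>h. h *s cvec \<xi>)"
      by (intro linear_conv_bounded_linear[THEN iffD1] linearI)
        (simp_all add: vec_eq_iff algebra_simps)
    have "((\<lambda>t. (t, t *s cvec \<xi> + cvec \<eta>)) has_derivative (\<lambda>h. (h, h *s cvec \<xi>))) (at \<tau>)"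
      using has_derivative_Pair[OF has_derivative_ident[of "at \<tau>"]
          has_derivative_add[OF bounded_linear.has_derivative[OF lin has_derivative_ident[of "at \<tau>"]] has_derivative_const[of "cvec \<eta>" "at \<tau>"]]]
      by simp
    from has_derivative_compose[OF this, of "\<lambda>(t, w). \<phi> t w" D] D(1)
    have "((\<lambda>t. \<phi> t (t *s cvec \<xi> + cvec \<eta>)) has_derivative (\<lambda>h. D (h, h *s cvec \<xi>))) (at \<tau>)"
      by simp
    \<comment> \<open>Complex homogeneity of D turns the derivative along the complex line into
      multiplication by a complex number.\<close>
    also have "(\<lambda>h. D (h, h *s cvec \<xi>)) = (\<lambda>h. D (1, cvec \<xi>) * h)"
      using D(2)[of _ 1 "cvec \<xi>"] by (auto simp: mult.commute)
    finally show ?thesis by (auto simp: field_differentiable_def has_field_derivative_def)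
  qed
  then have "(\<lambda>\<tau>. \<phi> \<tau> (\<tau> *s cvec \<xi> + cvec \<eta>)) holomorphic_on upper_half"
    by (auto simp: holomorphic_on_def upper_half_def intro: field_differentiable_at_within)
  then show ?thesis unfolding torval_def by (intro holomorphic_intros)
qed

text \<open>The exponent of q that the term (r, l) acquires at z = \<tau> \<xi> + \<eta>. For m > 0
  it equals r - |l|^2 / (2m) + |l + m \<xi>|^2 / (2m), so the support condition makes it
  nonnegative.\<close>

definition index_exp :: "nat \<Rightarrow> real ^ 'n \<Rightarrow> rat \<times> (real ^ 'n) \<Rightarrow> real" where
  "index_exp m \<xi> = (\<lambda>(r, l). of_rat r + l \<bullet> \<xi> + real m * (\<xi> \<bullet> \<xi>) / 2)"

lemma torval_expansion:
  assumes "((\<lambda>(r, l). f r l * exp (2 * of_real pi * \<i> * (of_rat r * \<tau> + cform (cvec l) (\<tau> *s cvec \<xi> + cvec \<eta>))))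
              has_sum \<psi> \<tau> (\<tau> *s cvec \<xi> + cvec \<eta>)) X"
  shows "((\<lambda>p. (f (fst p) (snd p) * exp (2 * of_real pi * \<i> * of_real (snd p \<bullet> \<eta>))) * qexp (index_exp m \<xi> p) \<tau>)
              has_sum torval m \<psi> \<tau> \<xi> \<eta>) X"
proof -
  have "((\<lambda>p. exp (of_real pi * \<i> * of_nat m * (of_real (\<xi> \<bullet> \<xi>) * \<tau>)) *
      (case p of (r, l) \<Rightarrow> f r l * exp (2 * of_real pi * \<i> * (of_rat r * \<tau> + cform (cvec l) (\<tau> *s cvec \<xi> + cvec \<eta>)))))
     has_sum torval m \<psi> \<tau> \<xi> \<eta>) X"
    unfolding torval_def by (rule has_sum_cmult_right) (rule assms)
  moreover have "exp (of_real pi * \<i> * of_nat m * (of_real (\<xi> \<bullet> \<xi>) * \<tau>)) *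
      (case p of (r, l) \<Rightarrow> f r l * exp (2 * of_real pi * \<i> * (of_rat r * \<tau> + cform (cvec l) (\<tau> *s cvec \<xi> + cvec \<eta>)))) =
     (f (fst p) (snd p) * exp (2 * of_real pi * \<i> * of_real (snd p \<bullet> \<eta>))) * qexp (index_exp m \<xi> p) \<tau>" for p
  proof -
    obtain r l where p: "p = (r, l)" by fastforce
    have rr: "complex_of_real (of_rat r) = of_rat r" by (cases r) (simp add: of_rat_rat)
    show ?thesis
      by (simp add: p qexp_def index_exp_def cform_simps rr exp_add[symmetric] algebra_simps)
  qed
  ultimately show ?thesis by simp
qed

section \<open>Exponents and generic non-vanishing\<close>

locale orthogonal_frame =
  fixes v :: "nat \<Rightarrow> real ^ 'n" and d :: "nat \<Rightarrow> nat"
  assumes d_pos: "j \<in> {1..CARD('n)} \<Longrightarrow> d j > 0"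
    and inner_v: "i \<in> {1..CARD('n)} \<Longrightarrow> j \<in> {1..CARD('n)} \<Longrightarrow>
      v i \<bullet> v j = (if i = j then 2 * real (d j) else 0)"
begin

lemma inner_combination:
  "(\<Sum>j=1..CARD('n). x j *\<^sub>R v j) \<bullet> (\<Sum>j=1..CARD('n). y j *\<^sub>R v j) =
     (\<Sum>j=1..CARD('n). 2 * real (d j) * x j * y j)"
proof -
  have "(\<Sum>j=1..CARD('n). x j *\<^sub>R v j) \<bullet> (\<Sum>j=1..CARD('n). y j *\<^sub>R v j) =
      (\<Sum>i=1..CARD('n). \<Sum>j=1..CARD('n). x i * y j * (v i \<bullet> v j))"
    by (simp add: inner_sum_left inner_sum_right sum_distrib_left sum_distrib_right mult_ac)
      (rule sum.swap)
  also have "\<dots> = (\<Sum>i=1..CARD('n). \<Sum>j=1..CARD('n). if i = j then 2 * real (d j) * x j * y j else 0)"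
    using inner_v by (intro sum.cong refl) (simp add: mult_ac)
  also have "\<dots> = (\<Sum>j=1..CARD('n). 2 * real (d j) * x j * y j)" by simp
  finally show ?thesis .
qed

lemma exists_inner_nonzero:
  assumes "w \<noteq> 0"
  shows "\<exists>j\<in>{1..CARD('n)}. w \<bullet> v j \<noteq> 0"
proof (rule ccontr)
  assume *: "\<not> ?thesis"
  let ?V = "v ` {1..CARD('n)}"
  have nz: "v j \<noteq> 0" if "j \<in> {1..CARD('n)}" for j
    using inner_v[OF that that] d_pos[OF that] by auto
  have inj: "inj_on v {1..CARD('n)}"
  proof (rule inj_onI)
    fix i j assume ij: "i \<in> {1..CARD('n)}" "j \<in> {1..CARD('n)}" "v i = v j"
    show "i = j"
    proof (rule ccontr)
      assume "i \<noteq> j"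
      then have "v i \<bullet> v j = 0" using inner_v[OF ij(1,2)] by simp
      then show False using ij nz by simp
    qed
  qed
  have "pairwise orthogonal ?V"
    unfolding pairwise_def orthogonal_def using inner_v by auto
  then have "independent ?V" using nz by (intro pairwise_orthogonal_independent) auto
  moreover have "card ?V = DIM(real ^ 'n)" using card_image[OF inj] by simp
  ultimately have "span ?V = UNIV"
    using card_eq_dim[of ?V UNIV] independent_card_le_dim
    by (metis dim_UNIV order_refl span_UNIV span_eq_dim subset_UNIV dim_eq_card_independent dim_eq_full)
  then have "w \<in> span ?V" by simp
  moreover have "orthogonal w x" if "x \<in> ?V" for x using * that by (auto simp: orthogonal_def)
  ultimately have "orthogonal w w" using orthogonal_to_span by blast
  then show False using assms by (simp add: orthogonal_def)
qed

text \<open>A dual vector is determined by its integral products with the frame, and Cauchy-Schwarz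
  bounds these products on a ball.\<close>

lemma finite_dual_ball:
  assumes L: "\<And>j. j \<in> {1..CARD('n)} \<Longrightarrow> v j \<in> L"
  shows "finite {l \<in> dual_lattice L. l \<bullet> l \<le> B}"
proof -
  let ?J = "{1..CARD('n)}"
  define g where "g l = (\<lambda>j\<in>?J. l \<bullet> v j)" for l
  define K where "K j = \<lceil>sqrt B * norm (v j)\<rceil>" for j
  have "g ` {l \<in> dual_lattice L. l \<bullet> l \<le> B} \<subseteq> PiE ?J (\<lambda>j. of_int ` {- K j..K j})"
  proof (intro image_subsetI PiE_I)
    fix l j assume l: "l \<in> {l \<in> dual_lattice L. l \<bullet> l \<le> B}" and j: "j \<in> ?J"
    then have "l \<bullet> v j \<in> \<int>" using L by (auto simp: dual_lattice_def)
    then obtain i where i: "l \<bullet> v j = of_int i" by (auto elim: Ints_cases)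
    have "\<bar>of_int i\<bar> \<le> norm l * norm (v j)" using Cauchy_Schwarz_ineq2[of l "v j"] i by simp
    also have "\<dots> \<le> sqrt B * norm (v j)"
      using l by (intro mult_right_mono) (auto simp: norm_eq_sqrt_inner)
    also have "\<dots> \<le> of_int (K j)" by (simp add: K_def)
    finally have "i \<in> {- K j..K j}" by (simp add: abs_le_iff)
    then show "g l j \<in> of_int ` {- K j..K j}" using i j by (auto simp: g_def)
  qed (auto simp: g_def)
  moreover have "finite (PiE ?J (\<lambda>j. (of_int ` {- K j..K j}) :: real set))" by (intro finite_PiE) auto
  ultimately have "finite (g ` {l \<in> dual_lattice L. l \<bullet> l \<le> B})" by (rule finite_subset)
  moreover have "inj g"
  proof (rule injI, rule ccontr)
    fix x y assume xy: "g x = g y" "x \<noteq> y"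
    then obtain j where "j \<in> ?J" "(x - y) \<bullet> v j \<noteq> 0" using exists_inner_nonzero[of "x - y"] by auto
    moreover have "g x j = g y j" using xy by simp
    ultimately show False by (simp add: g_def inner_diff_left)
  qed
  ultimately show ?thesis by (blast intro: finite_imageD inj_on_subset)
qed

text \<open>Some v j0 is not orthogonal to w, so on the hyperplane the coordinate j0 is determined
  by the others. One dimension is lost, which makes the exceptional points negligible among all grid
  points.\<close>

lemma card_hyperplane_grid:
  fixes w :: "real ^ 'n" and B :: "int set"
  assumes "w \<noteq> 0" "h \<noteq> 0" "finite B"
  shows "card {a \<in> PiE {1..CARD('n)} (\<lambda>_. B). w \<bullet> (\<Sum>j=1..CARD('n). (real_of_int (a j) / h) *\<^sub>R v j) = c}
     \<le> card B ^ (CARD('n) - 1)"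
proof -
  let ?J = "{1..CARD('n)}"
  obtain j0 where j0: "j0 \<in> ?J" "w \<bullet> v j0 \<noteq> 0" using exists_inner_nonzero[OF assms(1)] by blast
  define A where "A = {a \<in> PiE ?J (\<lambda>_. B). w \<bullet> (\<Sum>j=1..CARD('n). (real_of_int (a j) / h) *\<^sub>R v j) = c}"
  have "inj_on (\<lambda>a. restrict a (?J - {j0})) A"
  proof (rule inj_onI)
    fix a b assume a: "a \<in> A" and b: "b \<in> A" and ab: "restrict a (?J - {j0}) = restrict b (?J - {j0})"
    have eq: "a j = b j" if "j \<in> ?J - {j0}" for j using ab that by (metis restrict_apply')
    have split: "w \<bullet> (\<Sum>j\<in>?J. (real_of_int (a j) / h) *\<^sub>R v j) =
       real_of_int (a j0) / h * (w \<bullet> v j0) + (\<Sum>j\<in>?J - {j0}. real_of_int (a j) / h * (w \<bullet> v j))" for a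
      unfolding inner_sum_right inner_scaleR_right by (rule sum.remove) (use j0 in auto)
    have "real_of_int (a j0) / h * (w \<bullet> v j0) = real_of_int (b j0) / h * (w \<bullet> v j0)"
      using a b split[of a] split[of b] eq by (simp add: A_def)
    then have "a j0 = b j0" using j0 assms(2) by simp
    then have "a j = b j" if "j \<in> ?J" for j using eq that by (cases "j = j0") auto
    then show "a = b" using a b by (intro PiE_ext[of a ?J "\<lambda>_. B" b]) (auto simp only: A_def)
  qed
  moreover have "(\<lambda>a. restrict a (?J - {j0})) ` A \<subseteq> PiE (?J - {j0}) (\<lambda>_. B)"
  proof (rule image_subsetI)
    fix a assume "a \<in> A"
    then have a: "a \<in> PiE ?J (\<lambda>_. B)" by (simp only: A_def mem_Collect_eq)
    show "restrict a (?J - {j0}) \<in> PiE (?J - {j0}) (\<lambda>_. B)"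
      by (rule restrict_PiE_iff[THEN iffD2], rule ballI) (rule PiE_mem[OF a], rule DiffD1)
  qed
  moreover have "finite (PiE (?J - {j0}) (\<lambda>_. B))" using assms(3) by (intro finite_PiE) auto
  ultimately have "card A \<le> card (PiE (?J - {j0}) (\<lambda>_. B))" by (rule card_inj_on_le)
  also have "\<dots> = card B ^ (CARD('n) - 1)" using j0 by (simp add: card_PiE)
  finally show ?thesis by (simp add: A_def)
qed

end

section \<open>Exponents of the expansions restricted to torsion points\<close>

lemma finite_q_exponents_le: "finite {r \<in> q_exponents D. real_of_rat r \<le> R}" if "D > 0"
proof -
  have "{r \<in> q_exponents D. real_of_rat r \<le> R} \<subseteq> (\<lambda>i. of_int i / of_nat D) ` {0..\<lceil>real D * R\<rceil>}"
  proof clarify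
    fix r assume r: "r \<in> q_exponents D" "real_of_rat r \<le> R"
    then obtain i where i: "of_nat D * r = of_int i" by (auto simp: q_exponents_def elim: Ints_cases)
    have "real D * real_of_rat r = real_of_int i"
      using arg_cong[OF i, of real_of_rat] by (simp add: of_rat_mult)
    moreover have "0 \<le> real D * real_of_rat r" using r by (simp add: q_exponents_def)
    moreover have "real D * real_of_rat r \<le> real D * R" using r by (intro mult_left_mono) auto
    ultimately have "0 \<le> real_of_int i" "real_of_int i \<le> real D * R" by simp_all
    then have "i \<in> {0..\<lceil>real D * R\<rceil>}" by (simp add: le_ceiling_iff)
    moreover have "r = of_int i / of_nat D" using i that by (simp add: field_simps)
    ultimately show "r \<in> (\<lambda>i. of_int i / of_nat D) ` {0..\<lceil>real D * R\<rceil>}" by blast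
  qed
  then show ?thesis by (rule finite_subset) simp
qed

text \<open>The support condition gives |l| \<le> 2 * sqrt r * sqrt (m / 2), and Cauchy-Schwarz then
  bounds the linear term from below by the cross term of the square.\<close>

lemma index_exp_ge:
  assumes "of_rat r \<ge> (0::real)" "l \<bullet> l \<le> 2 * of_rat r * real m"
  shows "index_exp m \<xi> (r, l) \<ge> (sqrt (of_rat r) - sqrt (real m / 2) * norm \<xi>)\<^sup>2"
proof -
  define s where "s = sqrt (real m / 2) * norm \<xi>"
  have s2: "s\<^sup>2 = real m * (\<xi> \<bullet> \<xi>) / 2" by (simp add: s_def power_mult_distrib power2_norm_eq_inner)
  have "norm l \<le> sqrt (2 * of_rat r * real m)"
    using assms by (simp add: norm_eq_sqrt_inner)
  also have "2 * of_rat r * real m = 4 * (of_rat r * (real m / 2))" by simp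
  also have "sqrt \<dots> = 2 * (sqrt (of_rat r) * sqrt (real m / 2))"
    by (simp only: real_sqrt_mult real_sqrt_four)
  finally have "norm l * norm \<xi> \<le> 2 * (sqrt (of_rat r) * sqrt (real m / 2)) * norm \<xi>"
    by (intro mult_right_mono) auto
  moreover have "\<bar>l \<bullet> \<xi>\<bar> \<le> norm l * norm \<xi>" by (rule Cauchy_Schwarz_ineq2)
  ultimately have "l \<bullet> \<xi> \<ge> - 2 * sqrt (of_rat r) * s" by (simp add: s_def mult_ac)
  then have "of_rat r - 2 * sqrt (of_rat r) * s + s\<^sup>2 \<le> index_exp m \<xi> (r, l)"
    by (simp add: index_exp_def s2)
  moreover have "(sqrt (of_rat r) - s)\<^sup>2 = of_rat r - 2 * sqrt (of_rat r) * s + s\<^sup>2"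
    using assms(1) by (simp add: power2_diff)
  ultimately show ?thesis by (simp add: s_def)
qed

text \<open>The witnesses of \<open>jacobi_expansion\<close> become arguments because the order at
  infinity, the decay and the generic non-vanishing must refer to the same coefficients.\<close>

definition has_jacobi_coeffs ::
  "(real ^ 'n) set \<Rightarrow> nat \<Rightarrow> (complex \<Rightarrow> complex ^ 'n \<Rightarrow> complex) \<Rightarrow> nat \<Rightarrow> (rat \<Rightarrow> real ^ 'n \<Rightarrow> complex) \<Rightarrow> bool" where
  "has_jacobi_coeffs L m \<psi> D f \<longleftrightarrow> D > 0 \<and>
        (\<forall>\<tau> z. Im \<tau> > 0 \<longrightarrow>
           ((\<lambda>(r, l). f r l * exp (2 * of_real pi * \<i> * (of_rat r * \<tau> + cform (cvec l) z)))
              has_sum \<psi> \<tau> z) (q_exponents D \<times> dual_lattice L)) \<and>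
        (\<forall>r\<in>q_exponents D. \<forall>l\<in>dual_lattice L.
           \<not> 2 * of_rat r * real m \<ge> l \<bullet> l \<longrightarrow> f r l = 0)"

lemma jacobi_expansion_iff: "jacobi_expansion L m \<psi> \<longleftrightarrow> (\<exists>D f. has_jacobi_coeffs L m \<psi> D f)"
  unfolding jacobi_expansion_def has_jacobi_coeffs_def by auto

text \<open>Exponents r \<ge> N give (sqrt r - s)^2 \<ge> (sqrt N - s)^2 only if s \<le> sqrt N,
  because the parabola increases only to the right of s. The alternative \<nu> = 0 covers the
  remaining factors.\<close>

lemma torval_decay:
  assumes "has_jacobi_coeffs L m \<psi> D f" and N: "N \<ge> 0"
    and f: "\<And>r l. r \<in> q_exponents D \<Longrightarrow> l \<in> dual_lattice L \<Longrightarrow> f r l \<noteq> 0 \<Longrightarrow> of_rat r \<ge> N"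
    and \<nu>: "\<nu> = 0 \<or> sqrt (real m / 2) * norm \<xi> \<le> sqrt N \<and> \<nu> = (sqrt N - sqrt (real m / 2) * norm \<xi>)\<^sup>2"
  shows "\<exists>C\<ge>0. \<forall>\<tau>. Im \<tau> \<ge> 1/2 \<longrightarrow> norm (torval m \<psi> \<tau> \<xi> \<eta>) \<le> C * exp (- 2 * pi * \<nu> * Im \<tau>)"
proof -
  define c where "c p = f (fst p) (snd p) * exp (2 * of_real pi * \<i> * of_real (snd p \<bullet> \<eta>))" for p
  have hs: "((\<lambda>p. c p * qexp (index_exp m \<xi> p) \<tau>) has_sum torval m \<psi> \<tau> \<xi> \<eta>)
      (q_exponents D \<times> dual_lattice L)" if "Im \<tau> > 0" for \<tau>
    unfolding c_def using assms(1) that by (intro torval_expansion) (simp add: has_jacobi_coeffs_def)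
  have "index_exp m \<xi> p \<ge> \<nu>" if "p \<in> q_exponents D \<times> dual_lattice L" "c p \<noteq> 0" for p
  proof -
    obtain r l where p: "p = (r, l)" by fastforce
    have rl: "r \<in> q_exponents D" "l \<in> dual_lattice L" "f r l \<noteq> 0" using that by (auto simp: p c_def)
    have r: "of_rat r \<ge> N" by (rule f) fact+
    have "l \<bullet> l \<le> 2 * of_rat r * real m"
      using assms(1) rl by (auto simp: has_jacobi_coeffs_def)
    then have ge: "index_exp m \<xi> (r, l) \<ge> (sqrt (of_rat r) - sqrt (real m / 2) * norm \<xi>)\<^sup>2"
      by (intro index_exp_ge order.trans[OF N r])
    from \<nu> show ?thesis
    proof
      assume "\<nu> = 0"
      then show ?thesis using order.trans[OF zero_le_power2 ge] by (simp add: p)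
    next
      assume *: "sqrt (real m / 2) * norm \<xi> \<le> sqrt N \<and> \<nu> = (sqrt N - sqrt (real m / 2) * norm \<xi>)\<^sup>2"
      then have "\<nu> \<le> (sqrt (of_rat r) - sqrt (real m / 2) * norm \<xi>)\<^sup>2"
        using r by (simp add: power_mono)
      then show ?thesis using ge by (simp add: p)
    qed
  qed
  then obtain C where "C \<ge> 0" "\<And>\<tau>. Im \<tau> \<ge> 1/2 \<Longrightarrow> norm (torval m \<psi> \<tau> \<xi> \<eta>) \<le> C * exp (- 2 * pi * \<nu> * Im \<tau>)"
    using qexp_series_bound[where f = c and E = "index_exp m \<xi>" and \<nu> = \<nu>
        and \<psi> = "\<lambda>\<tau>. torval m \<psi> \<tau> \<xi> \<eta>", OF hs] by metis
  then show ?thesis by metis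
qed

text \<open>The exponents of the values at \<open>\<xi> \<tau> + \<eta>\<close> are affine functions of \<open>\<xi>\<close> up to a common
  quadratic term. Away from finitely many hyperplanes their minimum is attained only once, so no
  cancellation is possible, whatever \<open>\<eta>\<close> is.\<close>

proposition (in orthogonal_frame) generic_nonvanishing:
  fixes \<psi> :: "complex \<Rightarrow> complex ^ 'n \<Rightarrow> complex"
  assumes coeffs: "has_jacobi_coeffs L m \<psi> D f"
    and L: "\<And>j. j \<in> {1..CARD('n)} \<Longrightarrow> v j \<in> L"
    and p0: "p0 \<in> q_exponents D \<times> dual_lattice L" "f (fst p0) (snd p0) \<noteq> 0"
    and \<Lambda>: "\<Lambda> \<ge> 0"
  obtains Z where "finite Z" "\<And>w c. (w, c) \<in> Z \<Longrightarrow> w \<noteq> 0"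
    "\<And>\<xi> \<eta>. norm \<xi> \<le> \<Lambda> \<Longrightarrow> (\<And>w c. (w, c) \<in> Z \<Longrightarrow> w \<bullet> \<xi> \<noteq> c) \<Longrightarrow>
       \<exists>\<tau>. Im \<tau> > 0 \<and> torval m \<psi> \<tau> \<xi> \<eta> \<noteq> 0"
proof -
  define T where "T = {p \<in> q_exponents D \<times> dual_lattice L. f (fst p) (snd p) \<noteq> 0}"
  have D: "D > 0" using coeffs by (simp add: has_jacobi_coeffs_def)
  have T: "snd p \<bullet> snd p \<le> 2 * of_rat (fst p) * real m" "of_rat (fst p) \<ge> (0::real)" if "p \<in> T" for p
  proof -
    have p: "fst p \<in> q_exponents D" "snd p \<in> dual_lattice L" "f (fst p) (snd p) \<noteq> 0"
      using that by (auto simp: T_def)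
    then show "snd p \<bullet> snd p \<le> 2 * of_rat (fst p) * real m"
      using coeffs unfolding has_jacobi_coeffs_def by blast
    show "of_rat (fst p) \<ge> (0::real)" using p by (simp add: q_exponents_def)
  qed
  \<comment> \<open>\<open>B\<close> bounds the exponent of p0 for all \<xi> of norm at most
    \<Lambda>. A term whose exponent is at most B + 1 has sqrt r \<le> S, so only the finite set
    \<open>T1\<close> can compete for the minimum.\<close>
  define B where "B = of_rat (fst p0) + norm (snd p0) * \<Lambda> + real m * \<Lambda>\<^sup>2 / 2"
  define S where "S = sqrt (B + 1) + sqrt (real m / 2) * \<Lambda>"
  define T1 where "T1 = {p \<in> T. of_rat (fst p) \<le> S\<^sup>2}"
  have p0T: "p0 \<in> T" using p0 by (simp add: T_def)
  have B0: "B \<ge> 0" unfolding B_def using T(2)[OF p0T] \<Lambda> by simp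
  have finT1: "finite T1"
  proof (rule finite_subset)
    show "T1 \<subseteq> {r \<in> q_exponents D. real_of_rat r \<le> S\<^sup>2} \<times> {l \<in> dual_lattice L. l \<bullet> l \<le> 2 * S\<^sup>2 * real m}"
    proof
      fix p assume p: "p \<in> T1"
      then have "snd p \<bullet> snd p \<le> 2 * of_rat (fst p) * real m" using T by (simp add: T1_def)
      also have "\<dots> \<le> 2 * S\<^sup>2 * real m" using p by (intro mult_right_mono) (auto simp: T1_def)
      finally show "p \<in> {r \<in> q_exponents D. real_of_rat r \<le> S\<^sup>2} \<times> {l \<in> dual_lattice L. l \<bullet> l \<le> 2 * S\<^sup>2 * real m}"
        using p by (auto simp: T1_def T_def mem_Times_iff)
    qed
    show "finite ({r \<in> q_exponents D. real_of_rat r \<le> S\<^sup>2} \<times> {l \<in> dual_lattice L. l \<bullet> l \<le> 2 * S\<^sup>2 * real m})"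
      using finite_q_exponents_le[OF D] finite_dual_ball[OF L] by blast
  qed
  \<comment> \<open>The terms p and p' have equal exponents exactly when \<xi> lies on the
    hyperplane given by this pair. If the dual vectors coincide, then so do the exponents of q, so
    distinct terms always have a nonzero normal vector.\<close>
  define \<Delta> where "\<Delta> = (\<lambda>(p :: rat \<times> (real ^ 'n), p'). (snd p - snd p', real_of_rat (fst p') - of_rat (fst p)))"
  define Z where "Z = {(w, c). w \<noteq> 0 \<and> (w, c) \<in> \<Delta> ` (T1 \<times> T1)}"
  show ?thesis
  proof (rule that)
    show "finite Z"
      by (rule finite_subset[of _ "\<Delta> ` (T1 \<times> T1)"]) (use finT1 in \<open>auto simp: Z_def\<close>)
    show "w \<noteq> 0" if "(w, c) \<in> Z" for w c using that by (simp add: Z_def)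
    fix \<xi> \<eta> :: "real ^ 'n"
    assume \<xi>: "norm \<xi> \<le> \<Lambda>" and Z: "\<And>w c. (w, c) \<in> Z \<Longrightarrow> w \<bullet> \<xi> \<noteq> c"
    define E where "E = index_exp m \<xi>"
    have E_p0: "E p0 \<le> B"
    proof -
      have "snd p0 \<bullet> \<xi> \<le> norm (snd p0) * norm \<xi>" by (rule norm_cauchy_schwarz)
      also have "\<dots> \<le> norm (snd p0) * \<Lambda>" using \<xi> by (intro mult_left_mono) auto
      finally have "snd p0 \<bullet> \<xi> \<le> norm (snd p0) * \<Lambda>" .
      moreover have "\<xi> \<bullet> \<xi> \<le> \<Lambda>\<^sup>2" using \<xi> by (simp add: power_mono flip: power2_norm_eq_inner)
      then have "real m * (\<xi> \<bullet> \<xi>) / 2 \<le> real m * \<Lambda>\<^sup>2 / 2"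
        by (intro divide_right_mono mult_left_mono) auto
      ultimately show ?thesis by (simp add: E_def index_exp_def B_def case_prod_unfold)
    qed
    have inT1: "p \<in> T1" if p: "p \<in> T" "E p \<le> B + 1" for p
    proof -
      define s where "s = sqrt (real m / 2) * norm \<xi>"
      have "(sqrt (of_rat (fst p)) - s)\<^sup>2 \<le> E p"
        using index_exp_ge[OF T(2)[OF p(1)] T(1)[OF p(1)]] by (simp add: E_def s_def)
      then have "sqrt (of_rat (fst p)) - s \<le> sqrt (B + 1)"
        using p(2) by (intro real_le_rsqrt) simp
      moreover have "s \<le> sqrt (real m / 2) * \<Lambda>" unfolding s_def using \<xi> by (intro mult_left_mono) auto
      ultimately have "sqrt (of_rat (fst p)) \<le> S" by (simp add: S_def)
      then have "of_rat (fst p) \<le> S\<^sup>2" by (rule sqrt_le_D)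
      then show ?thesis using p by (simp add: T1_def)
    qed
    have neq: "E p \<noteq> E p'" if p: "p \<in> T1" "p' \<in> T1" "p \<noteq> p'" for p p'
    proof
      assume eq: "E p = E p'"
      then have eq': "(snd p - snd p') \<bullet> \<xi> = of_rat (fst p') - of_rat (fst p)"
        by (simp add: E_def index_exp_def inner_diff_left case_prod_unfold)
      show False
      proof (cases "snd p = snd p'")
        case True
        then have "real_of_rat (fst p) = of_rat (fst p')" using eq' by simp
        then show False using True p(3) by (simp add: prod_eq_iff)
      next
        case False
        then have "(snd p - snd p', of_rat (fst p') - of_rat (fst p)) \<in> Z"
          using p by (force simp: Z_def \<Delta>_def)
        then show False using Z eq' by blast
      qed
    qed
    have p0T1: "p0 \<in> T1" using inT1[OF p0T] E_p0 by simp
    define p1 where "p1 = arg_min_on E T1"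
    have p1: "p1 \<in> T1" "\<And>p. p \<in> T1 \<Longrightarrow> E p1 \<le> E p"
      unfolding p1_def using finT1 p0T1 arg_min_if_finite[of T1 E] arg_min_least[of T1 _ E] by auto
    \<comment> \<open>The cap 1 accounts for the terms outside \<open>T1\<close>: their exponents
      exceed B + 1, while the minimum is at most B.\<close>
    define \<delta> where "\<delta> = Min (insert 1 ((\<lambda>p. E p - E p1) ` (T1 - {p1})))"
    have pos: "E p - E p1 > 0" if "p \<in> T1 - {p1}" for p
      using p1(2)[of p] neq[of p p1] p1(1) that by simp
    have \<delta>: "\<delta> > 0" "\<delta> \<le> 1" "\<And>p. p \<in> T1 \<Longrightarrow> p \<noteq> p1 \<Longrightarrow> \<delta> \<le> E p - E p1"
    proof -
      show "\<delta> > 0" unfolding \<delta>_def using finT1 pos by (subst Min_gr_iff) auto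
    qed (use finT1 in \<open>auto simp: \<delta>_def intro!: Min_le\<close>)
    define c where "c p = f (fst p) (snd p) * exp (2 * of_real pi * \<i> * of_real (snd p \<bullet> \<eta>))" for p
    have hs: "((\<lambda>p. c p * qexp (E p) \<tau>) has_sum torval m \<psi> \<tau> \<xi> \<eta>)
        (q_exponents D \<times> dual_lattice L)" if "Im \<tau> > 0" for \<tau>
      unfolding c_def E_def using coeffs that by (intro torval_expansion) (simp add: has_jacobi_coeffs_def)
    show "\<exists>\<tau>. Im \<tau> > 0 \<and> torval m \<psi> \<tau> \<xi> \<eta> \<noteq> 0"
    proof (rule qexp_series_nonzero[where f = c and E = E and ?i0.0 = p1 and \<delta> = \<delta>, OF hs])
      show "p1 \<in> q_exponents D \<times> dual_lattice L" "c p1 \<noteq> 0"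
        using p1(1) by (auto simp: T1_def T_def c_def)
      show "E p1 + \<delta> \<le> E p" if "p \<in> q_exponents D \<times> dual_lattice L" "c p \<noteq> 0" "p \<noteq> p1" for p
      proof (cases "p \<in> T1")
        case True
        then show ?thesis using \<delta>(3)[of p] that by simp
      next
        case False
        have "p \<in> T" using that by (simp add: T_def c_def)
        then have "E p > B + 1" using inT1[of p] False by force
        then show ?thesis using p1(2)[OF p0T1] E_p0 \<delta>(2) by simp
      qed
    qed (use \<delta> in auto)
  qed
qed

section \<open>Averages over boxes and cosets of the modular group\<close>

lemma sum_PiE_coordinate:
  fixes g :: "'b \<Rightarrow> real"
  assumes "finite J" "j \<in> J" "\<And>i. i \<in> J \<Longrightarrow> finite (B i)" "card (B j) > 0"
  shows "(\<Sum>a\<in>PiE J B. g (a j)) = (\<Prod>i\<in>J. real (card (B i))) * ((\<Sum>t\<in>B j. g t) / real (card (B j)))"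
proof -
  have "(\<Sum>a\<in>PiE J B. g (a j)) = (\<Sum>a\<in>PiE J B. \<Prod>i\<in>J. if i = j then g (a i) else 1)"
    using assms by (intro sum.cong) (auto simp: prod.delta)
  also have "\<dots> = (\<Prod>i\<in>J. \<Sum>t\<in>B i. if i = j then g t else 1)"
    using assms by (intro prod_sum_PiE[symmetric]) auto
  also have "\<dots> = (\<Sum>t\<in>B j. g t) * (\<Prod>i\<in>J - {j}. real (card (B i)))"
    using assms by (simp add: prod.remove[of J j])
  also have "\<dots> = (\<Prod>i\<in>J. real (card (B i))) * ((\<Sum>t\<in>B j. g t) / real (card (B j)))"
    using assms by (simp add: prod.remove[of J j])
  finally show ?thesis .
qed

lemma symmetric_interval_insert:
  "{- int (Suc r)..int (Suc r)} = insert (int (Suc r)) (insert (- int (Suc r)) {- int r..int r})"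
  by auto

lemma sum_abs_symmetric_interval:
  "(\<Sum>t\<in>{- int r..int r}. \<bar>real_of_int t\<bar>) = real r * (real r + 1)"
proof (induction r)
  case (Suc r)
  then show ?case unfolding symmetric_interval_insert
    by (simp add: algebra_simps del: of_nat_Suc) (simp add: algebra_simps)
qed simp

lemma sum_squares_symmetric_interval:
  "(\<Sum>t\<in>{- int r..int r}. (real_of_int t)\<^sup>2) = real r * (real r + 1) * (2 * real r + 1) / 3"
proof (induction r)
  case (Suc r)
  then show ?case unfolding symmetric_interval_insert
    by (simp add: algebra_simps power2_eq_square del: of_nat_Suc) (simp add: algebra_simps power2_eq_square)
qed simp

lemma nat_floor_scaled_limit:
  fixes \<rho> :: real
  assumes "\<rho> \<ge> 0"
  shows "(\<lambda>R. real (nat \<lfloor>\<rho> * (2 * real R + 1)\<rfloor>) / (2 * real R + 1)) \<longlonglongrightarrow> \<rho>"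
proof (rule tendsto_sandwich)
  show "\<forall>\<^sub>F R in sequentially. \<rho> - 1 / (2 * real R + 1) \<le> real (nat \<lfloor>\<rho> * (2 * real R + 1)\<rfloor>) / (2 * real R + 1)"
  proof (intro always_eventually allI)
    fix R :: nat
    have "\<rho> * (2 * real R + 1) - 1 \<le> real (nat \<lfloor>\<rho> * (2 * real R + 1)\<rfloor>)"
      using assms by (simp add: of_nat_nat)
    then have "(\<rho> * (2 * real R + 1) - 1) / (2 * real R + 1) \<le> real (nat \<lfloor>\<rho> * (2 * real R + 1)\<rfloor>) / (2 * real R + 1)"
      by (rule divide_right_mono) simp
    moreover have "2 * real R + 1 \<noteq> 0" using of_nat_0_le_iff[of R, where 'a = real] by linarith
    then have "(\<rho> * (2 * real R + 1) - 1) / (2 * real R + 1) = \<rho> - 1 / (2 * real R + 1)"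
      unfolding diff_divide_distrib by simp
    ultimately show "\<rho> - 1 / (2 * real R + 1) \<le> real (nat \<lfloor>\<rho> * (2 * real R + 1)\<rfloor>) / (2 * real R + 1)"
      by simp
  qed
  show "\<forall>\<^sub>F R in sequentially. real (nat \<lfloor>\<rho> * (2 * real R + 1)\<rfloor>) / (2 * real R + 1) \<le> \<rho>"
    using assms by (intro always_eventually allI) (simp add: pos_divide_le_eq of_nat_nat)
  show "(\<lambda>R. \<rho> - 1 / (2 * real R + 1)) \<longlonglongrightarrow> \<rho>" by real_asymp
qed simp

text \<open>The sums of |t| and t^2 over a symmetric interval are explicit, so the limit is that of
  an elementary expression in r j / h and 1 / h, with no theory of integration. The error K *
  h^(n-1) disappears after division by h^n.\<close>

lemma box_average_limit:
  fixes \<rho> D :: "nat \<Rightarrow> real" and x c K :: real and n :: nat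
  defines "h \<equiv> \<lambda>R. 2 * real R + 1" and "r \<equiv> \<lambda>j R. nat \<lfloor>\<rho> j * (2 * real R + 1)\<rfloor>"
  assumes \<rho>: "\<And>j. j \<in> {1..n} \<Longrightarrow> \<rho> j > 0" and n: "n > 0"
    and le: "\<And>R :: nat. (\<Sum>a\<in>PiE {1..n} (\<lambda>j. {- int (r j R)..int (r j R)}).
        x\<^sup>2 - 2 * x * (\<Sum>j=1..n. sqrt (D j) * (\<bar>real_of_int (a j)\<bar> / h R)) +
          (\<Sum>j=1..n. D j * (real_of_int (a j) / h R)\<^sup>2)) \<le> c * h R ^ n + K * h R ^ (n - 1)"
  shows "(\<Prod>j=1..n. 2 * \<rho> j) *
          (x\<^sup>2 - x * (\<Sum>j=1..n. sqrt (D j) * \<rho> j) + (\<Sum>j=1..n. D j * (\<rho> j)\<^sup>2) / 3) \<le> c"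
proof -
  define y where "y j R = real (r j R) / h R" for j R
  define \<epsilon> where "\<epsilon> R = 1 / h R" for R
  have h: "h R > 0" for R by (simp add: h_def)
  have \<epsilon>: "\<epsilon> \<longlonglongrightarrow> 0" unfolding \<epsilon>_def h_def by real_asymp
  have y: "y j \<longlonglongrightarrow> \<rho> j" if "j \<in> {1..n}" for j
    unfolding y_def r_def h_def using \<rho>[OF that] by (intro nat_floor_scaled_limit) simp
  \<comment> \<open>The sum on the left of \<open>le\<close> divided by h^n, rewritten in y j = r j
    / h and \<epsilon> = 1 / h.\<close>
  define F where "F R = (\<Prod>j=1..n. 2 * y j R + \<epsilon> R) *
     (x\<^sup>2 - 2 * x * (\<Sum>j=1..n. sqrt (D j) * (y j R * (y j R + \<epsilon> R) / (2 * y j R + \<epsilon> R))) +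
       (\<Sum>j=1..n. D j * (y j R * (y j R + \<epsilon> R) / 3)))" for R
  have F_le: "F R \<le> c + K * \<epsilon> R" for R
  proof -
    define B where "B j = {- int (r j R)..int (r j R)}" for j
    have Beq: "B = (\<lambda>j. {- int (r j R)..int (r j R)})" by (rule ext) (simp add: B_def)
    define P where "P = (\<Prod>j=1..n. real (card (B j)))"
    have card: "real (card (B j)) = 2 * real (r j R) + 1" for j by (simp add: B_def)
    have one: "(\<Sum>a\<in>PiE {1..n} B. g (a j)) = P * ((\<Sum>t\<in>B j. g t) / (2 * real (r j R) + 1))"
      if "j \<in> {1..n}" for j and g :: "int \<Rightarrow> real"
      unfolding P_def card[symmetric] using that by (intro sum_PiE_coordinate) (auto simp: B_def)
    have cardP: "real (card (PiE {1..n} B)) = P" by (simp add: card_PiE P_def)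
    have abs: "(\<Sum>a\<in>PiE {1..n} B. sqrt (D j) * (\<bar>real_of_int (a j)\<bar> / h R)) =
        P * (sqrt (D j) * (y j R * (y j R + \<epsilon> R) / (2 * y j R + \<epsilon> R)))" if "j \<in> {1..n}" for j
    proof -
      have "(\<Sum>a\<in>PiE {1..n} B. sqrt (D j) * (\<bar>real_of_int (a j)\<bar> / h R)) =
          sqrt (D j) / h R * (\<Sum>a\<in>PiE {1..n} B. \<bar>real_of_int (a j)\<bar>)"
        by (simp add: sum_distrib_left)
      also have "\<dots> = sqrt (D j) / h R * (P * (real (r j R) * (real (r j R) + 1) / (2 * real (r j R) + 1)))"
        using one[OF that, of "\<lambda>t. \<bar>real_of_int t\<bar>"] by (simp add: B_def sum_abs_symmetric_interval)
      also have "real (r j R) = y j R * h R" using h[of R] by (simp add: y_def)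
      also have "2 * (y j R * h R) + 1 = (2 * y j R + \<epsilon> R) * h R"
        using h[of R] by (simp add: \<epsilon>_def field_simps)
      also have "y j R * h R + 1 = (y j R + \<epsilon> R) * h R"
        using h[of R] by (simp add: \<epsilon>_def field_simps)
      finally show ?thesis using h[of R] by (simp add: mult_ac)
    qed
    have sq: "(\<Sum>a\<in>PiE {1..n} B. D j * (real_of_int (a j) / h R)\<^sup>2) =
        P * (D j * (y j R * (y j R + \<epsilon> R) / 3))" if "j \<in> {1..n}" for j
    proof -
      have "(\<Sum>a\<in>PiE {1..n} B. D j * (real_of_int (a j) / h R)\<^sup>2) =
          D j / (h R)\<^sup>2 * (\<Sum>a\<in>PiE {1..n} B. (real_of_int (a j))\<^sup>2)"
        by (simp add: sum_distrib_left power_divide)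
      also have "\<dots> = D j / (h R)\<^sup>2 * (P * (real (r j R) * (real (r j R) + 1) / 3))"
      proof -
        have nz: "2 * real (r j R) + 1 \<noteq> 0" using of_nat_0_le_iff[of "r j R", where 'a = real] by linarith
        have "(p * b / 3) / b = p / 3" if "b \<noteq> 0" for p b :: real using that by simp
        note div = this[OF nz]
        have "(\<Sum>t\<in>B j. (real_of_int t)\<^sup>2) = real (r j R) * (real (r j R) + 1) * (2 * real (r j R) + 1) / 3"
          unfolding B_def by (rule sum_squares_symmetric_interval)
        then show ?thesis
          by (simp only: one[OF \<open>j \<in> {1..n}\<close>, of "\<lambda>t. (real_of_int t)\<^sup>2"] div)
      qed
      also have "real (r j R) = y j R * h R" using h[of R] by (simp add: y_def)
      also have "y j R * h R + 1 = (y j R + \<epsilon> R) * h R"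
        using h[of R] by (simp add: \<epsilon>_def field_simps)
      finally show ?thesis using h[of R] by (simp add: power2_eq_square mult_ac)
    qed
    have "(\<Sum>a\<in>PiE {1..n} B. x\<^sup>2 - 2 * x * (\<Sum>j=1..n. sqrt (D j) * (\<bar>real_of_int (a j)\<bar> / h R)) +
          (\<Sum>j=1..n. D j * (real_of_int (a j) / h R)\<^sup>2)) =
        P * x\<^sup>2 - 2 * x * (\<Sum>j=1..n. \<Sum>a\<in>PiE {1..n} B. sqrt (D j) * (\<bar>real_of_int (a j)\<bar> / h R)) +
          (\<Sum>j=1..n. \<Sum>a\<in>PiE {1..n} B. D j * (real_of_int (a j) / h R)\<^sup>2)"
      unfolding sum.distrib sum_subtractf sum_distrib_left[symmetric] sum.swap[of _ "{1..n}" "PiE {1..n} B"]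
      using cardP by simp
    also have "\<dots> = P * (x\<^sup>2 - 2 * x * (\<Sum>j=1..n. sqrt (D j) * (y j R * (y j R + \<epsilon> R) / (2 * y j R + \<epsilon> R))) +
       (\<Sum>j=1..n. D j * (y j R * (y j R + \<epsilon> R) / 3)))" (is "_ = P * ?E")
    proof -
      have 1: "(\<Sum>j=1..n. \<Sum>a\<in>PiE {1..n} B. sqrt (D j) * (\<bar>real_of_int (a j)\<bar> / h R)) =
          P * (\<Sum>j=1..n. sqrt (D j) * (y j R * (y j R + \<epsilon> R) / (2 * y j R + \<epsilon> R)))"
        unfolding sum_distrib_left by (intro sum.cong refl abs)
      have 2: "(\<Sum>j=1..n. \<Sum>a\<in>PiE {1..n} B. D j * (real_of_int (a j) / h R)\<^sup>2) =
          P * (\<Sum>j=1..n. D j * (y j R * (y j R + \<epsilon> R) / 3))"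
        unfolding sum_distrib_left by (intro sum.cong refl sq)
      show ?thesis unfolding 1 2 by (simp only: algebra_simps)
    qed
    finally have le': "P * ?E \<le> c * h R ^ n + K * h R ^ (n - 1)" 
      using le[of R] unfolding Beq[symmetric] by (simp only:)
    have P: "P = (\<Prod>j=1..n. 2 * y j R + \<epsilon> R) * h R ^ n"
    proof -
      have "P = (\<Prod>j=1..n. (2 * y j R + \<epsilon> R) * h R)"
        unfolding P_def card using h[of R] by (intro prod.cong) (auto simp: y_def \<epsilon>_def field_simps)
      then show ?thesis by (simp add: prod.distrib)
    qed
    have K: "K * h R ^ (n - 1) = (K * \<epsilon> R) * h R ^ n"
      using n h[of R] by (cases n) (auto simp: \<epsilon>_def)
    have "F R * h R ^ n = P * ?E" unfolding F_def P by (simp only: mult_ac)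
    with le' have "F R * h R ^ n \<le> (c + K * \<epsilon> R) * h R ^ n"
      by (simp only: K distrib_right)
    then show ?thesis using h[of R] by simp
  qed
  have "F \<longlonglongrightarrow> (\<Prod>j=1..n. 2 * \<rho> j + 0) *
     (x\<^sup>2 - 2 * x * (\<Sum>j=1..n. sqrt (D j) * (\<rho> j * (\<rho> j + 0) / (2 * \<rho> j + 0))) +
       (\<Sum>j=1..n. D j * (\<rho> j * (\<rho> j + 0) / 3)))"
    unfolding F_def using \<rho> by (intro tendsto_intros y \<epsilon>) (auto simp: less_imp_neq[symmetric])
  moreover have "(\<lambda>R. c + K * \<epsilon> R) \<longlonglongrightarrow> c + K * 0" by (intro tendsto_intros \<epsilon>)
  ultimately have "(\<Prod>j=1..n. 2 * \<rho> j + 0) *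
     (x\<^sup>2 - 2 * x * (\<Sum>j=1..n. sqrt (D j) * (\<rho> j * (\<rho> j + 0) / (2 * \<rho> j + 0))) +
       (\<Sum>j=1..n. D j * (\<rho> j * (\<rho> j + 0) / 3))) \<le> c + K * 0"
    by (rule LIMSEQ_le) (use F_le in blast)
  also have "(\<Sum>j=1..n. sqrt (D j) * (\<rho> j * (\<rho> j + 0) / (2 * \<rho> j + 0))) = (\<Sum>j=1..n. sqrt (D j) * \<rho> j) / 2"
    unfolding sum_divide_distrib using \<rho> by (intro sum.cong) (auto simp: field_simps less_imp_neq[symmetric])
  also have "(\<Sum>j=1..n. D j * (\<rho> j * (\<rho> j + 0) / 3)) = (\<Sum>j=1..n. D j * (\<rho> j)\<^sup>2) / 3"
    by (simp add: sum_divide_distrib power2_eq_square)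
  finally show ?thesis by simp
qed

section \<open>Finite index of congruence subgroups\<close>

lemma det_mult_int_2: "det (A ** B) = det A * det B" for A B :: "int ^ 2 ^ 2"
  by (simp add: det_2 matrix_mult_2 algebra_simps)

lemma group_SL2Z: "group SL2Z"
proof (rule groupI)
  fix A assume A: "A \<in> carrier SL2Z"
  define B :: "int ^ 2 ^ 2" where
    "B = vector [vector [A $ 2 $ 2, - (A $ 1 $ 2)], vector [- (A $ 2 $ 1), A $ 1 $ 1]]"
  have "B ** A = mat 1"
    using A by (simp add: SL2Z_def det_2 vec_eq_iff forall_2 matrix_mult_2 B_def vector_2 mat_def algebra_simps)
  moreover have "det B = 1" using A by (simp add: SL2Z_def B_def det_2 vector_2 algebra_simps)
  ultimately show "\<exists>B\<in>carrier SL2Z. B \<otimes>\<^bsub>SL2Z\<^esub> A = \<one>\<^bsub>SL2Z\<^esub>"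
    by (intro bexI[of _ B]) (auto simp: SL2Z_def)
qed (auto simp: SL2Z_def det_mult_int_2 matrix_mul_assoc)

text \<open>Matrices with equal residues modulo M differ by a factor congruent to 1, hence lie in
  the same coset, and there are finitely many residues. Since the index is a \<open>card\<close>,
  finiteness is what keeps it from being 0.\<close>

lemma finite_rcosets_SL2Z:
  assumes "congruence_subgroup \<Gamma>"
  shows "finite (rcosets\<^bsub>SL2Z\<^esub> \<Gamma>)"
proof -
  interpret group SL2Z by (rule group_SL2Z)
  obtain M where sub: "subgroup \<Gamma> SL2Z" and M: "M > 0" "principal_congruence_subgroup M \<subseteq> \<Gamma>"
    using assms by (auto simp: congruence_subgroup_def)
  define q where "q A = (A $ 1 $ 1 mod int M, A $ 1 $ 2 mod int M, A $ 2 $ 1 mod int M, A $ 2 $ 2 mod int M)"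
    for A :: "int ^ 2 ^ 2"
  have "q ` carrier SL2Z \<subseteq> {0..<int M} \<times> {0..<int M} \<times> {0..<int M} \<times> {0..<int M}"
    using M(1) by (auto simp: q_def)
  then have fin: "finite (q ` carrier SL2Z)" by (rule finite_subset) auto
  have eq: "\<Gamma> #>\<^bsub>SL2Z\<^esub> A = \<Gamma> #>\<^bsub>SL2Z\<^esub> B"
    if A: "A \<in> carrier SL2Z" and B: "B \<in> carrier SL2Z" and q: "q A = q B" for A B
  proof -
    define B' :: "int ^ 2 ^ 2" where
      "B' = vector [vector [B $ 2 $ 2, - (B $ 1 $ 2)], vector [- (B $ 2 $ 1), B $ 1 $ 1]]"
    have B': "B' ** B = mat 1"
      using B by (simp add: SL2Z_def det_2 vec_eq_iff forall_2 matrix_mult_2 B'_def vector_2 mat_def algebra_simps)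
    have B'car: "B' \<in> carrier SL2Z" using B by (simp add: SL2Z_def B'_def det_2 vector_2 algebra_simps)
    have c: "[A $ i $ j = B $ i $ j] (mod int M)" for i j
      using q exhaust_2[of i] exhaust_2[of j] by (auto simp: q_def cong_def)
    have detB: "B $ 1 $ 1 * B $ 2 $ 2 - B $ 1 $ 2 * B $ 2 $ 1 = 1" using B by (simp add: SL2Z_def det_2)
    have "[(A ** B') $ i $ j = mat 1 $ i $ j] (mod int M)" for i j
    proof -
      have "[A $ i $ 1 * B' $ 1 $ j + A $ i $ 2 * B' $ 2 $ j = B $ i $ 1 * B' $ 1 $ j + B $ i $ 2 * B' $ 2 $ j] (mod int M)"
        by (intro cong_add cong_mult c cong_refl)
      moreover have "B $ i $ 1 * B' $ 1 $ j + B $ i $ 2 * B' $ 2 $ j = mat 1 $ i $ j"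
        using detB exhaust_2[of i] exhaust_2[of j] by (auto simp: B'_def vector_2 mat_def algebra_simps)
      ultimately show ?thesis by (simp add: matrix_mult_2)
    qed
    moreover have car: "A ** B' \<in> carrier SL2Z" using A B'car by (simp add: SL2Z_def det_mult_int_2)
    ultimately have "A ** B' \<in> \<Gamma>" using M(2) by (auto simp: principal_congruence_subgroup_def)
    then have "(A ** B') ** B \<in> \<Gamma> #>\<^bsub>SL2Z\<^esub> B" by (auto simp: r_coset_def SL2Z_def)
    moreover have "(A ** B') ** B = A" using B' by (metis matrix_mul_assoc matrix_mul_rid)
    ultimately show ?thesis using repr_independence[of A \<Gamma> B] B sub by simp
  qed
  define s where "s t = \<Gamma> #>\<^bsub>SL2Z\<^esub> (SOME A. A \<in> carrier SL2Z \<and> q A = t)" for t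
  have "rcosets\<^bsub>SL2Z\<^esub> \<Gamma> \<subseteq> s ` q ` carrier SL2Z"
  proof
    fix C assume "C \<in> rcosets\<^bsub>SL2Z\<^esub> \<Gamma>"
    then obtain A where A: "A \<in> carrier SL2Z" "C = \<Gamma> #>\<^bsub>SL2Z\<^esub> A" by (auto simp: RCOSETS_def)
    define B where "B = (SOME B. B \<in> carrier SL2Z \<and> q B = q A)"
    have "B \<in> carrier SL2Z \<and> q B = q A"
      unfolding B_def by (rule someI[of _ A]) (use A in auto)
    then have "\<Gamma> #>\<^bsub>SL2Z\<^esub> B = C" using eq[of B A] A by simp
    then have "s (q A) = C" by (simp only: s_def B_def)
    then show "C \<in> s ` q ` carrier SL2Z" using A by blast
  qed
  then show ?thesis using fin by (meson finite_imageI finite_subset)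
qed

section \<open>The action of the modular group on torsion values\<close>

definition mat_T :: "int ^ 2 ^ 2" where "mat_T = vector [vector [1, 1], vector [0, 1]]"
definition mat_S :: "int ^ 2 ^ 2" where "mat_S = vector [vector [0, - 1], vector [1, 0]]"

lemma mat_T_entries [simp]: "mat_T $ 1 $ 1 = 1" "mat_T $ 1 $ 2 = 1" "mat_T $ 2 $ 1 = 0" "mat_T $ 2 $ 2 = 1"
  by (simp_all add: mat_T_def vector_2)

lemma mat_S_entries [simp]: "mat_S $ 1 $ 1 = 0" "mat_S $ 1 $ 2 = - 1" "mat_S $ 2 $ 1 = 1" "mat_S $ 2 $ 2 = 0"
  by (simp_all add: mat_S_def vector_2)

lemma mat_T_SL2Z: "mat_T \<in> carrier SL2Z" by (simp add: SL2Z_def det_2)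
lemma mat_S_SL2Z: "mat_S \<in> carrier SL2Z" by (simp add: SL2Z_def det_2)
lemma mob_T: "mob mat_T \<tau> = \<tau> + 1" by (simp add: mob_def)
lemma mob_S: "mob mat_S \<tau> = - 1 / \<tau>" by (simp add: mob_def)

lemma slash_one: "slash k m \<phi> (mat 1) \<tau> z = \<phi> \<tau> z"
  by (simp add: slash_def mat_def)

lemma carrier_SL2Z: "A \<in> carrier SL2Z \<longleftrightarrow> det A = 1" by (simp add: SL2Z_def)
lemma mult_SL2Z: "A \<otimes>\<^bsub>SL2Z\<^esub> B = A ** B" by (simp add: SL2Z_def)

text \<open>The representative of least absolute value. The odd modulus makes the range closed under
  negation, as the inversion requires.\<close>

definition sym_residue :: "nat \<Rightarrow> int \<Rightarrow> int" where
  "sym_residue R x = (x + int R) mod (2 * int R + 1) - int R"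

lemma sym_residue_range: "sym_residue R x \<in> {- int R..int R}"
  unfolding sym_residue_def
  using pos_mod_bound[of "2 * int R + 1" "x + int R"] pos_mod_sign[of "2 * int R + 1" "x + int R"]
  by (simp; linarith)

lemma sym_residue_decomp: "x = sym_residue R x + (2 * int R + 1) * ((x + int R) div (2 * int R + 1))"
  unfolding sym_residue_def using mod_mult_div_eq[of "x + int R" "2 * int R + 1"] by linarith

lemma sym_residue_inj_add:
  assumes "sym_residue R (a + b) = sym_residue R (a + b')" "b \<in> {- int R..int R}" "b' \<in> {- int R..int R}"
  shows "b = b'"
proof -
  let ?h = "2 * int R + 1"
  have "(a + b + int R) mod ?h = (a + b' + int R) mod ?h" using assms(1) by (simp add: sym_residue_def)
  then have "?h dvd (a + b + int R) - (a + b' + int R)" by (simp add: mod_eq_dvd_iff)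
  then have "?h dvd b - b'" by simp
  moreover have "\<bar>b - b'\<bar> < ?h" using assms(2,3) by auto
  ultimately show ?thesis using zdvd_imp_le[of ?h "\<bar>b - b'\<bar>"] by (cases "b = b'") auto
qed

locale jacobi_frame = orthogonal_frame v d
  for v :: "nat \<Rightarrow> real ^ 'n" and d :: "nat \<Rightarrow> nat" +
  fixes L :: "(real ^ 'n) set" and \<Gamma> :: "(int ^ 2 ^ 2) set" and ch :: "int ^ 2 ^ 2 \<Rightarrow> complex"
    and k m :: nat and \<phi> :: "complex \<Rightarrow> complex ^ 'n \<Rightarrow> complex"
  assumes congruence: "congruence_subgroup \<Gamma>"
    and character: "finite_order_character \<Gamma> ch"
    and combination_in_L: "(\<Sum>j=1..CARD('n). real_of_int (a j) *\<^sub>R v j) \<in> L"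
    and jacobi: "\<phi> \<in> jacobi_forms (int k) L m \<Gamma> ch"
begin

sublocale SL2Z: group SL2Z by (rule group_SL2Z)

lemma subgroup_Gamma: "subgroup \<Gamma> SL2Z"
  using congruence by (simp add: congruence_subgroup_def)

lemma Gamma_SL2Z: "g \<in> \<Gamma> \<Longrightarrow> g \<in> carrier SL2Z"
  using subgroup.subset[OF subgroup_Gamma] by blast

lemma norm_character:
  assumes "g \<in> \<Gamma>"
  shows "norm (ch g) = 1"
proof -
  obtain r where r: "r > 0" "ch g ^ r = 1"
    using character assms by (auto simp: finite_order_character_def)
  then have "norm (ch g) ^ r = 1 ^ r" by (simp flip: norm_power)
  then show ?thesis by (rule power_eq_imp_eq_base) (use r in auto)
qed

definition comb :: "(nat \<Rightarrow> real) \<Rightarrow> real ^ 'n" where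
  "comb c = (\<Sum>j=1..CARD('n). c j *\<^sub>R v j)"

lemma comb_int: "comb (\<lambda>j. real_of_int (a j)) \<in> L"
  using combination_in_L by (simp add: comb_def)

lemma comb_add: "comb (\<lambda>j. a j + b j) = comb a + comb b"
  by (simp add: comb_def scaleR_add_left sum.distrib)

lemma comb_scale: "comb (\<lambda>j. c * a j) = c *\<^sub>R comb a"
  by (simp add: comb_def scaleR_sum_right)

lemma comb_cong: "(\<And>j. j \<in> {1..CARD('n)} \<Longrightarrow> a j = b j) \<Longrightarrow> comb a = comb b"
  by (simp add: comb_def)

text \<open>Normalising by the imaginary part absorbs the automorphy factor, so these values obey a
  plain composition law in A and depend only on the coset of A; any choice of representatives
  serves.\<close>

definition modval :: "int ^ 2 ^ 2 \<Rightarrow> complex \<Rightarrow> real ^ 'n \<Rightarrow> real ^ 'n \<Rightarrow> real" where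
  "modval A \<tau> \<xi> \<eta> = norm (torval m \<phi> (mob A \<tau>)
      (real_of_int (A $ 2 $ 2) *\<^sub>R \<xi> - real_of_int (A $ 2 $ 1) *\<^sub>R \<eta>)
      (real_of_int (A $ 1 $ 1) *\<^sub>R \<eta> - real_of_int (A $ 1 $ 2) *\<^sub>R \<xi>)) * Im (mob A \<tau>) powr (real k / 2)"

text \<open>Has the absolute value of the torsion value of the slashed form. In this shape
  holomorphy is inherited from \<phi> by composition with the Moebius map.\<close>

definition holval :: "int ^ 2 ^ 2 \<Rightarrow> real ^ 'n \<Rightarrow> real ^ 'n \<Rightarrow> complex \<Rightarrow> complex" where
  "holval A \<xi> \<eta> \<tau> = jfac A \<tau> powi (- int k) * torval m \<phi> (mob A \<tau>)
      (real_of_int (A $ 2 $ 2) *\<^sub>R \<xi> - real_of_int (A $ 2 $ 1) *\<^sub>R \<eta>)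
      (real_of_int (A $ 1 $ 1) *\<^sub>R \<eta> - real_of_int (A $ 1 $ 2) *\<^sub>R \<xi>)"

lemma norm_holval:
  assumes "A \<in> carrier SL2Z" "Im \<tau> > 0"
  shows "norm (holval A \<xi> \<eta> \<tau>) = norm (torval m (slash (int k) m \<phi> A) \<tau> \<xi> \<eta>)"
  using norm_torval_slash[of A \<tau> m "int k" \<phi> \<xi> \<eta>] assms
  by (simp add: holval_def norm_mult norm_power_int carrier_SL2Z)

lemma modval_eq_holval:
  assumes "A \<in> carrier SL2Z" "Im \<tau> > 0"
  shows "modval A \<tau> \<xi> \<eta> = norm (holval A \<xi> \<eta> \<tau>) * Im \<tau> powr (real k / 2)"
proof -
  have A: "det A = 1" using assms by (simp add: carrier_SL2Z)
  have j: "norm (jfac A \<tau>) > 0" using jfac_nonzero[OF A assms(2)] by simp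
  have "((norm (jfac A \<tau>))\<^sup>2) powr (real k / 2) = norm (jfac A \<tau>) ^ k"
    using j by (simp add: powr_powr powr_realpow flip: powr_numeral)
  then have "Im (mob A \<tau>) powr (real k / 2) = Im \<tau> powr (real k / 2) * norm (jfac A \<tau>) powi (- int k)"
    using assms(2) j by (simp add: Im_mob[OF A assms(2)] powr_divide power_int_minus field_simps)
  then show ?thesis by (simp add: modval_def holval_def norm_mult norm_power_int)
qed

lemma modval_mult:
  assumes "A \<in> carrier SL2Z" "B \<in> carrier SL2Z" "Im \<tau> > 0"
  shows "modval (A ** B) \<tau> \<xi> \<eta> = modval A (mob B \<tau>)
      (real_of_int (B $ 2 $ 2) *\<^sub>R \<xi> - real_of_int (B $ 2 $ 1) *\<^sub>R \<eta>)
      (real_of_int (B $ 1 $ 1) *\<^sub>R \<eta> - real_of_int (B $ 1 $ 2) *\<^sub>R \<xi>)"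
proof -
  have "mob (A ** B) \<tau> = mob A (mob B \<tau>)"
    using assms by (intro mob_mult) (auto simp: carrier_SL2Z)
  then show ?thesis unfolding modval_def by (simp add: matrix_mult_2 algebra_simps)
qed

lemma torval_slash_Gamma:
  assumes "g \<in> \<Gamma>" "Im \<tau> > 0"
  shows "norm (torval m (slash (int k) m \<phi> g) \<tau> \<xi> \<eta>) = norm (torval m \<phi> \<tau> \<xi> \<eta>)"
proof -
  have "slash (int k) m \<phi> g \<tau> z = ch g * \<phi> \<tau> z" for z
    using jacobi assms by (auto simp: jacobi_forms_def)
  then show ?thesis using norm_character[OF assms(1)] by (simp add: torval_def norm_mult)
qed

lemma modval_Gamma:
  assumes "g \<in> \<Gamma>" "A \<in> carrier SL2Z" "Im \<tau> > 0"
  shows "modval (g ** A) \<tau> \<xi> \<eta> = modval A \<tau> \<xi> \<eta>"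
proof -
  have g: "g \<in> carrier SL2Z" using Gamma_SL2Z assms by blast
  have im: "Im (mob A \<tau>) > 0" using assms by (intro Im_mob_pos) (auto simp: carrier_SL2Z)
  show ?thesis
    unfolding modval_mult[OF g assms(2,3)] modval_eq_holval[OF g im] norm_holval[OF g im]
      torval_slash_Gamma[OF assms(1) im] by (simp only: modval_def)
qed

lemma modval_translate:
  assumes "A \<in> carrier SL2Z" "Im \<tau> > 0"
  shows "modval A \<tau> (\<xi> + comb (\<lambda>j. real_of_int (a j))) (\<eta> + comb (\<lambda>j. real_of_int (b j))) = modval A \<tau> \<xi> \<eta>"
proof -
  define X where "X = (\<lambda>x y a b. real_of_int x *\<^sub>R comb (\<lambda>j. real_of_int (a j)) - real_of_int y *\<^sub>R comb (\<lambda>j. real_of_int (b j)))"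
  have X: "X x y a b \<in> L" for x y a b
  proof -
    have "X x y a b = comb (\<lambda>j. real_of_int (x * a j + (- y) * b j))"
      by (simp only: X_def comb_scale comb_add of_int_add of_int_mult) simp
    then show ?thesis by (simp only: comb_int)
  qed
  have im: "Im (mob A \<tau>) > 0" using assms by (intro Im_mob_pos) (auto simp: carrier_SL2Z)
  have "norm (torval m \<phi> (mob A \<tau>) (\<xi>' + X x y a b) (\<eta>' + X x' y' a' b')) =
      norm (torval m \<phi> (mob A \<tau>) \<xi>' \<eta>')" for \<xi>' \<eta>' x y a b x' y' a' b'
    using jacobi im X by (intro norm_torval_translate[OF _ refl]) (auto simp: jacobi_forms_def)
  from this[of "real_of_int (A $ 2 $ 2) *\<^sub>R \<xi> - real_of_int (A $ 2 $ 1) *\<^sub>R \<eta>" "A $ 2 $ 2" "A $ 2 $ 1" a b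
      "real_of_int (A $ 1 $ 1) *\<^sub>R \<eta> - real_of_int (A $ 1 $ 2) *\<^sub>R \<xi>" "A $ 1 $ 1" "A $ 1 $ 2" b a]
  show ?thesis by (simp add: modval_def X_def algebra_simps)
qed

lemma holval_holomorphic:
  assumes "A \<in> carrier SL2Z"
  shows "holval A \<xi> \<eta> holomorphic_on upper_half"
proof -
  have A: "det A = 1" using assms by (simp add: carrier_SL2Z)
  have nz: "of_int (A $ 2 $ 1) * \<tau> + of_int (A $ 2 $ 2) \<noteq> 0" if "\<tau> \<in> upper_half" for \<tau>
    using jfac_nonzero[OF A, of \<tau>] that by (simp add: jfac_def upper_half_def)
  have j: "jfac A holomorphic_on upper_half"
    unfolding jfac_def by (intro holomorphic_intros)
  have mob: "mob A holomorphic_on upper_half"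
    unfolding mob_def using nz by (intro holomorphic_intros) auto
  have img: "mob A ` upper_half \<subseteq> upper_half"
    using Im_mob_pos[OF A] by (auto simp: upper_half_def)
  have t: "(\<lambda>\<tau>. torval m \<phi> \<tau> \<xi>' \<eta>') holomorphic_on upper_half" for \<xi>' \<eta>'
    using jacobi by (intro torval_holomorphic) (simp add: jacobi_forms_def)
  show ?thesis unfolding holval_def
    using jfac_nonzero[OF A] holomorphic_on_compose_gen[OF mob t img]
    by (intro holomorphic_intros j) (auto simp: upper_half_def comp_def)
qed

lemma finite_cosets: "finite (rcosets\<^bsub>SL2Z\<^esub> \<Gamma>)"
  by (rule finite_rcosets_SL2Z) (rule congruence)

definition rep :: "(int ^ 2 ^ 2) set \<Rightarrow> int ^ 2 ^ 2" where "rep C = (SOME A. A \<in> C)"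

lemma rep:
  assumes "A \<in> carrier SL2Z"
  shows "rep (\<Gamma> #>\<^bsub>SL2Z\<^esub> A) \<in> carrier SL2Z"
    and "Im \<tau> > 0 \<Longrightarrow> modval (rep (\<Gamma> #>\<^bsub>SL2Z\<^esub> A)) \<tau> \<xi> \<eta> = modval A \<tau> \<xi> \<eta>"
proof -
  have "A \<in> \<Gamma> #>\<^bsub>SL2Z\<^esub> A" using SL2Z.rcos_self[OF assms subgroup_Gamma] .
  then have "rep (\<Gamma> #>\<^bsub>SL2Z\<^esub> A) \<in> \<Gamma> #>\<^bsub>SL2Z\<^esub> A" unfolding rep_def by (rule someI)
  then obtain g where g: "g \<in> \<Gamma>" "rep (\<Gamma> #>\<^bsub>SL2Z\<^esub> A) = g ** A"
    by (auto simp: r_coset_def mult_SL2Z)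
  then show "rep (\<Gamma> #>\<^bsub>SL2Z\<^esub> A) \<in> carrier SL2Z"
    using SL2Z.m_closed[OF Gamma_SL2Z assms] by (metis mult_SL2Z)
  show "modval (rep (\<Gamma> #>\<^bsub>SL2Z\<^esub> A)) \<tau> \<xi> \<eta> = modval A \<tau> \<xi> \<eta>" if "Im \<tau> > 0"
    using modval_Gamma[OF g(1) assms that] g(2) by simp
qed

lemma cosetE:
  assumes "C \<in> rcosets\<^bsub>SL2Z\<^esub> \<Gamma>"
  obtains A where "A \<in> carrier SL2Z" "C = \<Gamma> #>\<^bsub>SL2Z\<^esub> A"
  using assms by (auto simp: RCOSETS_def)

lemma rep_in: "C \<in> rcosets\<^bsub>SL2Z\<^esub> \<Gamma> \<Longrightarrow> rep C \<in> carrier SL2Z"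
  using rep(1) by (auto elim!: cosetE)

lemma coset_mult:
  assumes "C \<in> rcosets\<^bsub>SL2Z\<^esub> \<Gamma>" "B \<in> carrier SL2Z"
  shows "C #>\<^bsub>SL2Z\<^esub> B \<in> rcosets\<^bsub>SL2Z\<^esub> \<Gamma>"
    and "Im \<tau> > 0 \<Longrightarrow> modval (rep (C #>\<^bsub>SL2Z\<^esub> B)) \<tau> \<xi> \<eta> = modval (rep C) (mob B \<tau>)
      (real_of_int (B $ 2 $ 2) *\<^sub>R \<xi> - real_of_int (B $ 2 $ 1) *\<^sub>R \<eta>)
      (real_of_int (B $ 1 $ 1) *\<^sub>R \<eta> - real_of_int (B $ 1 $ 2) *\<^sub>R \<xi>)"
proof -
  obtain A where A: "A \<in> carrier SL2Z" "C = \<Gamma> #>\<^bsub>SL2Z\<^esub> A" using assms(1) by (rule cosetE)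
  have eq: "C #>\<^bsub>SL2Z\<^esub> B = \<Gamma> #>\<^bsub>SL2Z\<^esub> (A ** B)"
    using SL2Z.coset_mult_assoc[OF subgroup.subset[OF subgroup_Gamma] A(1) assms(2)] A(2)
    by (simp add: mult_SL2Z)
  have AB: "A ** B \<in> carrier SL2Z" using A assms(2) SL2Z.m_closed by (metis mult_SL2Z)
  show "C #>\<^bsub>SL2Z\<^esub> B \<in> rcosets\<^bsub>SL2Z\<^esub> \<Gamma>"
    unfolding eq using SL2Z.rcosetsI[OF subgroup.subset[OF subgroup_Gamma] AB] .
  show "modval (rep (C #>\<^bsub>SL2Z\<^esub> B)) \<tau> \<xi> \<eta> = modval (rep C) (mob B \<tau>)
      (real_of_int (B $ 2 $ 2) *\<^sub>R \<xi> - real_of_int (B $ 2 $ 1) *\<^sub>R \<eta>)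
      (real_of_int (B $ 1 $ 1) *\<^sub>R \<eta> - real_of_int (B $ 1 $ 2) *\<^sub>R \<xi>)" if "Im \<tau> > 0"
  proof -
    have "Im (mob B \<tau>) > 0" using assms(2) that by (intro Im_mob_pos) (auto simp: carrier_SL2Z)
    then show ?thesis
      by (simp only: eq rep(2)[OF AB that] modval_mult[OF A(1) assms(2) that] rep(2)[OF A(1), folded A(2)])
  qed
qed

lemma coset_mult_inj:
  assumes "B \<in> carrier SL2Z"
  shows "inj_on (\<lambda>C. C #>\<^bsub>SL2Z\<^esub> B) (rcosets\<^bsub>SL2Z\<^esub> \<Gamma>)"
proof (rule inj_onI)
  fix C C' assume C: "C \<in> rcosets\<^bsub>SL2Z\<^esub> \<Gamma>" "C' \<in> rcosets\<^bsub>SL2Z\<^esub> \<Gamma>" and eq: "C #>\<^bsub>SL2Z\<^esub> B = C' #>\<^bsub>SL2Z\<^esub> B"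
  have sub: "D \<subseteq> carrier SL2Z" if "D \<in> rcosets\<^bsub>SL2Z\<^esub> \<Gamma>" for D
    using that SL2Z.r_coset_subset_G[OF subgroup.subset[OF subgroup_Gamma]] by (auto elim!: cosetE)
  have undo: "D #>\<^bsub>SL2Z\<^esub> B #>\<^bsub>SL2Z\<^esub> inv\<^bsub>SL2Z\<^esub> B = D" if "D \<in> rcosets\<^bsub>SL2Z\<^esub> \<Gamma>" for D
    by (simp only: SL2Z.coset_mult_assoc[OF sub[OF that] assms SL2Z.inv_closed[OF assms]]
      SL2Z.r_inv[OF assms] SL2Z.coset_mult_one[OF sub[OF that]])
  have "C = C #>\<^bsub>SL2Z\<^esub> B #>\<^bsub>SL2Z\<^esub> inv\<^bsub>SL2Z\<^esub> B" by (rule undo[symmetric]) (rule C(1))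
  also have "\<dots> = C' #>\<^bsub>SL2Z\<^esub> B #>\<^bsub>SL2Z\<^esub> inv\<^bsub>SL2Z\<^esub> B" by (subst eq) (rule refl)
  also have "\<dots> = C'" by (rule undo) (rule C(2))
  finally show "C = C'" .
qed

end

section \<open>Counting vanishing orders\<close>

context jacobi_frame
begin

definition torsion :: "nat \<Rightarrow> (nat \<Rightarrow> int) \<Rightarrow> real ^ 'n" where
  "torsion R a = comb (\<lambda>j. real_of_int (a j) / (2 * real R + 1))"

definition grid :: "nat \<Rightarrow> (nat \<Rightarrow> int) set" where
  "grid R = PiE {1..CARD('n)} (\<lambda>_. {- int R..int R})"

lemma finite_grid: "finite (grid R)"
  unfolding grid_def by (intro finite_PiE) auto

lemma card_grid: "real (card (grid R)) = (2 * real R + 1) ^ CARD('n)"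
  unfolding grid_def by (simp add: card_PiE)

lemma grid_range: "a \<in> grid R \<Longrightarrow> j \<in> {1..CARD('n)} \<Longrightarrow> a j \<in> {- int R..int R}"
  unfolding grid_def by (rule PiE_mem)

lemma grid_ext:
  assumes "a \<in> grid R" "b \<in> grid R" "\<And>j. j \<in> {1..CARD('n)} \<Longrightarrow> a j = b j"
  shows "a = b"
  using assms unfolding grid_def by (rule PiE_ext)

lemma restrict_grid: "(\<And>j. j \<in> {1..CARD('n)} \<Longrightarrow> g j \<in> {- int R..int R}) \<Longrightarrow> restrict g {1..CARD('n)} \<in> grid R"
  unfolding grid_def by (rule restrict_PiE_iff[THEN iffD2]) blast

lemma torsion_add_residue:
  "torsion R a + torsion R b = torsion R (\<lambda>j\<in>{1..CARD('n)}. sym_residue R (a j + b j)) +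
     comb (\<lambda>j. real_of_int ((a j + b j + int R) div (2 * int R + 1)))"
proof -
  have h: "2 * real R + 1 \<noteq> 0" using of_nat_0_le_iff[of R, where 'a = real] by linarith
  have "real_of_int (a j) / (2 * real R + 1) + real_of_int (b j) / (2 * real R + 1) =
     real_of_int (sym_residue R (a j + b j)) / (2 * real R + 1) +
       real_of_int ((a j + b j + int R) div (2 * int R + 1))" for j
  proof -
    have "real_of_int (a j + b j) = real_of_int (sym_residue R (a j + b j)) +
        (2 * real R + 1) * real_of_int ((a j + b j + int R) div (2 * int R + 1))"
      using arg_cong[OF sym_residue_decomp[of "a j + b j" R], of real_of_int] by simp
    then have "real_of_int (a j + b j) / (2 * real R + 1) =
      real_of_int (sym_residue R (a j + b j)) / (2 * real R + 1) +
       real_of_int ((a j + b j + int R) div (2 * int R + 1))"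
      using h by (simp only: add_divide_distrib) simp
    then show ?thesis by (simp add: add_divide_distrib)
  qed
  then show ?thesis
    unfolding torsion_def comb_add[symmetric] by (intro comb_cong) simp
qed

lemma torsion_uminus: "torsion R (\<lambda>j\<in>{1..CARD('n)}. - a j) = - torsion R a"
proof -
  have "torsion R (\<lambda>j\<in>{1..CARD('n)}. - a j) = comb (\<lambda>j. (- 1) * (real_of_int (a j) / (2 * real R + 1)))"
    unfolding torsion_def by (intro comb_cong) simp
  then show ?thesis unfolding comb_scale torsion_def by simp
qed

text \<open>The representative chosen for \<open>\<Gamma>\<close> may be any of its elements; the
  comparison with the identity matrix goes through \<open>modval\<close>, which does not see the
  choice.\<close>

lemma norm_holval_identity_coset:
  assumes "Im \<tau> > 0"
  shows "norm (holval (rep (\<Gamma> #>\<^bsub>SL2Z\<^esub> mat 1)) \<xi> \<eta> \<tau>) = norm (torval m \<phi> \<tau> \<xi> \<eta>)"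
proof -
  have one: "mat 1 \<in> carrier SL2Z" by (simp add: carrier_SL2Z)
  have "modval (rep (\<Gamma> #>\<^bsub>SL2Z\<^esub> mat 1)) \<tau> \<xi> \<eta> = modval (mat 1) \<tau> \<xi> \<eta>"
    by (rule rep(2)[OF one assms])
  then have "norm (holval (rep (\<Gamma> #>\<^bsub>SL2Z\<^esub> mat 1)) \<xi> \<eta> \<tau>) = norm (holval (mat 1) \<xi> \<eta> \<tau>)"
    using assms by (simp add: modval_eq_holval[OF rep(1)[OF one] assms] modval_eq_holval[OF one assms])
  also have "\<dots> = norm (torval m \<phi> \<tau> \<xi> \<eta>)"
    unfolding norm_holval[OF one assms] torval_def slash_one ..
  finally show ?thesis .
qed

lemma norm_torsion:
  "(sqrt (real m / 2) * norm (torsion R a))\<^sup>2 =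
     (\<Sum>j=1..CARD('n). real (d j) * real m * (real_of_int (a j) / (2 * real R + 1))\<^sup>2)"
  unfolding power_mult_distrib power2_norm_eq_inner torsion_def comb_def inner_combination
  by (simp add: sum_distrib_left power2_eq_square mult_ac)

text \<open>This linearises the cross term of (sqrt N - |\<xi>|)^2, which could not be averaged
  coordinatewise otherwise; the square of |\<xi>| is kept exactly by
  \<open>norm_torsion\<close>.\<close>

lemma norm_torsion_le_sum:
  "sqrt (real m / 2) * norm (torsion R a) \<le>
     (\<Sum>j=1..CARD('n). sqrt (real (d j) * real m) * (\<bar>real_of_int (a j)\<bar> / (2 * real R + 1)))"
proof -
  have "norm (torsion R a) \<le> (\<Sum>j=1..CARD('n). norm ((real_of_int (a j) / (2 * real R + 1)) *\<^sub>R v j))"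
    unfolding torsion_def comb_def by (rule norm_sum)
  also have "\<dots> = (\<Sum>j=1..CARD('n). \<bar>real_of_int (a j)\<bar> / (2 * real R + 1) * sqrt (2 * real (d j)))"
  proof (intro sum.cong refl)
    fix j assume j: "j \<in> {1..CARD('n)}"
    have "norm (v j) = sqrt (2 * real (d j))" using inner_v[OF j j] by (simp add: norm_eq_sqrt_inner)
    then show "norm ((real_of_int (a j) / (2 * real R + 1)) *\<^sub>R v j) =
        \<bar>real_of_int (a j)\<bar> / (2 * real R + 1) * sqrt (2 * real (d j))" by simp
  qed
  finally have "sqrt (real m / 2) * norm (torsion R a) \<le>
      sqrt (real m / 2) * (\<Sum>j=1..CARD('n). \<bar>real_of_int (a j)\<bar> / (2 * real R + 1) * sqrt (2 * real (d j)))"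
    by (intro mult_left_mono) auto
  also have "\<dots> = (\<Sum>j=1..CARD('n). sqrt (real (d j) * real m) * (\<bar>real_of_int (a j)\<bar> / (2 * real R + 1)))"
    unfolding sum_distrib_left
  proof (intro sum.cong refl)
    fix j
    have "sqrt (real (d j) * real m) = sqrt (real m / 2 * (2 * real (d j)))" by (simp add: mult.commute)
    also have "\<dots> = sqrt (real m / 2) * sqrt (2 * real (d j))" by (rule real_sqrt_mult)
    finally show "sqrt (real m / 2) * (\<bar>real_of_int (a j)\<bar> / (2 * real R + 1) * sqrt (2 * real (d j))) =
      sqrt (real (d j) * real m) * (\<bar>real_of_int (a j)\<bar> / (2 * real R + 1))" by (simp only: mult_ac)
  qed
  finally show ?thesis .
qed

text \<open>The bound is independent of R, so one finite set of exceptional hyperplanes serves all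
  grids.\<close>

lemma norm_torsion_bounded:
  assumes "a \<in> grid R"
  shows "norm (torsion R a) \<le> (\<Sum>j=1..CARD('n). norm (v j))"
proof -
  have "norm (torsion R a) \<le> (\<Sum>j=1..CARD('n). norm ((real_of_int (a j) / (2 * real R + 1)) *\<^sub>R v j))"
    unfolding torsion_def comb_def by (rule norm_sum)
  also have "\<dots> \<le> (\<Sum>j=1..CARD('n). norm (v j))"
  proof (intro sum_mono)
    fix j assume "j \<in> {1..CARD('n)}"
    from grid_range[OF assms this] have "\<bar>a j\<bar> \<le> int R" by (simp add: abs_le_iff)
    then have "\<bar>real_of_int (a j)\<bar> \<le> 2 * real R + 1" by linarith
    then have "\<bar>real_of_int (a j)\<bar> / (2 * real R + 1) \<le> 1" by simp
    then have "\<bar>real_of_int (a j)\<bar> / (2 * real R + 1) * norm (v j) \<le> norm (v j)"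
      by (intro mult_left_le_one_le) auto
    then show "norm ((real_of_int (a j) / (2 * real R + 1)) *\<^sub>R v j) \<le> norm (v j)" by simp
  qed
  finally show ?thesis .
qed

lemma v_in_L:
  assumes "j \<in> {1..CARD('n)}"
  shows "v j \<in> L"
proof -
  have "(\<Sum>i=1..CARD('n). real_of_int (if i = j then 1 else 0) *\<^sub>R v i) = (\<Sum>i=1..CARD('n). if i = j then v i else 0)"
    by (intro sum.cong) auto
  then show ?thesis using combination_in_L[of "\<lambda>i. if i = j then 1 else 0"] assms by simp
qed

definition torsion_family :: "nat \<Rightarrow> ((int ^ 2 ^ 2) set \<times> (nat \<Rightarrow> int) \<times> (nat \<Rightarrow> int)) set" where
  "torsion_family R = (rcosets\<^bsub>SL2Z\<^esub> \<Gamma>) \<times> grid R \<times> grid R"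

definition torsion_value :: "nat \<Rightarrow> (int ^ 2 ^ 2) set \<times> (nat \<Rightarrow> int) \<times> (nat \<Rightarrow> int) \<Rightarrow> complex \<Rightarrow> complex" where
  "torsion_value R = (\<lambda>(C, a, b). holval (rep C) (torsion R a) (torsion R b))"

proposition torsion_orders_bound:
  assumes decay: "\<And>x. x \<in> torsion_family R \<Longrightarrow>
      \<exists>C\<ge>0. \<forall>\<tau>. Im \<tau> \<ge> 1/2 \<longrightarrow> norm (torsion_value R x \<tau>) \<le> C * exp (- 2 * pi * \<nu> x * Im \<tau>)"
  shows "(\<Sum>x | x \<in> torsion_family R \<and> (\<exists>\<tau>. Im \<tau> > 0 \<and> torsion_value R x \<tau> \<noteq> 0). \<nu> x) \<le>
     real k * (real (SL2Z_index \<Gamma>) * (2 * real R + 1) ^ CARD('n) * (2 * real R + 1) ^ CARD('n)) * 5 / 54"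
proof -
  let ?J = "{1..CARD('n)}"
  \<comment> \<open>Both maps come from (a, b) times the matrix as row vectors: translation sends
    (a, b) to (a, a + b), reduced to the grid, and inversion sends it to (b, -a).\<close>
  define sT where "sT = (\<lambda>(C, a, b). (C #>\<^bsub>SL2Z\<^esub> mat_T, a, \<lambda>j\<in>?J. sym_residue R (a j + b j)))"
  define sS where "sS = (\<lambda>(C, a :: nat \<Rightarrow> int, b :: nat \<Rightarrow> int). (C #>\<^bsub>SL2Z\<^esub> mat_S, b, \<lambda>j\<in>?J. - a j))"
  have inv: "norm (torsion_value R (C, a, b) \<tau>) * Im \<tau> powr (real k / 2) = modval (rep C) \<tau> (torsion R a) (torsion R b)"
    if "C \<in> rcosets\<^bsub>SL2Z\<^esub> \<Gamma>" "Im \<tau> > 0" for C a b \<tau>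
    using modval_eq_holval[OF rep_in[OF that(1)] that(2)] by (simp add: torsion_value_def)
  have "(\<Sum>x | x \<in> torsion_family R \<and> (\<exists>\<tau>. Im \<tau> > 0 \<and> torsion_value R x \<tau> \<noteq> 0). \<nu> x) \<le>
     real k * real (card (torsion_family R)) * 5 / 54"
  proof (rule sum_vanishing_orders_bound[where \<sigma> = sT and \<rho> = sS])
    show "finite (torsion_family R)" using finite_cosets finite_grid by (simp add: torsion_family_def)
    show "torsion_value R x holomorphic_on upper_half" if x: "x \<in> torsion_family R" for x
      using x rep_in holval_holomorphic by (auto simp: torsion_family_def torsion_value_def)
    show "inj_on sT (torsion_family R)"
    proof (rule inj_onI)
      fix x y assume xy: "x \<in> torsion_family R" "y \<in> torsion_family R" "sT x = sT y"
      obtain C a b C' a' b' where e: "x = (C, a, b)" "y = (C', a', b')" by (metis prod_cases3)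
      have mem: "C \<in> rcosets\<^bsub>SL2Z\<^esub> \<Gamma>" "C' \<in> rcosets\<^bsub>SL2Z\<^esub> \<Gamma>" "b \<in> grid R" "b' \<in> grid R"
        using xy by (auto simp: e torsion_family_def)
      have eq: "C #>\<^bsub>SL2Z\<^esub> mat_T = C' #>\<^bsub>SL2Z\<^esub> mat_T" "a = a'"
        "(\<lambda>j\<in>?J. sym_residue R (a j + b j)) = (\<lambda>j\<in>?J. sym_residue R (a' j + b' j))"
        using xy(3)[unfolded e sT_def prod.case prod.inject] by blast+
      have "C = C'" using inj_onD[OF coset_mult_inj[OF mat_T_SL2Z] eq(1) mem(1,2)] .
      moreover have "b = b'"
      proof (rule grid_ext[OF mem(3,4)])
        fix j assume j: "j \<in> ?J"
        then have "sym_residue R (a j + b j) = sym_residue R (a j + b' j)"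
          using fun_cong[OF eq(3), of j] eq(2) by simp
        then show "b j = b' j"
          by (rule sym_residue_inj_add) (use grid_range mem j in blast)+
      qed
      ultimately show "x = y" using eq(2) by (simp add: e)
    qed
    show "sT ` torsion_family R \<subseteq> torsion_family R"
    proof (rule image_subsetI)
      fix x assume x: "x \<in> torsion_family R"
      obtain C a b where e: "x = (C, a, b)" by (metis prod_cases3)
      have "(\<lambda>j\<in>?J. sym_residue R (a j + b j)) \<in> grid R" by (rule restrict_grid) (rule sym_residue_range)
      then show "sT x \<in> torsion_family R"
        using x coset_mult(1)[OF _ mat_T_SL2Z] by (simp add: e sT_def torsion_family_def)
    qed
    show "norm (torsion_value R x (\<tau> + 1)) * Im (\<tau> + 1) powr (real k / 2) =
        norm (torsion_value R (sT x) \<tau>) * Im \<tau> powr (real k / 2)"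
      if x: "x \<in> torsion_family R" and \<tau>: "Im \<tau> > 0" for x \<tau>
    proof -
      obtain C a b where e: "x = (C, a, b)" by (metis prod_cases3)
      have C: "C \<in> rcosets\<^bsub>SL2Z\<^esub> \<Gamma>" using x by (simp add: e torsion_family_def)
      let ?r = "\<lambda>j\<in>?J. sym_residue R (a j + b j)"
      have CT: "C #>\<^bsub>SL2Z\<^esub> mat_T \<in> rcosets\<^bsub>SL2Z\<^esub> \<Gamma>" by (rule coset_mult(1)[OF C mat_T_SL2Z])
      have "norm (torsion_value R x (\<tau> + 1)) * Im (\<tau> + 1) powr (real k / 2) =
          modval (rep C) (\<tau> + 1) (torsion R a) (torsion R b)"
        using inv[OF C, of "\<tau> + 1" a b] \<tau> by (simp add: e)
      also have "\<dots> = modval (rep (C #>\<^bsub>SL2Z\<^esub> mat_T)) \<tau> (torsion R a) (torsion R a + torsion R b)"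
        using coset_mult(2)[OF C mat_T_SL2Z \<tau>, of "torsion R a" "torsion R a + torsion R b"]
        by (simp add: mob_T)
      also have "\<dots> = modval (rep (C #>\<^bsub>SL2Z\<^esub> mat_T)) \<tau> (torsion R a) (torsion R ?r)"
        using modval_translate[OF rep_in[OF CT] \<tau>, of "torsion R a" "\<lambda>_. 0" "torsion R ?r"
            "\<lambda>j. (a j + b j + int R) div (2 * int R + 1)"]
        unfolding torsion_add_residue by (simp add: comb_def)
      also have "\<dots> = norm (torsion_value R (sT x) \<tau>) * Im \<tau> powr (real k / 2)"
        using inv[OF CT \<tau>, of a ?r] by (simp add: e sT_def)
      finally show ?thesis .
    qed
    show "inj_on sS (torsion_family R)"
    proof (rule inj_onI)
      fix x y assume xy: "x \<in> torsion_family R" "y \<in> torsion_family R" "sS x = sS y"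
      obtain C a b C' a' b' where e: "x = (C, a, b)" "y = (C', a', b')" by (metis prod_cases3)
      have mem: "C \<in> rcosets\<^bsub>SL2Z\<^esub> \<Gamma>" "C' \<in> rcosets\<^bsub>SL2Z\<^esub> \<Gamma>" "a \<in> grid R" "a' \<in> grid R"
        using xy by (auto simp: e torsion_family_def)
      have eq: "C #>\<^bsub>SL2Z\<^esub> mat_S = C' #>\<^bsub>SL2Z\<^esub> mat_S" "b = b'"
        "(\<lambda>j\<in>?J. - a j) = (\<lambda>j\<in>?J. - a' j)"
        using xy(3)[unfolded e sS_def prod.case prod.inject] by blast+
      have "C = C'" using inj_onD[OF coset_mult_inj[OF mat_S_SL2Z] eq(1) mem(1,2)] .
      moreover have "a = a'"
      proof (rule grid_ext[OF mem(3,4)])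
        fix j assume j: "j \<in> ?J"
        then show "a j = a' j" using fun_cong[OF eq(3), of j] by simp
      qed
      ultimately show "x = y" using eq(2) by (simp add: e)
    qed
    show "sS ` torsion_family R \<subseteq> torsion_family R"
    proof (rule image_subsetI)
      fix x assume x: "x \<in> torsion_family R"
      obtain C a b where e: "x = (C, a, b)" by (metis prod_cases3)
      have a: "a \<in> grid R" using x by (simp add: e torsion_family_def)
      have "(\<lambda>j\<in>?J. - a j) \<in> grid R"
      proof (rule restrict_grid)
        fix j assume "j \<in> ?J"
        from grid_range[OF a this] show "- a j \<in> {- int R..int R}" by simp
      qed
      then show "sS x \<in> torsion_family R"
        using x coset_mult(1)[OF _ mat_S_SL2Z] by (simp add: e sS_def torsion_family_def)
    qed
    show "norm (torsion_value R x (- 1 / \<tau>)) * Im (- 1 / \<tau>) powr (real k / 2) =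
        norm (torsion_value R (sS x) \<tau>) * Im \<tau> powr (real k / 2)"
      if x: "x \<in> torsion_family R" and \<tau>: "Im \<tau> > 0" for x \<tau>
    proof -
      obtain C a b where e: "x = (C, a, b)" by (metis prod_cases3)
      have C: "C \<in> rcosets\<^bsub>SL2Z\<^esub> \<Gamma>" using x by (simp add: e torsion_family_def)
      have CS: "C #>\<^bsub>SL2Z\<^esub> mat_S \<in> rcosets\<^bsub>SL2Z\<^esub> \<Gamma>" by (rule coset_mult(1)[OF C mat_S_SL2Z])
      have im: "Im (- 1 / \<tau>) > 0"
        using Im_mob_pos[of mat_S \<tau>] mat_S_SL2Z \<tau> by (simp add: mob_S carrier_SL2Z)
      have "norm (torsion_value R x (- 1 / \<tau>)) * Im (- 1 / \<tau>) powr (real k / 2) =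
          modval (rep C) (- 1 / \<tau>) (torsion R a) (torsion R b)"
        unfolding e by (rule inv[OF C im])
      also have "\<dots> = modval (rep (C #>\<^bsub>SL2Z\<^esub> mat_S)) \<tau> (torsion R b) (- torsion R a)"
        using coset_mult(2)[OF C mat_S_SL2Z \<tau>, of "torsion R b" "- torsion R a"]
        by (simp add: mob_S)
      also have "\<dots> = norm (torsion_value R (sS x) \<tau>) * Im \<tau> powr (real k / 2)"
        unfolding e sS_def prod.case inv[OF CS \<tau>] torsion_uminus ..
      finally show ?thesis .
    qed
  qed (rule decay)
  also have "real (card (torsion_family R)) =
      real (SL2Z_index \<Gamma>) * (2 * real R + 1) ^ CARD('n) * (2 * real R + 1) ^ CARD('n)"
    unfolding torsion_family_def card_cartesian_product of_nat_mult card_grid SL2Z_index_def by simp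
  finally show ?thesis .
qed

text \<open>Only the coset \<open>\<Gamma>\<close> and points of B off the exceptional hyperplanes
  are credited with a positive order. Each a occurs with all h^n choices of b, which cancels one
  factor h^n. The exceptional a number at most \<open>card Z\<close> times h^(n-1) and contribute at
  most N each, so K = \<open>card Z\<close> * N depends neither on R nor on B.\<close>

proposition grid_inequality:
  assumes coeffs: "has_jacobi_coeffs L m \<phi> D f" and N: "N \<ge> 0"
    and f: "\<And>r l. r \<in> q_exponents D \<Longrightarrow> l \<in> dual_lattice L \<Longrightarrow> f r l \<noteq> 0 \<Longrightarrow> of_rat r \<ge> N"
    and p0: "p0 \<in> q_exponents D \<times> dual_lattice L" "f (fst p0) (snd p0) \<noteq> 0"
  obtains K where "\<And>R B. B \<subseteq> grid R \<Longrightarrow>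
      (\<And>a. a \<in> B \<Longrightarrow> sqrt (real m / 2) * norm (torsion R a) \<le> sqrt N) \<Longrightarrow>
      (\<Sum>a\<in>B. (sqrt N - sqrt (real m / 2) * norm (torsion R a))\<^sup>2) \<le>
        real k * real (SL2Z_index \<Gamma>) * 5 / 54 * (2 * real R + 1) ^ CARD('n) + K * (2 * real R + 1) ^ (CARD('n) - 1)"
proof -
  obtain Z where Z: "finite Z" "\<And>w c. (w, c) \<in> Z \<Longrightarrow> w \<noteq> 0"
    "\<And>\<xi> \<eta>. norm \<xi> \<le> (\<Sum>j=1..CARD('n). norm (v j)) \<Longrightarrow> (\<And>w c. (w, c) \<in> Z \<Longrightarrow> w \<bullet> \<xi> \<noteq> c) \<Longrightarrow>
       \<exists>\<tau>. Im \<tau> > 0 \<and> torval m \<phi> \<tau> \<xi> \<eta> \<noteq> 0"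
  proof (rule generic_nonvanishing[OF coeffs v_in_L p0])
    show "0 \<le> (\<Sum>j=1..CARD('n). norm (v j))" by (intro sum_nonneg) auto
  qed blast+
  define C0 where "C0 = \<Gamma> #>\<^bsub>SL2Z\<^esub> mat 1"
  have C0: "C0 \<in> rcosets\<^bsub>SL2Z\<^esub> \<Gamma>"
    unfolding C0_def by (rule SL2Z.rcosetsI[OF subgroup.subset[OF subgroup_Gamma]]) (simp add: carrier_SL2Z)
  show ?thesis
  proof (rule that)
    fix R B assume B: "B \<subseteq> grid R"
      and s: "\<And>a. a \<in> B \<Longrightarrow> sqrt (real m / 2) * norm (torsion R a) \<le> sqrt N"
    define h where "h = 2 * real R + 1"
    have h: "h > 0" by (simp add: h_def)
    define g where "g a = (sqrt N - sqrt (real m / 2) * norm (torsion R a))\<^sup>2" for a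
    define G where "G = {a \<in> B. \<forall>(w, c)\<in>Z. w \<bullet> torsion R a \<noteq> c}"
    define \<nu> where "\<nu> = (\<lambda>(C, a, b :: nat \<Rightarrow> int). if C = C0 \<and> a \<in> B then g a else 0)"
    have finB: "finite B" using B finite_grid by (rule finite_subset)
    have finF: "finite (torsion_family R)"
      using finite_cosets finite_grid by (simp add: torsion_family_def)
    have g0: "g a \<ge> 0" for a by (simp add: g_def)
    have gN: "g a \<le> N" if "a \<in> B" for a
    proof -
      have "g a \<le> (sqrt N)\<^sup>2" unfolding g_def using s[OF that] by (intro power_mono) auto
      then show ?thesis using N by simp
    qed
    have "(\<Sum>x | x \<in> torsion_family R \<and> (\<exists>\<tau>. Im \<tau> > 0 \<and> torsion_value R x \<tau> \<noteq> 0). \<nu> x) \<le>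
       real k * (real (SL2Z_index \<Gamma>) * h ^ CARD('n) * h ^ CARD('n)) * 5 / 54"
      unfolding h_def
    proof (rule torsion_orders_bound)
      fix x assume x: "x \<in> torsion_family R"
      obtain C a b where e: "x = (C, a, b)" by (metis prod_cases3)
      have C: "C \<in> rcosets\<^bsub>SL2Z\<^esub> \<Gamma>" using x by (simp add: e torsion_family_def)
      show "\<exists>c\<ge>0. \<forall>\<tau>. Im \<tau> \<ge> 1/2 \<longrightarrow> norm (torsion_value R x \<tau>) \<le> c * exp (- 2 * pi * \<nu> x * Im \<tau>)"
      proof (cases "C = C0 \<and> a \<in> B")
        case True
        have "\<exists>c\<ge>0. \<forall>\<tau>. Im \<tau> \<ge> 1/2 \<longrightarrow> norm (torval m \<phi> \<tau> (torsion R a) (torsion R b)) \<le> c * exp (- 2 * pi * g a * Im \<tau>)"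
          by (rule torval_decay[OF coeffs N f]) (use s True in \<open>auto simp: g_def\<close>)
        moreover have "norm (torsion_value R x \<tau>) = norm (torval m \<phi> \<tau> (torsion R a) (torsion R b))"
          if "Im \<tau> \<ge> 1/2" for \<tau>
          using norm_holval_identity_coset[of \<tau>] that True by (simp add: e torsion_value_def C0_def)
        moreover have "\<nu> x = g a" using True by (simp add: e \<nu>_def)
        ultimately show ?thesis by simp
      next
        case False
        have A: "rep C \<in> carrier SL2Z" by (rule rep_in[OF C])
        then obtain D' f' where f': "has_jacobi_coeffs L m (slash (int k) m \<phi> (rep C)) D' f'"
          using jacobi unfolding jacobi_forms_def jacobi_expansion_iff by blast
        \<comment> \<open>At the other cusps and outside B nonnegative exponents suffice: the order
          bound is used with N = 0 and \<nu> = 0.\<close>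
        have "\<exists>c\<ge>0. \<forall>\<tau>. Im \<tau> \<ge> 1/2 \<longrightarrow>
            norm (torval m (slash (int k) m \<phi> (rep C)) \<tau> (torsion R a) (torsion R b)) \<le> c * exp (- 2 * pi * 0 * Im \<tau>)"
          by (rule torval_decay[OF f', of 0]) (auto simp: q_exponents_def)
        moreover have "norm (torsion_value R x \<tau>) = norm (torval m (slash (int k) m \<phi> (rep C)) \<tau> (torsion R a) (torsion R b))"
          if "Im \<tau> \<ge> 1/2" for \<tau>
          using norm_holval[OF A, of \<tau>] that by (simp add: e torsion_value_def)
        moreover have "\<nu> x = 0" using False by (auto simp: e \<nu>_def)
        ultimately show ?thesis by simp
      qed
    qed
    moreover have "(\<Sum>a\<in>G. g a) * h ^ CARD('n) \<le>
        (\<Sum>x | x \<in> torsion_family R \<and> (\<exists>\<tau>. Im \<tau> > 0 \<and> torsion_value R x \<tau> \<noteq> 0). \<nu> x)"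
    proof -
      have "(\<Sum>a\<in>G. g a) * h ^ CARD('n) = (\<Sum>a\<in>G. \<Sum>b\<in>grid R. g a)"
        using card_grid[of R] by (simp add: h_def sum_distrib_right mult.commute)
      also have "\<dots> = (\<Sum>x\<in>G \<times> grid R. g (fst x))"
        unfolding sum.cartesian_product by (simp add: case_prod_unfold)
      also have "\<dots> = (\<Sum>x\<in>G \<times> grid R. \<nu> (C0, x))"
        by (intro sum.cong) (auto simp: \<nu>_def G_def)
      also have "\<dots> = (\<Sum>x\<in>Pair C0 ` (G \<times> grid R). \<nu> x)"
        by (subst sum.reindex) (auto intro: inj_onI)
      also have "\<dots> \<le> (\<Sum>x | x \<in> torsion_family R \<and> (\<exists>\<tau>. Im \<tau> > 0 \<and> torsion_value R x \<tau> \<noteq> 0). \<nu> x)"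
      proof (rule sum_mono2)
        show "finite {x \<in> torsion_family R. \<exists>\<tau>. Im \<tau> > 0 \<and> torsion_value R x \<tau> \<noteq> 0}" using finF by simp
        show "Pair C0 ` (G \<times> grid R) \<subseteq> {x \<in> torsion_family R. \<exists>\<tau>. Im \<tau> > 0 \<and> torsion_value R x \<tau> \<noteq> 0}"
        proof clarify
          fix a b assume a: "a \<in> G" and b: "b \<in> grid R"
          have aR: "a \<in> grid R" using a B by (auto simp: G_def)
          have "\<exists>\<tau>. Im \<tau> > 0 \<and> torval m \<phi> \<tau> (torsion R a) (torsion R b) \<noteq> 0"
            using a by (intro Z(3) norm_torsion_bounded[OF aR]) (auto simp: G_def)
          then obtain \<tau> where \<tau>: "Im \<tau> > 0" "torval m \<phi> \<tau> (torsion R a) (torsion R b) \<noteq> 0" by blast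
          then have "torsion_value R (C0, a, b) \<tau> \<noteq> 0"
            using norm_holval_identity_coset[OF \<tau>(1), of "torsion R a" "torsion R b"]
            by (auto simp: torsion_value_def C0_def)
          then show "(C0, a, b) \<in> torsion_family R \<and> (\<exists>\<tau>. Im \<tau> > 0 \<and> torsion_value R (C0, a, b) \<tau> \<noteq> 0)"
            using aR b C0 \<tau> by (auto simp: torsion_family_def)
        qed
        show "\<nu> x \<ge> 0" for x using g0 by (simp add: \<nu>_def split: prod.splits)
      qed
      finally show ?thesis .
    qed
    ultimately have "(\<Sum>a\<in>G. g a) * h ^ CARD('n) \<le>
        (real k * real (SL2Z_index \<Gamma>) * 5 / 54 * h ^ CARD('n)) * h ^ CARD('n)"
      by (simp add: mult_ac)
    then have good: "(\<Sum>a\<in>G. g a) \<le> real k * real (SL2Z_index \<Gamma>) * 5 / 54 * h ^ CARD('n)"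
      using h by simp
    \<comment> \<open>The discarded points lie on the finitely many hyperplanes in Z.\<close>
    have "B - G \<subseteq> (\<Union>(w, c)\<in>Z. {a \<in> grid R. w \<bullet> torsion R a = c})"
      using B by (auto simp: G_def)
    then have "card (B - G) \<le> card (\<Union>(w, c)\<in>Z. {a \<in> grid R. w \<bullet> torsion R a = c})"
      using Z(1) finite_grid by (intro card_mono finite_UN_I) auto
    also have "\<dots> \<le> (\<Sum>(w, c)\<in>Z. card {a \<in> grid R. w \<bullet> torsion R a = c})"
      using card_UN_le[OF Z(1), of "\<lambda>(w, c). {a \<in> grid R. w \<bullet> torsion R a = c}"]
      by (simp add: case_prod_unfold)
    also have "\<dots> \<le> (\<Sum>(w, c)\<in>Z. (2 * R + 1) ^ (CARD('n) - 1))"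
    proof (intro sum_mono, clarify)
      fix w c assume "(w, c) \<in> Z"
      then have "w \<noteq> 0" using Z(2) by blast
      have cardR: "card {- int R..int R} = 2 * R + 1" by (simp add: nat_add_distrib nat_mult_distrib)
      from card_hyperplane_grid[OF \<open>w \<noteq> 0\<close>, of h "{- int R..int R}" c, unfolded cardR] h
      show "card {a \<in> grid R. w \<bullet> torsion R a = c} \<le> (2 * R + 1) ^ (CARD('n) - 1)"
        by (simp add: grid_def torsion_def comb_def h_def)
    qed
    also have "\<dots> = card Z * (2 * R + 1) ^ (CARD('n) - 1)" by (simp add: case_prod_unfold)
    finally have "real (card (B - G)) \<le> real (card Z * (2 * R + 1) ^ (CARD('n) - 1))"
      by (rule of_nat_mono)
    then have bad: "real (card (B - G)) \<le> real (card Z) * h ^ (CARD('n) - 1)"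
      by (simp add: h_def add.commute)
    have "(\<Sum>a\<in>B. g a) = (\<Sum>a\<in>G. g a) + (\<Sum>a\<in>B - G. g a)"
      using finB by (subst add.commute, intro sum.subset_diff) (auto simp: G_def)
    also have "(\<Sum>a\<in>B - G. g a) \<le> real (card (B - G)) * N"
      using gN by (intro sum_bounded_above) auto
    also have "\<dots> \<le> (real (card Z) * h ^ (CARD('n) - 1)) * N"
      using bad N by (rule mult_right_mono)
    finally show "(\<Sum>a\<in>B. (sqrt N - sqrt (real m / 2) * norm (torsion R a))\<^sup>2) \<le>
        real k * real (SL2Z_index \<Gamma>) * 5 / 54 * (2 * real R + 1) ^ CARD('n) +
        (real (card Z) * N) * (2 * real R + 1) ^ (CARD('n) - 1)"
      using good by (simp add: g_def h_def mult_ac)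
  qed
qed

end

section \<open>The vanishing theorem\<close>

lemma qexp_of_rat: "qexp (of_rat r) \<tau> = exp (2 * of_real pi * \<i> * of_rat r * \<tau>)"
proof -
  have "complex_of_real (of_rat r) = of_rat r" by (cases r) (simp add: of_rat_rat)
  then show ?thesis by (simp add: qexp_def)
qed

lemma q_exponents_gap:
  assumes "D > 0" "r \<in> q_exponents D" "s \<in> q_exponents D" "r < s"
  shows "r + 1 / of_nat D \<le> s"
proof -
  obtain i j where ij: "of_nat D * r = of_int i" "of_nat D * s = of_int j"
    using assms by (auto simp: q_exponents_def elim!: Ints_cases)
  have "of_nat D * r < of_nat D * s" using assms by simp
  then have "i < j" unfolding ij by simp
  then have "of_int i + 1 \<le> (of_int j :: rat)" by linarith
  then have "of_nat D * (r + 1 / of_nat D) \<le> of_nat D * s"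
    using ij assms(1) by (simp add: distrib_left)
  then show ?thesis using assms(1) by simp
qed

text \<open>The least exponent with a nonzero coefficient would dominate, bounded denominators
  supplying the gap 1 / D. Thus the zero form has order \<infinity> and belongs to the space for
  every N.\<close>

lemma q_expansion_zero_unique:
  assumes "is_q_expansion (\<lambda>\<tau> z. 0) c"
  shows "c r z = 0"
proof (rule ccontr)
  assume nz: "c r z \<noteq> 0"
  obtain D where D: "D > 0" and out: "\<And>r z. r \<notin> q_exponents D \<Longrightarrow> c r z = 0"
    and hs: "\<And>\<tau> z. Im \<tau> > 0 \<Longrightarrow>
       ((\<lambda>r. c r z * exp (2 * of_real pi * \<i> * of_rat r * \<tau>)) has_sum 0) (q_exponents D)"
    using assms by (auto simp: is_q_expansion_def)
  define A where "A = {s \<in> q_exponents D. real_of_rat s \<le> of_rat r \<and> c s z \<noteq> 0}"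
  have "A \<subseteq> {s \<in> q_exponents D. real_of_rat s \<le> of_rat r}" by (auto simp: A_def)
  then have fin: "finite A" by (rule finite_subset) (rule finite_q_exponents_le[OF D])
  have rA: "r \<in> A" using out nz by (auto simp: A_def)
  define s where "s = Min A"
  have sA: "s \<in> A" unfolding s_def using fin rA by (intro Min_in) auto
  have min: "s \<le> t" if "t \<in> q_exponents D" "c t z \<noteq> 0" for t
  proof (cases "t \<le> r")
    case True
    then have "t \<in> A" using that by (simp add: A_def of_rat_less_eq)
    then show ?thesis unfolding s_def using fin by (intro Min_le) auto
  next
    case False
    moreover have "s \<le> r" unfolding s_def using fin rA by (intro Min_le) auto
    ultimately show ?thesis by simp
  qed
  have "\<exists>\<tau>. Im \<tau> > 0 \<and> (0 :: complex) \<noteq> 0"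
  proof (rule qexp_series_nonzero[where f = "\<lambda>t. c t z" and E = of_rat and ?i0.0 = s and \<delta> = "1 / real D"
        and A = "q_exponents D" and \<psi> = "\<lambda>_. 0"])
    show "((\<lambda>t. c t z * qexp (of_rat t) \<tau>) has_sum 0) (q_exponents D)" if "Im \<tau> > 0" for \<tau>
      unfolding qexp_of_rat by (rule hs[OF that])
    show "of_rat s + 1 / real D \<le> of_rat t"
      if t: "t \<in> q_exponents D" "c t z \<noteq> 0" "t \<noteq> s" for t
    proof -
      have "s < t" using min[OF t(1,2)] t(3) by simp
      then have "s + 1 / of_nat D \<le> t" using sA t by (intro q_exponents_gap D) (auto simp: A_def)
      then have "real_of_rat (s + 1 / of_nat D) \<le> of_rat t" by (simp only: of_rat_less_eq)
      then show ?thesis by (simp add: of_rat_add of_rat_divide)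
    qed
  qed (use sA D in \<open>auto simp: A_def\<close>)
  then show False by simp
qed

text \<open>Linear independence of exponentials. Let l0 have maximal norm among the l with nonzero
  coefficient; then l \<bullet> l0 is strictly largest at l = l0, and along z = - \<tau> l0 that
  term dominates.\<close>

lemma finite_character_sum_zero:
  fixes f :: "real ^ 'n \<Rightarrow> complex"
  assumes fin: "finite A" and zero: "\<And>z. (\<Sum>l\<in>A. f l * exp (2 * of_real pi * \<i> * cform (cvec l) z)) = 0"
    and "l \<in> A"
  shows "f l = 0"
proof (rule ccontr)
  assume nz: "f l \<noteq> 0"
  define A' where "A' = {l \<in> A. f l \<noteq> 0}"
  have A': "finite A'" "l \<in> A'" using fin nz \<open>l \<in> A\<close> by (auto simp: A'_def)
  then have "Max (norm ` A') \<in> norm ` A'" by (intro Max_in) auto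
  then obtain l0 where "l0 \<in> A'" "Max (norm ` A') = norm l0" by auto
  then have l0: "l0 \<in> A'" "\<And>l. l \<in> A' \<Longrightarrow> norm l \<le> norm l0"
    using Max_ge[of "norm ` A'"] A'(1) by auto
  have less: "l \<bullet> l0 < l0 \<bullet> l0" if "l \<in> A'" "l \<noteq> l0" for l
  proof -
    have "(l - l0) \<bullet> (l - l0) > 0" using that by simp
    then have "2 * (l \<bullet> l0) < l \<bullet> l + l0 \<bullet> l0"
      by (simp add: inner_diff_left inner_diff_right inner_commute)
    moreover have "l \<bullet> l \<le> l0 \<bullet> l0"
      using l0(2)[OF that(1)] by (simp add: norm_eq_sqrt_inner)
    ultimately show ?thesis by simp
  qed
  define \<delta> where "\<delta> = Min (insert 1 ((\<lambda>l. l0 \<bullet> l0 - l \<bullet> l0) ` (A' - {l0})))"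
  have \<delta>: "\<delta> > 0" "\<And>l. l \<in> A' \<Longrightarrow> l \<noteq> l0 \<Longrightarrow> \<delta> \<le> l0 \<bullet> l0 - l \<bullet> l0"
  proof -
    show "\<delta> > 0" unfolding \<delta>_def using A' less by (subst Min_gr_iff) auto
    show "\<delta> \<le> l0 \<bullet> l0 - l \<bullet> l0" if "l \<in> A'" "l \<noteq> l0" for l
      unfolding \<delta>_def using A' that by (intro Min_le) auto
  qed
  have "\<exists>\<tau>. Im \<tau> > 0 \<and> (0 :: complex) \<noteq> 0"
  proof (rule qexp_series_nonzero[where f = f and E = "\<lambda>l. - (l \<bullet> l0)" and ?i0.0 = l0 and \<delta> = \<delta>
        and A = A and \<psi> = "\<lambda>_. 0"])
    show "((\<lambda>l. f l * qexp (- (l \<bullet> l0)) \<tau>) has_sum 0) A" for \<tau>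
    proof (rule has_sum_finiteI[OF fin])
      have "(\<Sum>l\<in>A. f l * qexp (- (l \<bullet> l0)) \<tau>) =
          (\<Sum>l\<in>A. f l * exp (2 * of_real pi * \<i> * cform (cvec l) ((- \<tau>) *s cvec l0)))"
        unfolding qexp_def cform_simps by (intro sum.cong refl) (simp add: mult_ac)
      then show "0 = (\<Sum>l\<in>A. f l * qexp (- (l \<bullet> l0)) \<tau>)" using zero by simp
    qed
    show "- (l0 \<bullet> l0) + \<delta> \<le> - (l \<bullet> l0)" if "l \<in> A" "f l \<noteq> 0" "l \<noteq> l0" for l
      using \<delta>(2)[of l] that by (simp add: A'_def)
  qed (use l0 \<delta> in \<open>auto simp: A'_def\<close>)
  then show False by simp
qed

text \<open>For each exponent the support condition leaves finitely many dual vectors, so the double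
  series can be summed over them first and gives a q-expansion. A coefficient function that vanishes
  for all z then has only zero Fourier coefficients, by independence of exponentials.\<close>

lemma (in orthogonal_frame) jacobi_coeffs_ord_ge:
  assumes coeffs: "has_jacobi_coeffs L m \<phi> D f"
    and L: "\<And>j. j \<in> {1..CARD('n)} \<Longrightarrow> v j \<in> L"
    and ord: "ord_infinity \<phi> \<ge> ereal N"
    and rl: "r \<in> q_exponents D" "l \<in> dual_lattice L" "f r l \<noteq> 0"
  shows "of_rat r \<ge> N"
proof (rule ccontr)
  assume less: "\<not> of_rat r \<ge> N"
  have D: "D > 0" using coeffs by (simp add: has_jacobi_coeffs_def)
  define S where "S s = {l \<in> dual_lattice L. l \<bullet> l \<le> 2 * real_of_rat s * real m}" for s
  have finS: "finite (S s)" for s unfolding S_def by (rule finite_dual_ball[OF L])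
  have f0: "f s l = 0" if "s \<in> q_exponents D" "l \<in> dual_lattice L" "l \<notin> S s" for s l
    using coeffs that unfolding has_jacobi_coeffs_def S_def by blast
  define c where "c s z = (if s \<in> q_exponents D then \<Sum>l\<in>S s. f s l * exp (2 * of_real pi * \<i> * cform (cvec l) z) else 0)"
    for s and z :: "complex ^ 'n"
  have "is_q_expansion \<phi> c"
    unfolding is_q_expansion_def
  proof (intro exI[of _ D] conjI allI impI)
    fix \<tau> and z :: "complex ^ 'n" assume \<tau>: "Im \<tau> > 0"
    have hs: "((\<lambda>(s, l). f s l * exp (2 * of_real pi * \<i> * (of_rat s * \<tau> + cform (cvec l) z)))
        has_sum \<phi> \<tau> z) (q_exponents D \<times> dual_lattice L)"
      using coeffs \<tau> by (simp add: has_jacobi_coeffs_def)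
    show "((\<lambda>s. c s z * exp (2 * of_real pi * \<i> * of_rat s * \<tau>)) has_sum \<phi> \<tau> z) (q_exponents D)"
    proof (rule has_sum_SigmaD[OF hs])
      fix s assume s: "s \<in> q_exponents D"
      have "c s z * exp (2 * of_real pi * \<i> * of_rat s * \<tau>) =
          (\<Sum>l\<in>S s. f s l * exp (2 * of_real pi * \<i> * (of_rat s * \<tau> + cform (cvec l) z)))"
        unfolding c_def if_P[OF s] sum_distrib_right
        by (intro sum.cong refl) (simp add: exp_add distrib_left mult_ac)
      moreover have "((\<lambda>l. f s l * exp (2 * of_real pi * \<i> * (of_rat s * \<tau> + cform (cvec l) z)))
         has_sum (\<Sum>l\<in>S s. f s l * exp (2 * of_real pi * \<i> * (of_rat s * \<tau> + cform (cvec l) z)))) (dual_lattice L)"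
        using f0[OF s] by (intro has_sum_finite_neutralI[OF finS]) (auto simp: S_def)
      ultimately show "((\<lambda>l. case (s, l) of (s, l) \<Rightarrow> f s l * exp (2 * of_real pi * \<i> * (of_rat s * \<tau> + cform (cvec l) z)))
         has_sum c s z * exp (2 * of_real pi * \<i> * of_rat s * \<tau>)) (dual_lattice L)"
        by simp
    qed
  qed (auto simp: c_def D)
  \<comment> \<open>A nonzero value would put r < N into the set whose infimum is the order.\<close>
  have "c r z = 0" for z
  proof (rule ccontr)
    assume "c r z \<noteq> 0"
    then have "ord_infinity \<phi> \<le> ereal (of_rat r)"
      unfolding ord_infinity_def using \<open>is_q_expansion \<phi> c\<close> by (intro Inf_lower) blast
    then have "ereal N \<le> ereal (of_rat r)" using ord by (rule order.trans[rotated])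
    then show False using less by simp
  qed
  then have zero: "(\<Sum>l\<in>S r. f r l * exp (2 * of_real pi * \<i> * cform (cvec l) z)) = 0" for z
    using rl(1) by (simp add: c_def)
  have "l \<in> S r" using f0 rl by blast
  from finite_character_sum_zero[OF finS zero this] rl(3) show False by simp
qed

lemma zero_in_jacobi_forms_vanishing:
  fixes L :: "(real ^ 'n) set"
  shows "(\<lambda>\<tau> z. 0) \<in> jacobi_forms_vanishing k L m \<Gamma> ch N"
proof -
  define zero where "zero = (\<lambda>(\<tau> :: complex) (z :: complex ^ 'n). 0 :: complex)"
  have "jacobi_expansion L m zero"
    unfolding jacobi_expansion_def zero_def
    by (intro exI[of _ "\<lambda>_ _. 0"] exI[of _ 1]) (simp add: case_prod_unfold)
  moreover have "slash k m zero A = zero" for A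
    by (simp add: slash_def fun_eq_iff zero_def)
  moreover have "holomorphic_HxC zero"
    unfolding holomorphic_HxC_def zero_def
    by (intro allI impI exI[of _ "\<lambda>_. 0"]) (auto simp: case_prod_unfold)
  moreover have "ord_infinity zero = \<infinity>"
  proof -
    have "{ereal (real_of_rat r) |r. \<exists>c. is_q_expansion zero c \<and> (\<exists>z. c r z \<noteq> 0)} = {}"
      using q_expansion_zero_unique unfolding zero_def by blast
    then show ?thesis unfolding ord_infinity_def by (simp only: Inf_empty top_ereal_def)
  qed
  ultimately have "zero \<in> jacobi_forms_vanishing k L m \<Gamma> ch N"
    by (simp add: jacobi_forms_vanishing_def jacobi_forms_def) (simp add: zero_def)
  then show ?thesis by (simp add: zero_def)
qed

lemma contains_A1_sumE:
  assumes "contains_A1_sum L n d"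
  obtains v where "\<And>a. (\<Sum>j=1..n. real_of_int (a j) *\<^sub>R v j) \<in> L"
    "\<And>i j. i \<in> {1..n} \<Longrightarrow> j \<in> {1..n} \<Longrightarrow> v i \<bullet> v j = (if i = j then 2 * real (d j) else 0)"
proof -
  obtain M f where M: "M \<subseteq> L" "bij_betw f (A1_sum n) M"
    and f: "\<And>x y. x \<in> A1_sum n \<Longrightarrow> y \<in> A1_sum n \<Longrightarrow> f x \<bullet> f y = of_int (A1_sum_form n d x y)"
    using assms unfolding contains_A1_sum_def by blast
  define e where "e j = (\<lambda>i. if i = j then 1 else 0 :: int)" for j :: nat
  have e: "e j \<in> A1_sum n" if "j \<in> {1..n}" for j using that by (auto simp: e_def A1_sum_def)
  define v where "v j = f (e j)" for j
  have form_e: "A1_sum_form n d x (e j) = 2 * int (d j) * x j" if "j \<in> {1..n}" for x j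
  proof -
    have "A1_sum_form n d x (e j) = (\<Sum>i=1..n. if i = j then 2 * int (d i) * x i else 0)"
      unfolding A1_sum_form_def e_def by (intro sum.cong) auto
    then show ?thesis using that by simp
  qed
  have vv: "v i \<bullet> v j = (if i = j then 2 * real (d j) else 0)" if "i \<in> {1..n}" "j \<in> {1..n}" for i j
    using f[OF e[OF that(1)] e[OF that(2)]] form_e[OF that(2), of "e i"] by (simp add: v_def e_def)
  have "(\<Sum>j=1..n. real_of_int (a j) *\<^sub>R v j) \<in> L" for a
  proof -
    define x where "x = (\<lambda>j. if j \<in> {1..n} then a j else 0)"
    have x: "x \<in> A1_sum n" by (auto simp: x_def A1_sum_def)
    define w where "w = (\<Sum>j=1..n. real_of_int (a j) *\<^sub>R v j)"
    define q where "q = (\<Sum>j=1..n. 2 * real (d j) * real_of_int (a j) * real_of_int (a j))"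
    have xv: "f x \<bullet> v j = 2 * real (d j) * real_of_int (a j)" if "j \<in> {1..n}" for j
      using f[OF x e[OF that]] form_e[OF that, of x] that by (simp add: v_def x_def)
    have xw: "f x \<bullet> w = q"
      unfolding w_def q_def inner_sum_right using xv by (intro sum.cong) auto
    have xx: "f x \<bullet> f x = q"
      unfolding f[OF x x] A1_sum_form_def of_int_sum q_def by (intro sum.cong) (auto simp: x_def)
    have "v j \<bullet> w = 2 * real (d j) * real_of_int (a j)" if "j \<in> {1..n}" for j
    proof -
      have "v j \<bullet> w = (\<Sum>i=1..n. if j = i then 2 * real (d i) * real_of_int (a i) else 0)"
        unfolding w_def inner_sum_right using vv[OF that] by (intro sum.cong) auto
      then show ?thesis using that by simp
    qed
    then have ww: "w \<bullet> w = q"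
      unfolding q_def by (subst w_def, unfold inner_sum_left) (intro sum.cong, auto)
    \<comment> \<open>All three inner products of \<open>f x\<close> and \<open>w\<close> equal q,
      so definiteness identifies the image of x with the integral combination of the v j.\<close>
    have "(f x - w) \<bullet> (f x - w) = 0"
      using xw xx ww by (simp add: inner_diff_left inner_diff_right inner_commute)
    then have "f x = w" by simp
    moreover have "f x \<in> M" using M(2) x by (auto simp: bij_betw_def)
    ultimately show ?thesis using M(1) by (auto simp: w_def)
  qed
  then show ?thesis using vv by (rule that)
qed

theorem theorem4p2:
  fixes k m n N :: nat
    and L :: "(real ^ 'n) set"
    and d :: "nat \<Rightarrow> nat"
    and \<Gamma> :: "(int ^ 2 ^ 2) set"
    and ch :: "int ^ 2 ^ 2 \<Rightarrow> complex"
  assumes "k > 0" and "m > 0" and "n > 0" and "N > 0"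
    and "CARD('n) = n"
    and "even_lattice L"
    and "\<And>j. j \<in> {1..n} \<Longrightarrow> d j > 0"
    and "\<And>i j. 1 \<le> i \<Longrightarrow> i < j \<Longrightarrow> j \<le> n \<Longrightarrow> d i \<le> d j"
    and "contains_A1_sum L n d"
    and "congruence_subgroup \<Gamma>"
    and "finite_order_character \<Gamma> ch"
    and "real k < 3 * 2 powr (3 - 2 ^ n) * real (d 1) * real m"
    and "real N > C_const n * real (SL2Z_index \<Gamma>) *
           (\<Prod>j=1..n. real (d j) powr (2 powr (real j - 1 - real n))) *
           real k powr (2 powr (- real n)) * real m powr (1 - 2 powr (- real n))"
  shows "jacobi_forms_vanishing (int k) L m \<Gamma> ch N = {\<lambda>\<tau> z. 0}"
proof -
  have "\<phi> = (\<lambda>\<tau> z. 0)" if \<phi>: "\<phi> \<in> jacobi_forms_vanishing (int k) L m \<Gamma> ch N" for \<phi>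
  proof (rule ccontr)
    assume nz: "\<phi> \<noteq> (\<lambda>\<tau> z. 0)"
    have jac: "\<phi> \<in> jacobi_forms (int k) L m \<Gamma> ch" and ord: "ord_infinity \<phi> \<ge> ereal (real N)"
      using \<phi> by (auto simp: jacobi_forms_vanishing_def)
    obtain v where v: "\<And>a. (\<Sum>j=1..n. real_of_int (a j) *\<^sub>R v j) \<in> L"
      "\<And>i j. i \<in> {1..n} \<Longrightarrow> j \<in> {1..n} \<Longrightarrow> v i \<bullet> v j = (if i = j then 2 * real (d j) else 0)"
      using contains_A1_sumE[OF assms(9)] by blast
    interpret jacobi_frame v d L \<Gamma> ch k m \<phi>
      by unfold_locales (use v assms(7,10,11) jac in \<open>simp_all only: assms(5)\<close>)
    have "jacobi_expansion L m (slash (int k) m \<phi> (mat 1))"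
      using jac by (simp add: jacobi_forms_def carrier_SL2Z)
    moreover have "slash (int k) m \<phi> (mat 1) = \<phi>" by (intro ext) (rule slash_one)
    ultimately obtain D f where coeffs: "has_jacobi_coeffs L m \<phi> D f"
      unfolding jacobi_expansion_iff by auto
    have "\<exists>p0\<in>q_exponents D \<times> dual_lattice L. f (fst p0) (snd p0) \<noteq> 0"
    proof (rule ccontr)
      assume *: "\<not> ?thesis"
      have "\<phi> \<tau> z = 0" for \<tau> z
      proof (cases "Im \<tau> > 0")
        case True
        then have "((\<lambda>(r, l). f r l * exp (2 * of_real pi * \<i> * (of_rat r * \<tau> + cform (cvec l) z)))
              has_sum \<phi> \<tau> z) (q_exponents D \<times> dual_lattice L)"
          using coeffs by (simp add: has_jacobi_coeffs_def)
        moreover have "((\<lambda>(r, l). f r l * exp (2 * of_real pi * \<i> * (of_rat r * \<tau> + cform (cvec l) z)))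
              has_sum 0) (q_exponents D \<times> dual_lattice L)"
          using * by (intro has_sum_0) auto
        ultimately show ?thesis by (rule has_sum_unique)
      next
        case False
        then show ?thesis using jac by (simp add: jacobi_forms_def)
      qed
      then have "\<phi> = (\<lambda>\<tau> z. 0)" by (intro ext)
      with nz show False ..
    qed
    then obtain p0 where p0: "p0 \<in> q_exponents D \<times> dual_lattice L" "f (fst p0) (snd p0) \<noteq> 0" by blast
    obtain K where K: "\<And>R B. B \<subseteq> grid R \<Longrightarrow>
      (\<And>a. a \<in> B \<Longrightarrow> sqrt (real m / 2) * norm (torsion R a) \<le> sqrt (real N)) \<Longrightarrow>
      (\<Sum>a\<in>B. (sqrt (real N) - sqrt (real m / 2) * norm (torsion R a))\<^sup>2) \<le>
        real k * real (SL2Z_index \<Gamma>) * 5 / 54 * (2 * real R + 1) ^ CARD('n) + K * (2 * real R + 1) ^ (CARD('n) - 1)"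
    proof (rule grid_inequality[OF coeffs of_nat_0_le_iff _ p0])
      show "real N \<le> of_rat r"
        if "r \<in> q_exponents D" "l \<in> dual_lattice L" "f r l \<noteq> 0" for r l
        by (rule jacobi_coeffs_ord_ge[OF coeffs v_in_L ord that])
    qed blast
    define E where "E j = real (d j) * real m" for j
    define \<beta> where "\<beta> = real k / 12"
    define x where "x = sqrt (real N)"
    have x2: "x\<^sup>2 = real N" and x0: "x > 0" using assms(4) by (simp_all add: x_def)
    have E: "E j > 0" if "1 \<le> j" "j \<le> n" for j using that assms(2,7) by (simp add: E_def)
    have "\<Gamma> #>\<^bsub>SL2Z\<^esub> mat 1 \<in> rcosets\<^bsub>SL2Z\<^esub> \<Gamma>"
      by (rule SL2Z.rcosetsI[OF subgroup.subset[OF subgroup_Gamma]]) (simp add: carrier_SL2Z)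
    then have "SL2Z_index \<Gamma> > 0" unfolding SL2Z_index_def using finite_cosets by (auto simp: card_gt_0_iff)
    then have index: "real (SL2Z_index \<Gamma>) \<ge> 1" by simp
    \<comment> \<open>Dividing the hypothesis by 12 turns 3 * 2^(3 - 2^n) into 2 *
      (1/2)^(2^n).\<close>
    have small: "\<beta> < 2 * E 1 * (1/2) ^ (2 ^ n)"
    proof -
      have "(2::real) powr (3 - 2 ^ n) = 8 * (1/2) ^ (2 ^ n)"
        using powr_realpow[of 2 "2 ^ n"] by (simp add: powr_diff power_one_over)
      then show ?thesis using assms(12) by (simp add: \<beta>_def E_def mult_ac)
    qed
    have bound: "real (SL2Z_index \<Gamma>) * slice_bound \<beta> E n \<le> x\<^sup>2"
      using assms(13) slice_bound_closed_form[OF assms(1,2), of d n]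
      by (simp add: x2 \<beta>_def E_def[abs_def] mult_ac)
    obtain \<rho> where \<rho>: "\<And>j. j \<in> {1..n} \<Longrightarrow> 0 < \<rho> j \<and> \<rho> j \<le> 1/2"
      "(\<Sum>j=1..n. E j * (\<rho> j)\<^sup>2) \<le> x\<^sup>2"
      "real (SL2Z_index \<Gamma>) * (10 / 9 * \<beta>) < (\<Prod>j=1..n. 2 * \<rho> j) *
          (x\<^sup>2 - x * (\<Sum>j=1..n. sqrt (E j) * \<rho> j) + (\<Sum>j=1..n. E j * (\<rho> j)\<^sup>2) / 3)"
    proof (rule exists_averaging_box[where D = E and \<beta> = \<beta> and n = n and x = x, OF _ _ _ _ small index x0 bound])
      show "E i \<le> E j" if "1 \<le> i" "i < j" "j \<le> n" for i j
        using assms(8)[OF that] by (simp add: E_def mult_right_mono)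
    qed (use assms(1,3) E in \<open>auto simp: \<beta>_def\<close>)
    have "(\<Prod>j=1..n. 2 * \<rho> j) *
          (x\<^sup>2 - x * (\<Sum>j=1..n. sqrt (E j) * \<rho> j) + (\<Sum>j=1..n. E j * (\<rho> j)\<^sup>2) / 3) \<le>
        real k * real (SL2Z_index \<Gamma>) * 5 / 54"
    proof (rule box_average_limit)
      fix R :: nat
      define h where "h = 2 * real R + 1"
      define r where "r j = nat \<lfloor>\<rho> j * h\<rfloor>" for j
      define B where "B = PiE {1..n} (\<lambda>j. {- int (r j)..int (r j)})"
      have h: "h > 0" by (simp add: h_def)
      have r: "real (r j) \<le> \<rho> j * h" if "j \<in> {1..n}" for j
        using \<rho>(1)[OF that] h by (simp add: r_def)
      have rR: "r j \<le> R" if "j \<in> {1..n}" for j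
      proof -
        \<comment> \<open>Half of h = 2R + 1 is R + 1/2, and r j is an integer, so r j \<le> R: the
          box fits into the grid.\<close>
        have "\<rho> j * h \<le> 1/2 * h" using \<rho>(1)[OF that] h by (intro mult_right_mono) auto
        then have "real (r j) \<le> 1/2 * h" using r[OF that] by (rule order.trans[rotated])
        then show ?thesis by (simp add: h_def)
      qed
      have BR: "B \<subseteq> grid R"
        unfolding B_def grid_def assms(5) using rR by (intro PiE_mono) force
      have a_le: "\<bar>real_of_int (a j)\<bar> / h \<le> \<rho> j" if "a \<in> B" "j \<in> {1..n}" for a j
      proof -
        have "a j \<in> {- int (r j)..int (r j)}" using that unfolding B_def by (rule PiE_mem)
        then have "\<bar>real_of_int (a j)\<bar> \<le> real (r j)" by auto
        also have "\<dots> \<le> \<rho> j * h" by (rule r) fact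
        finally show ?thesis using h by (simp add: pos_divide_le_eq)
      qed
      have s2: "(sqrt (real m / 2) * norm (torsion R a))\<^sup>2 = (\<Sum>j=1..n. E j * (real_of_int (a j) / h)\<^sup>2)" for a
        using norm_torsion[of R a] by (simp add: assms(5) E_def h_def)
      have s1: "sqrt (real m / 2) * norm (torsion R a) \<le> (\<Sum>j=1..n. sqrt (E j) * (\<bar>real_of_int (a j)\<bar> / h))" for a
        using norm_torsion_le_sum[of R a] by (simp add: assms(5) E_def h_def)
      have sx: "sqrt (real m / 2) * norm (torsion R a) \<le> sqrt (real N)" if "a \<in> B" for a
      proof (rule real_le_rsqrt)
        have "(\<Sum>j=1..n. E j * (real_of_int (a j) / h)\<^sup>2) \<le> (\<Sum>j=1..n. E j * (\<rho> j)\<^sup>2)"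
        proof (intro sum_mono mult_left_mono)
          fix j assume j: "j \<in> {1..n}"
          have "(\<bar>real_of_int (a j)\<bar> / h)\<^sup>2 \<le> (\<rho> j)\<^sup>2"
            using a_le[OF that j] h by (intro power_mono) auto
          then show "(real_of_int (a j) / h)\<^sup>2 \<le> (\<rho> j)\<^sup>2" by (simp add: power_divide)
          show "0 \<le> E j" using E[of j] j by simp
        qed
        then show "(sqrt (real m / 2) * norm (torsion R a))\<^sup>2 \<le> real N" using s2 \<rho>(2) x2 by simp
      qed
      \<comment> \<open>The norm in the cross term is replaced by its larger coordinatewise bound,
        which only decreases the summand since x > 0.\<close>
      have "(\<Sum>a\<in>B. x\<^sup>2 - 2 * x * (\<Sum>j=1..n. sqrt (E j) * (\<bar>real_of_int (a j)\<bar> / h)) +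
          (\<Sum>j=1..n. E j * (real_of_int (a j) / h)\<^sup>2)) \<le>
         (\<Sum>a\<in>B. (sqrt (real N) - sqrt (real m / 2) * norm (torsion R a))\<^sup>2)"
      proof (intro sum_mono)
        fix a
        define s where "s = sqrt (real m / 2) * norm (torsion R a)"
        have "x * s \<le> x * (\<Sum>j=1..n. sqrt (E j) * (\<bar>real_of_int (a j)\<bar> / h))"
          using s1 x0 unfolding s_def by (intro mult_left_mono) auto
        moreover have "(sqrt (real N) - s)\<^sup>2 = x\<^sup>2 - 2 * (x * s) + s\<^sup>2"
          by (simp add: x_def power2_diff)
        ultimately show "x\<^sup>2 - 2 * x * (\<Sum>j=1..n. sqrt (E j) * (\<bar>real_of_int (a j)\<bar> / h)) +
          (\<Sum>j=1..n. E j * (real_of_int (a j) / h)\<^sup>2) \<le>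
           (sqrt (real N) - sqrt (real m / 2) * norm (torsion R a))\<^sup>2"
          using s2[of a] by (simp add: s_def)
      qed
      also have "\<dots> \<le> real k * real (SL2Z_index \<Gamma>) * 5 / 54 * h ^ n + K * h ^ (n - 1)"
        using K[OF BR sx] by (simp add: h_def assms(5))
      finally show "(\<Sum>a\<in>PiE {1..n} (\<lambda>j. {- int (nat \<lfloor>\<rho> j * (2 * real R + 1)\<rfloor>)..int (nat \<lfloor>\<rho> j * (2 * real R + 1)\<rfloor>)}).
        x\<^sup>2 - 2 * x * (\<Sum>j=1..n. sqrt (E j) * (\<bar>real_of_int (a j)\<bar> / (2 * real R + 1))) +
          (\<Sum>j=1..n. E j * (real_of_int (a j) / (2 * real R + 1))\<^sup>2)) \<le>
        real k * real (SL2Z_index \<Gamma>) * 5 / 54 * (2 * real R + 1) ^ n + K * (2 * real R + 1) ^ (n - 1)"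
        by (simp only: B_def r_def h_def)
    qed (use \<rho>(1) assms(3) in auto)
    \<comment> \<open>10/9 of k / 12 is 5/54 of k, so the strict lower bound from the box meets the
      upper bound from the average.\<close>
    moreover have "real (SL2Z_index \<Gamma>) * (10 / 9 * \<beta>) = real k * real (SL2Z_index \<Gamma>) * 5 / 54"
      by (simp add: \<beta>_def)
    ultimately show False using \<rho>(3) by linarith
  qed
  then show ?thesis using zero_in_jacobi_forms_vanishing by blast
qed

end
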